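(* Let $G:X\to[-0.4,0.4]$ be a real-analytic S-shaped function satisfying $G'(x)\le 25-50|G(x)|$ for all $x\in X$. Then, for any $N\in\mathbb N$, the map $\mathbf T_N:X^N\to X^N$ has a unique absolutely continuous invariant probability measure $\boldsymbol\mu_N$. Its density is strictly positive and real analytic. The systems $(\mathbf T_N,\boldsymbol\mu_N)$ are exponentially mixing in various strong senses; in particular, Hölder observables have exponentially decreasing correlations.
   Context: $X=[-\frac12,\frac12]$. For $|r|<\frac23$ let $f_r(x)=\dfrac{(r+4)x+(r+1)}{2rx+2}$ and $\alpha_r=-\frac r4$ (so $f_r(-\frac12)=-\frac12$, $f_r(\alpha_r)=\frac12$, $f_r(\frac12)=\frac32$). Define $T_r:X\to X$ by $T_r(x)=f_r(x)$ for $x\in[-\frac12,\alpha_r)$ and $T_r(x)=f_r(x)-1$ for $x\in(\alpha_r,\frac12]$ (the value at the single point $\alpha_r$ is left unspecified). A function $G:X\to[-0.4,0.4]$ is called S-shaped if $G'(x)>0$ and $G(-x)=-G(x)$ for all $x\in X$, and $G''(x)<0$ for $x>0$. For $\mathbf x=(x_1,\dots,x_N)\in X^N$ put $\phi(\mathbf x)=\frac1N\sum_{i=1}^N x_i$ and $r(\mathbf x)=G(\phi(\mathbf x))$. The globally coupled map $\mathbf T_N$ is given by $(\mathbf T_N(\mathbf x))_i=T_{r(\mathbf x)}(x_i)$, $i=1,\dots,N$. Absolute continuity and densities are with respect to $N$-dimensional Lebesgue measure on $X^N$. *)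

theory Defs
  imports "HOL-Analysis.Analysis"
begin

text \<open>
  Real analyticity in several variables: a function on an arbitrary (here: compact) set is analytic
  if it extends to an open neighbourhood on which it is locally the sum of a power series in the
  coordinates. A multi-index assigns an exponent to each basis vector; the summation over
  multi-indices is unordered, that is, absolute.
\<close>

definition has_power_series_at :: "('a::euclidean_space \<Rightarrow> real) \<Rightarrow> 'a \<Rightarrow> bool" where
  "has_power_series_at f a \<longleftrightarrow>
     (\<exists>\<rho>>0. \<exists>c :: ('a \<Rightarrow> nat) \<Rightarrow> real. \<forall>x\<in>ball a \<rho>.
        ((\<lambda>k. c k * (\<Prod>b\<in>Basis. ((x - a) \<bullet> b) ^ k b)) has_sum f x) (Basis \<rightarrow>\<^sub>E UNIV))"

definition real_analytic_on :: "('a::euclidean_space \<Rightarrow> real) \<Rightarrow> 'a set \<Rightarrow> bool" where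
  "real_analytic_on f S \<longleftrightarrow>
     (\<exists>U g. open U \<and> S \<subseteq> U \<and> (\<forall>x\<in>S. g x = f x) \<and> (\<forall>a\<in>U. has_power_series_at g a))"

definition unit_int :: "real set" where
  "unit_int = {-1/2..1/2}"

definition cube :: "(real ^ 'n) set" where
  "cube = {x. \<forall>i. x $ i \<in> unit_int}"

text \<open>The derivative of a function on the interval; it is one-sided at the end points.\<close>

definition int_deriv :: "(real \<Rightarrow> real) \<Rightarrow> real \<Rightarrow> real" where
  "int_deriv G x = vector_derivative G (at x within unit_int)"

definition S_shaped :: "(real \<Rightarrow> real) \<Rightarrow> bool" where
  "S_shaped G \<longleftrightarrow>
     G ` unit_int \<subseteq> {-2/5..2/5} \<and>
     G differentiable_on unit_int \<and> int_deriv G differentiable_on unit_int \<and>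
     (\<forall>x\<in>unit_int. int_deriv G x > 0 \<and> G (- x) = - G x) \<and>
     (\<forall>x\<in>unit_int. x > 0 \<longrightarrow> int_deriv (int_deriv G) x < 0)"

definition mob :: "real \<Rightarrow> real \<Rightarrow> real" where
  "mob r x = ((r + 4) * x + (r + 1)) / (2 * r * x + 2)"

definition break_pt :: "real \<Rightarrow> real" where
  "break_pt r = - r / 4"

text \<open>
  The value of the single-site map at the break point is left open; it is the parameter \<open>c r\<close>.
\<close>

definition site_map :: "(real \<Rightarrow> real) \<Rightarrow> real \<Rightarrow> real \<Rightarrow> real" where
  "site_map c r x =
     (if x < break_pt r then mob r x
      else if x > break_pt r then mob r x - 1
      else c r)"

definition mean_field :: "real ^ 'n \<Rightarrow> real" where
  "mean_field x = (\<Sum>i\<in>UNIV. x $ i) / real CARD('n)"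

definition coupled_map :: "(real \<Rightarrow> real) \<Rightarrow> (real \<Rightarrow> real) \<Rightarrow> real ^ 'n \<Rightarrow> real ^ 'n" where
  "coupled_map c G x = (\<chi> i. site_map c (G (mean_field x)) (x $ i))"

text \<open>
  Measures live on the Lebesgue sigma-algebra of the cube: the values \<open>c r\<close> are arbitrary, so the
  coupled map need not be Borel measurable on the null set where some coordinate is a break point.
\<close>

definition acip :: "(real ^ 'n \<Rightarrow> real ^ 'n) \<Rightarrow> (real ^ 'n) measure \<Rightarrow> bool" where
  "acip T \<mu> \<longleftrightarrow>
     sets \<mu> = sets (lebesgue_on cube) \<and> emeasure \<mu> (space \<mu>) = 1 \<and>
     absolutely_continuous (lebesgue_on cube) \<mu> \<and>
     T \<in> measurable \<mu> \<mu> \<and> distr \<mu> \<mu> T = \<mu>"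

text \<open>\<open>f\<close> is Hoelder continuous with exponent \<open>\<gamma>\<close> and Hoelder norm at most \<open>K\<close>.\<close>

definition hoelder_on :: "'a::metric_space set \<Rightarrow> real \<Rightarrow> real \<Rightarrow> ('a \<Rightarrow> real) \<Rightarrow> bool" where
  "hoelder_on S \<gamma> K f \<longleftrightarrow>
     (\<forall>x\<in>S. \<bar>f x\<bar> \<le> K) \<and> (\<forall>x\<in>S. \<forall>y\<in>S. \<bar>f x - f y\<bar> \<le> K * dist x y powr \<gamma>)"

definition correlation ::
    "'a measure \<Rightarrow> ('a \<Rightarrow> 'a) \<Rightarrow> ('a \<Rightarrow> real) \<Rightarrow> ('a \<Rightarrow> real) \<Rightarrow> nat \<Rightarrow> real" where
  "correlation \<mu> T f g n =
     (LINT x|\<mu>. f x * g ((T ^^ n) x)) - (LINT x|\<mu>. f x) * (LINT x|\<mu>. g x)"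

definition exp_decay_hoelder :: "'a::metric_space measure \<Rightarrow> ('a \<Rightarrow> 'a) \<Rightarrow> bool" where
  "exp_decay_hoelder \<mu> T \<longleftrightarrow>
     (\<forall>\<gamma>. 0 < \<gamma> \<and> \<gamma> \<le> 1 \<longrightarrow>
       (\<exists>C \<rho>. 0 < \<rho> \<and> \<rho> < 1 \<and>
         (\<forall>f g K L n. hoelder_on (space \<mu>) \<gamma> K f \<longrightarrow> hoelder_on (space \<mu>) \<gamma> L g \<longrightarrow>
           \<bar>correlation \<mu> T f g n\<bar> \<le> C * K * L * \<rho> ^ n)))"

text \<open>
  A strong form of exponential mixing: only one observable is regular, the other one is merely
  integrable. Equivalently, the iterates of the transfer operator of \<open>T\<close> with respect to \<open>\<mu>\<close>,
  applied to Hoelder functions, converge exponentially in the essential supremum norm.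
\<close>

definition strongly_exp_mixing :: "'a::metric_space measure \<Rightarrow> ('a \<Rightarrow> 'a) \<Rightarrow> bool" where
  "strongly_exp_mixing \<mu> T \<longleftrightarrow>
     (\<forall>\<gamma>. 0 < \<gamma> \<and> \<gamma> \<le> 1 \<longrightarrow>
       (\<exists>C \<rho>. 0 < \<rho> \<and> \<rho> < 1 \<and>
         (\<forall>f g K n. hoelder_on (space \<mu>) \<gamma> K f \<longrightarrow> integrable \<mu> g \<longrightarrow>
           \<bar>correlation \<mu> T f g n\<bar> \<le> C * K * (LINT x|\<mu>. \<bar>g x\<bar>) * \<rho> ^ n)))"

end

theory Submission
  imports Defs "HOL-Complex_Analysis.Conformal_Mappings"
begin

text \<open>
  The site map with parameter \<open>r\<close> expands by at least \<open>K = 2 (2 - t) / (2 + t)\<close>, where \<open>t = \<bar>r\<bar>\<close>, and the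
  derivative of the coupled map is \<open>v \<mapsto> (a\<^sub>i (v\<^sub>i + w\<^sub>i m))\<^sub>i\<close> with \<open>m\<close> the mean of \<open>v\<close>, slopes
  \<open>a\<^sub>i \<ge> K\<close> and \<open>0 \<le> w\<^sub>i \<le> G' / (4 - t\<^sup>2)\<close>. Since \<open>G' \<le> 25 - 50 t\<close>, the mean-field term costs less than
  the factor \<open>K\<close> gains, so the map expands the Euclidean norm by at least \<open>\<surd>(6/5)\<close>. Before the coordinates are
  reduced modulo 1, the map is a bijection from the cube onto a cube of twice the side length; hence all
  \<open>2\<^sup>N\<close> inverse branches are full, contracting and analytic.

  The transfer operator therefore contracts cones of densities with bounded logarithmic Hoelder constant:
  after one step a fixed fraction of the mass can be replaced by a constant. This gives the invariant density
  as the limit of the iterates of \<open>1\<close>, and exponential convergence for Hoelder functions; by duality this is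
  exponential mixing, and uniqueness follows since Hoelder functions are dense in \<open>L\<^sup>1\<close>. The inverse branches
  extend to contractions of a complex neighbourhood of the cube, on which the iterates of \<open>1\<close> are
  holomorphic and converge uniformly, so the density is real analytic.
\<close>

section \<open>Power series of separately holomorphic functions\<close>

text \<open>Bijectivity of the lifted map rests on monotonicity: \<open>mob r x\<close> is monotone
  in \<open>r\<close> and in \<open>x\<close>, and \<open>G\<close> increases, so equal images force
  equal parameters \<open>G (mean x)\<close>. Conversely, inverting site by site with a trial
  parameter leaves one scalar equation, solved by the intermediate value theorem. The Euclidean norm
  fits because splitting a vector into mean and fluctuation is orthogonal for it, which gives a
  constant free of the dimension. The estimate allows components in any real inner product space, so
  it covers complex tangent vectors at real points; this yields nonvanishing Jacobians and, after a
  small loss, the contraction of the complex branches. The obstacle to analyticity is the modulus in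
  the Jacobian: the determinant has constant sign on the connected cube, so the weights do extend
  holomorphically. Complex functions are compared with their real counterparts by relative errors
  \<open>exp (B * t) - 1\<close>, where \<open>t\<close> is the distance to a real point; along an
  orbit the exponents sum to a geometric series, so one neighbourhood serves all iterates.\<close>

definition vupd :: "complex ^ 'n \<Rightarrow> 'n \<Rightarrow> complex \<Rightarrow> complex ^ 'n" where
  "vupd z j w = (\<chi> i. if i = j then w else z $ i)"

definition polydisc :: "complex ^ 'n \<Rightarrow> real \<Rightarrow> (complex ^ 'n) set" where
  "polydisc a R = {z. \<forall>i. z $ i \<in> ball (a $ i) R}"

text \<open>Separate holomorphy is enough, because the power series is built for bounded functions,
  one variable at a time; it passes to uniform limits slice by slice.\<close>

definition sep_holo :: "complex ^ 'n \<Rightarrow> real \<Rightarrow> (complex ^ 'n \<Rightarrow> complex) \<Rightarrow> bool" where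
  "sep_holo a R f \<longleftrightarrow>
     (\<forall>z\<in>polydisc a R. \<forall>j. (\<lambda>w. f (vupd z j w)) holomorphic_on ball (a $ j) R)"

text \<open>The Taylor coefficient of order \<open>m\<close> in the variable \<open>j\<close>,
  regarded as a function of the other variables; the coordinate \<open>z $ j\<close> itself has no
  influence.\<close>

definition slice_coeff :: "complex ^ 'n \<Rightarrow> 'n \<Rightarrow> nat \<Rightarrow> (complex ^ 'n \<Rightarrow> complex) \<Rightarrow> complex ^ 'n \<Rightarrow> complex" where
  "slice_coeff a j m f z = (deriv ^^ m) (\<lambda>w. f (vupd z j w)) (a $ j) / fact m"

lemma vupd_nth [simp]: "vupd z j w $ i = (if i = j then w else z $ i)"
  by (simp add: vupd_def)

lemma vupd_vupd [simp]: "vupd (vupd z j v) j w = vupd z j w"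
  by (simp add: vec_eq_iff)

lemma vupd_commute: "i \<noteq> j \<Longrightarrow> vupd (vupd z i v) j w = vupd (vupd z j w) i v"
  by (simp add: vec_eq_iff)

lemma vupd_same [simp]: "vupd z j (z $ j) = z"
  by (simp add: vec_eq_iff)

lemma vupd_polydisc: "z \<in> polydisc a R \<Longrightarrow> w \<in> ball (a $ j) R \<Longrightarrow> vupd z j w \<in> polydisc a R"
  by (auto simp: polydisc_def)

lemma polydisc_mono: "r \<le> R \<Longrightarrow> polydisc a r \<subseteq> polydisc a R"
  unfolding polydisc_def by (auto intro: less_le_trans)

lemma sep_holo_uniform_limit:
  fixes a :: "complex ^ 'n"
  assumes "\<And>n. sep_holo a R (F n)" "uniform_limit (polydisc a R) F f sequentially"
  shows "sep_holo a R f"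
  unfolding sep_holo_def
proof (intro ballI allI)
  fix z :: "complex ^ 'n" and j
  assume z: "z \<in> polydisc a R"
  show "(\<lambda>w. f (vupd z j w)) holomorphic_on ball (a $ j) R"
  proof (rule holomorphic_uniform_sequence[where f = "\<lambda>n w. F n (vupd z j w)"])
    show "(\<lambda>w. F n (vupd z j w)) holomorphic_on ball (a $ j) R" for n
      using assms(1) z by (auto simp: sep_holo_def)
    fix w assume w: "w \<in> ball (a $ j) R"
    then obtain d where d: "d > 0" "cball w d \<subseteq> ball (a $ j) R"
      using open_contains_cball by blast
    have "uniform_limit (cball w d) (\<lambda>n w. F n (vupd z j w)) (\<lambda>w. f (vupd z j w)) sequentially"
      unfolding uniform_limit_iff
    proof (intro allI impI)
      fix e :: real assume "e > 0"
      hence "\<forall>\<^sub>F n in sequentially. \<forall>x\<in>polydisc a R. dist (F n x) (f x) < e"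
        using assms(2) by (auto simp: uniform_limit_iff)
      thus "\<forall>\<^sub>F n in sequentially. \<forall>x\<in>cball w d. dist (F n (vupd z j x)) (f (vupd z j x)) < e"
        by eventually_elim (use d vupd_polydisc[OF z] in blast)
    qed
    thus "\<exists>d>0. cball w d \<subseteq> ball (a $ j) R \<and>
        uniform_limit (cball w d) (\<lambda>n w. F n (vupd z j w)) (\<lambda>w. f (vupd z j w)) sequentially"
      using d by blast
  qed (use assms in auto)
qed

context
  fixes a :: "complex ^ 'n" and R \<rho> M :: real and f :: "complex ^ 'n \<Rightarrow> complex"
  assumes sh: "sep_holo a R f" and \<rho>: "0 < \<rho>" "\<rho> < R"
    and bd: "\<And>z. z \<in> polydisc a R \<Longrightarrow> norm (f z) \<le> M"
begin

lemma slice_holo: "z \<in> polydisc a R \<Longrightarrow> (\<lambda>w. f (vupd z j w)) holomorphic_on ball (a $ j) R"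
  using sh by (auto simp: sep_holo_def)

text \<open>Cauchy's inequality on a circle of radius \<rho>, smaller than \<open>R\<close> so that
  the closed disc lies in the region of holomorphy. The bound does not depend on \<open>z\<close>,
  so the argument can be repeated for the coefficient function.\<close>

lemma slice_coeff_bound:
  assumes z: "z \<in> polydisc a R"
  shows "norm (slice_coeff a j m f z) \<le> M / \<rho> ^ m"
proof -
  have "norm ((deriv ^^ m) (\<lambda>w. f (vupd z j w)) (a $ j)) \<le> fact m * M / \<rho> ^ m"
  proof (rule Cauchy_inequality)
    show "(\<lambda>w. f (vupd z j w)) holomorphic_on ball (a $ j) \<rho>"
      using slice_holo[OF z] by (rule holomorphic_on_subset) (use \<rho> in auto)
    show "continuous_on (cball (a $ j) \<rho>) (\<lambda>w. f (vupd z j w))"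
      using holomorphic_on_imp_continuous_on[OF slice_holo[OF z]]
      by (rule continuous_on_subset) (use \<rho> in auto)
    show "norm (f (vupd z j w)) \<le> M" if "norm (a $ j - w) = \<rho>" for w
      using that \<rho> by (intro bd vupd_polydisc z) (auto simp: dist_norm)
  qed (use \<rho> in auto)
  thus ?thesis by (simp add: slice_coeff_def norm_divide field_simps)
qed

lemma slice_coeff_sums:
  assumes z: "z \<in> polydisc a R" and w: "w \<in> ball (a $ j) R"
  shows "(\<lambda>m. slice_coeff a j m f z * (w - a $ j) ^ m) sums f (vupd z j w)"
  using holomorphic_power_series[OF slice_holo[OF z] w] by (simp add: slice_coeff_def)

lemma slice_coeff_vupd: "slice_coeff a j m f (vupd z j w) = slice_coeff a j m f z"
  by (simp add: slice_coeff_def)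

lemma sep_holo_vupd:
  assumes c: "c \<in> ball (a $ j) R"
  shows "sep_holo a R (\<lambda>z. f (vupd z j c))"
  unfolding sep_holo_def
proof (intro ballI allI)
  fix z i assume z: "z \<in> polydisc a R"
  show "(\<lambda>w. f (vupd (vupd z i w) j c)) holomorphic_on ball (a $ i) R"
  proof (cases "i = j")
    case False
    thus ?thesis using slice_holo[OF vupd_polydisc[OF z c], of i] by (simp add: vupd_commute)
  qed simp
qed

text \<open>The coefficient is the uniform limit of the difference quotients of order \<open>m\<close>.\<close>

lemma sep_holo_slice_coeff: "sep_holo a R (slice_coeff a j m f)"
proof (induction m rule: less_induct)
  case (less m)
  \<comment> \<open>Any null sequence in the disc would do; with this one the error series has ratio
    \<open>1 / (n + 2)\<close> and the closed sum \<open>1 / (n + 1)\<close>.\<close>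
  define h where "h n = \<rho> / real (n + 2)" for n
  define c where "c n = a $ j + of_real (h n)" for n
  have h: "0 < h n" "h n < \<rho>" for n
    using \<rho> by (auto simp: h_def divide_less_eq)
  have c: "c n \<in> ball (a $ j) R" for n
    using h[of n] \<rho> by (simp add: c_def dist_norm)
  define D where "D n z = (f (vupd z j (c n)) - (\<Sum>q<m. slice_coeff a j q f z * of_real (h n) ^ q)) /
       of_real (h n) ^ m" for n z
  \<comment> \<open>Only coefficients of order below \<open>m\<close> occur in \<open>D n\<close>,
    so the induction hypothesis applies to each.\<close>
  have "sep_holo a R (D n)" for n
    using less.IH sep_holo_vupd[OF c] h(1)[of n] unfolding sep_holo_def D_def
    by (auto intro!: holomorphic_intros)
  moreover have "uniform_limit (polydisc a R) D (slice_coeff a j m f) sequentially"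
    unfolding uniform_limit_iff
  proof (intro allI impI)
    fix e :: real assume e: "e > 0"
    have est: "dist (D n z) (slice_coeff a j m f z) \<le> M / \<rho> ^ m * (1 / real (n + 1))"
      if z: "z \<in> polydisc a R" for n z
    proof -
      let ?c = "\<lambda>q. slice_coeff a j q f z"
      have M: "M \<ge> 0" using bd[OF z] norm_ge_zero order_trans by blast
      have t: "h n / \<rho> = 1 / real (n + 2)" using \<rho> by (simp add: h_def)
      have h0: "complex_of_real (h n) \<noteq> 0" using h(1)[of n] by simp
      have "(\<lambda>q. ?c q * of_real (h n) ^ q) sums f (vupd z j (c n))"
        using slice_coeff_sums[OF z c] by (simp add: c_def)
      from sums_split_initial_segment[OF this, of m]
      have "(\<lambda>q. ?c (q + m) * of_real (h n) ^ (q + m)) sums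
              (f (vupd z j (c n)) - (\<Sum>q<m. ?c q * of_real (h n) ^ q))" .
      from sums_divide[OF this, of "of_real (h n) ^ m"]
      have "(\<lambda>q. ?c (q + m) * of_real (h n) ^ q) sums D n z"
        using h0 by (simp add: D_def power_add)
      from sums_split_initial_segment[OF this, of 1]
      have s: "(\<lambda>q. ?c (q + 1 + m) * of_real (h n) ^ (q + 1)) sums (D n z - ?c m)"
        by simp
      have "(\<lambda>q. (1 / real (n + 2)) ^ q) sums (1 / (1 - 1 / real (n + 2)))"
        by (rule geometric_sums) simp
      from sums_mult[OF this, of "M / \<rho> ^ m * (1 / real (n + 2))"]
      have s': "(\<lambda>q. M / \<rho> ^ m * (1 / real (n + 2)) * (1 / real (n + 2)) ^ q) sums
        (M / \<rho> ^ m * (1 / real (n + 2)) * (1 / (1 - 1 / real (n + 2))))" .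
      have g: "(\<lambda>q. M / \<rho> ^ m * (1 / real (n + 2)) ^ (q + 1)) sums (M / \<rho> ^ m * (1 / real (n + 1)))"
      proof -
        have "1 / real (n + 2) * (1 / (1 - 1 / real (n + 2))) = 1 / real (n + 1)"
          by (simp add: divide_simps)
        hence "M / \<rho> ^ m * (1 / real (n + 2)) * (1 / (1 - 1 / real (n + 2))) = M / \<rho> ^ m * (1 / real (n + 1))"
          by (simp only: mult.assoc)
        with s' show ?thesis by (simp only: power_Suc Suc_eq_plus1[symmetric] mult.assoc)
      qed
      have b: "norm (?c (q + 1 + m) * of_real (h n) ^ (q + 1)) \<le> M / \<rho> ^ m * (1 / real (n + 2)) ^ (q + 1)" for q
      proof -
        have "norm (?c (q + 1 + m) * of_real (h n) ^ (q + 1)) \<le> M / \<rho> ^ (q + 1 + m) * h n ^ (q + 1)"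
          using mult_right_mono[OF slice_coeff_bound[OF z, of j "q + 1 + m"], of "h n ^ (q + 1)"] h(1)[of n]
          by (simp add: norm_mult norm_power)
        also have "\<dots> = M / \<rho> ^ m * (h n / \<rho>) ^ (q + 1)"
          by (simp add: power_add power_divide)
        finally show ?thesis using t by simp
      qed
      have "norm (D n z - ?c m) \<le> M / \<rho> ^ m * (1 / real (n + 1))"
        using norm_suminf_le[OF b sums_summable[OF g]] s g by (simp add: sums_iff)
      thus ?thesis by (simp add: dist_norm)
    qed
    have "(\<lambda>n. M / \<rho> ^ m * (1 / real (n + 1))) \<longlonglongrightarrow> M / \<rho> ^ m * 0"
      by (intro tendsto_intros LIMSEQ_inverse_real_of_nat[unfolded inverse_eq_divide, simplified])
        (use LIMSEQ_inverse_real_of_nat in \<open>simp add: inverse_eq_divide add.commute\<close>)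
    hence "\<forall>\<^sub>F n in sequentially. M / \<rho> ^ m * (1 / real (n + 1)) < e"
      using e by (intro order_tendstoD) auto
    thus "\<forall>\<^sub>F n in sequentially. \<forall>z\<in>polydisc a R. dist (D n z) (slice_coeff a j m f z) < e"
      by eventually_elim (use est in \<open>blast intro: le_less_trans\<close>)
  qed
  ultimately show ?case by (rule sep_holo_uniform_limit)
qed

end

text \<open>Fubini over one coordinate at a time. The product is the majorant that makes the
  multi-indexed Cauchy bounds absolutely summable.\<close>

lemma has_sum_prod_geometric:
  fixes t :: "'a \<Rightarrow> real"
  assumes "finite S" "\<And>i. i \<in> S \<Longrightarrow> 0 \<le> t i \<and> t i < 1"
  shows "((\<lambda>k. \<Prod>i\<in>S. t i ^ k i) has_sum (\<Prod>i\<in>S. 1 / (1 - t i))) (S \<rightarrow>\<^sub>E UNIV)"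
  using assms
proof (induction S rule: finite_induct)
  case empty
  thus ?case by (auto intro!: has_sum_finiteI)
next
  case (insert j S)
  let ?P = "\<Prod>i\<in>S. 1 / (1 - t i)"
  let ?g = "\<lambda>(m, k). t j ^ m * (\<Prod>i\<in>S. t i ^ k i)"
  have tj: "0 \<le> t j" "t j < 1" using insert.prems by auto
  have 1: "((\<lambda>k. ?g (m, k)) has_sum (t j ^ m * ?P)) (S \<rightarrow>\<^sub>E UNIV)" for m
    using insert by (auto intro!: has_sum_cmult_right)
  have 2: "((\<lambda>m. t j ^ m * ?P) has_sum (1 / (1 - t j) * ?P)) UNIV"
    using tj by (intro has_sum_cmult_left norm_summable_imp_has_sum geometric_sums)
      (auto simp: norm_power summable_geometric)
  have "?g summable_on (UNIV \<times> (S \<rightarrow>\<^sub>E UNIV))"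
    using 1 2 insert.prems
    by (intro summable_on_SigmaI[where g = "\<lambda>m. t j ^ m * ?P"])
       (auto simp: summable_on_def intro!: mult_nonneg_nonneg prod_nonneg)
  from has_sum_SigmaI[OF 1 2 this]
  have "(?g has_sum (1 / (1 - t j) * ?P)) (UNIV \<times> (S \<rightarrow>\<^sub>E UNIV))" .
  also have "?this \<longleftrightarrow> ((\<lambda>k. \<Prod>i\<in>insert j S. t i ^ k i) has_sum (1 / (1 - t j) * ?P)) (insert j S \<rightarrow>\<^sub>E UNIV)"
  proof (rule has_sum_reindex_bij_witness[where j = "\<lambda>(m, k). k(j := m)" and i = "\<lambda>k. (k j, restrict k S)"])
    fix b :: "nat \<times> ('a \<Rightarrow> nat)" assume b: "b \<in> UNIV \<times> (S \<rightarrow>\<^sub>E UNIV)"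
    show "(\<lambda>k. (k j, restrict k S)) ((\<lambda>(m, k). k(j := m)) b) = b"
      using b insert.hyps by (auto simp: fun_eq_iff PiE_iff extensional_def split: prod.splits)
    show "(\<lambda>(m, k). k(j := m)) b \<in> insert j S \<rightarrow>\<^sub>E UNIV"
      using b by (auto simp: PiE_iff extensional_def split: prod.splits)
    have "(\<Prod>i\<in>S. t i ^ (if i = j then m else k i)) = (\<Prod>i\<in>S. t i ^ k i)" for m k
      using insert.hyps by (intro prod.cong) auto
    thus "(\<Prod>i\<in>insert j S. t i ^ (\<lambda>(m, k). k(j := m)) b i) = (\<lambda>(m, k). t j ^ m * (\<Prod>i\<in>S. t i ^ k i)) b"
      using insert.hyps by (auto split: prod.splits)
  qed (use insert.hyps in \<open>auto simp: fun_eq_iff PiE_iff extensional_def\<close>)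
  finally show ?case using insert.hyps by simp
qed

text \<open>Induction on the set \<open>S\<close> of variables that may move away from the centre. A
  new variable \<open>j\<close> is expanded in one dimension; its coefficients are again separately
  holomorphic and bounded, so each has a series in the old variables, and the product form of the
  bounds allows the iterated sum to be read as one unordered sum.\<close>

lemma sep_holo_power_series_partial:
  fixes a :: "complex ^ 'n"
  assumes "finite S" "0 < \<rho>" "\<rho> < R" "sep_holo a R f" "\<And>z. z \<in> polydisc a R \<Longrightarrow> norm (f z) \<le> M"
  shows "\<exists>c. (\<forall>k. norm (c k) \<le> M / \<rho> ^ (\<Sum>i\<in>S. k i)) \<and>
           (\<forall>z\<in>polydisc a \<rho>. (\<forall>i. i \<notin> S \<longrightarrow> z $ i = a $ i) \<longrightarrow>
              ((\<lambda>k. c k * (\<Prod>i\<in>S. (z $ i - a $ i) ^ k i)) has_sum f z) (S \<rightarrow>\<^sub>E UNIV))"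
  using assms(1,4,5)
proof (induction S arbitrary: f M rule: finite_induct)
  case (empty f M)
  have "norm (f a) \<le> M" using empty.prems assms by (auto simp: polydisc_def)
  thus ?case
    by (intro exI[of _ "\<lambda>_. f a"]) (auto intro!: has_sum_finiteI simp flip: vec_eq_iff)
next
  case (insert j S f M)
  note bd = insert.prems(2)
  \<comment> \<open>Coefficient \<open>m\<close> is bounded by \<open>M / \<rho> ^ m\<close>, which
    takes the place of \<open>M\<close> in the induction hypothesis.\<close>
  have "\<forall>m. \<exists>c. (\<forall>k. norm (c k) \<le> M / \<rho> ^ m / \<rho> ^ (\<Sum>i\<in>S. k i)) \<and>
           (\<forall>z\<in>polydisc a \<rho>. (\<forall>i. i \<notin> S \<longrightarrow> z $ i = a $ i) \<longrightarrow>
              ((\<lambda>k. c k * (\<Prod>i\<in>S. (z $ i - a $ i) ^ k i)) has_sum slice_coeff a j m f z) (S \<rightarrow>\<^sub>E UNIV))"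
    by (intro allI insert.IH sep_holo_slice_coeff slice_coeff_bound) (use insert.prems assms in auto)
  from choice[OF this] obtain C where C: "\<And>m k. norm (C m k) \<le> M / \<rho> ^ m / \<rho> ^ (\<Sum>i\<in>S. k i)"
    "\<And>m z. z \<in> polydisc a \<rho> \<Longrightarrow> (\<And>i. i \<notin> S \<Longrightarrow> z $ i = a $ i) \<Longrightarrow>
        ((\<lambda>k. C m k * (\<Prod>i\<in>S. (z $ i - a $ i) ^ k i)) has_sum slice_coeff a j m f z) (S \<rightarrow>\<^sub>E UNIV)"
    by blast
  define c where "c k = C (k j) (restrict k S)" for k
  have "norm (c k) \<le> M / \<rho> ^ (\<Sum>i\<in>insert j S. k i)" for k
    using C(1)[of "k j" "restrict k S"] insert.hyps by (simp add: c_def power_add)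
  moreover have "((\<lambda>k. c k * (\<Prod>i\<in>insert j S. (z $ i - a $ i) ^ k i)) has_sum f z) (insert j S \<rightarrow>\<^sub>E UNIV)"
    if z: "z \<in> polydisc a \<rho>" and z0: "\<And>i. i \<notin> insert j S \<Longrightarrow> z $ i = a $ i" for z
  proof -
    \<comment> \<open>The induction hypothesis only covers points with coordinate \<open>j\<close>
      at the centre; moving that coordinate there changes no slice coefficient.\<close>
    define z' where "z' = vupd z j (a $ j)"
    define t where "t i = norm (z $ i - a $ i) / \<rho>" for i
    have z': "z' \<in> polydisc a \<rho>" using z assms by (auto simp: z'_def polydisc_def)
    have zR: "z \<in> polydisc a R" and z'R: "z' \<in> polydisc a R"
      using z z' polydisc_mono[of \<rho> R a] assms by auto
    have M: "M \<ge> 0" using bd[OF zR] norm_ge_zero order_trans by blast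
    have t: "0 \<le> t i" "t i < 1" for i
      using z assms by (auto simp: t_def polydisc_def dist_norm norm_minus_commute)
    let ?g = "\<lambda>(m, k). C m k * (z $ j - a $ j) ^ m * (\<Prod>i\<in>S. (z $ i - a $ i) ^ k i)"
    have 1: "((\<lambda>k. ?g (m, k)) has_sum (slice_coeff a j m f z * (z $ j - a $ j) ^ m)) (S \<rightarrow>\<^sub>E UNIV)" for m
    proof -
      have "(\<Prod>i\<in>S. (z' $ i - a $ i) ^ k i) = (\<Prod>i\<in>S. (z $ i - a $ i) ^ k i)" for k
        using insert.hyps by (intro prod.cong) (auto simp: z'_def)
      moreover have "slice_coeff a j m f z' = slice_coeff a j m f z"
        using slice_coeff_vupd by (simp add: z'_def slice_coeff_def)
      ultimately have "((\<lambda>k. C m k * (\<Prod>i\<in>S. (z $ i - a $ i) ^ k i)) has_sum slice_coeff a j m f z) (S \<rightarrow>\<^sub>E UNIV)"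
        using C(2)[OF z', of m] z0 by (auto simp: z'_def)
      from has_sum_cmult_left[OF this, of "(z $ j - a $ j) ^ m"] show ?thesis
        by (simp add: mult_ac)
    qed
    have g: "norm (?g (m, k)) \<le> M * (t j ^ m * (\<Prod>i\<in>S. t i ^ k i))" for m k
    proof -
      have "norm (?g (m, k)) \<le> M / \<rho> ^ m / \<rho> ^ (\<Sum>i\<in>S. k i) * (norm (z $ j - a $ j) ^ m * (\<Prod>i\<in>S. norm (z $ i - a $ i) ^ k i))"
        using mult_right_mono[OF C(1)[of m k],
            of "norm (z $ j - a $ j) ^ m * (\<Prod>i\<in>S. norm (z $ i - a $ i) ^ k i)"]
        by (simp add: norm_mult norm_power prod_nonneg mult.assoc flip: prod_norm)
      also have "\<dots> = M * (t j ^ m * (\<Prod>i\<in>S. t i ^ k i))"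
        by (simp add: t_def power_divide prod_dividef power_sum)
      finally show ?thesis .
    qed
    have summ: "(\<lambda>p. norm (?g p)) summable_on (UNIV \<times> (S \<rightarrow>\<^sub>E UNIV))"
    proof (rule summable_on_comparison_test)
      let ?P = "\<Prod>i\<in>S. 1 / (1 - t i)"
      have "(\<lambda>(m, k). t j ^ m * (\<Prod>i\<in>S. t i ^ k i)) summable_on (UNIV \<times> (S \<rightarrow>\<^sub>E UNIV))"
      proof (rule summable_on_SigmaI[where g = "\<lambda>m. t j ^ m * ?P"])
        show "((\<lambda>k. case (m, k) of (m, k) \<Rightarrow> t j ^ m * (\<Prod>i\<in>S. t i ^ k i)) has_sum t j ^ m * ?P) (S \<rightarrow>\<^sub>E UNIV)" for m
          using has_sum_prod_geometric[OF insert.hyps(1), of t] t by (auto intro!: has_sum_cmult_right)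
        have "((\<lambda>m. t j ^ m * ?P) has_sum (1 / (1 - t j) * ?P)) UNIV"
          using t[of j] by (intro has_sum_cmult_left norm_summable_imp_has_sum geometric_sums)
            (auto simp: norm_power summable_geometric)
        thus "(\<lambda>m. t j ^ m * ?P) summable_on UNIV" by (auto simp: summable_on_def)
      qed (use t in \<open>auto intro!: mult_nonneg_nonneg prod_nonneg\<close>)
      thus "(\<lambda>p. M * (case p of (m, k) \<Rightarrow> t j ^ m * (\<Prod>i\<in>S. t i ^ k i))) summable_on (UNIV \<times> (S \<rightarrow>\<^sub>E UNIV))"
        by (rule summable_on_cmult_right)
    qed (use g in auto)
    have zj: "z $ j \<in> ball (a $ j) R" using zR by (auto simp: polydisc_def)
    have "summable (\<lambda>m. norm (slice_coeff a j m f z * (z $ j - a $ j) ^ m))"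
    proof (rule summable_comparison_test')
      show "summable (\<lambda>m. M * t j ^ m)" using t[of j] by (intro summable_mult summable_geometric) auto
      show "norm (norm (slice_coeff a j m f z * (z $ j - a $ j) ^ m)) \<le> M * t j ^ m" if "m \<ge> 0" for m
        using slice_coeff_bound[where j = j and m = m, OF insert.prems(1) assms(2,3) bd zR]
          mult_right_mono[of "norm (slice_coeff a j m f z)" "M / \<rho> ^ m" "norm (z $ j - a $ j) ^ m"]
        by (simp add: t_def norm_mult norm_power power_divide)
    qed
    hence 2: "((\<lambda>m. slice_coeff a j m f z * (z $ j - a $ j) ^ m) has_sum f z) UNIV"
      using slice_coeff_sums[OF insert.prems(1) assms(2,3) bd zR zj]
      by (intro norm_summable_imp_has_sum) auto
    from has_sum_SigmaI[OF 1 2 abs_summable_summable[OF summ]]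
    have "(?g has_sum f z) (UNIV \<times> (S \<rightarrow>\<^sub>E UNIV))" .
    also have "?this \<longleftrightarrow> ?thesis"
    proof (rule has_sum_reindex_bij_witness[where j = "\<lambda>(m, k). k(j := m)" and i = "\<lambda>k. (k j, restrict k S)"])
      fix b :: "nat \<times> ('n \<Rightarrow> nat)" assume b: "b \<in> UNIV \<times> (S \<rightarrow>\<^sub>E UNIV)"
      show r: "(\<lambda>k. (k j, restrict k S)) ((\<lambda>(m, k). k(j := m)) b) = b"
        using b insert.hyps by (auto simp: fun_eq_iff PiE_iff extensional_def split: prod.splits)
      show "(\<lambda>(m, k). k(j := m)) b \<in> insert j S \<rightarrow>\<^sub>E UNIV"
        using b by (auto simp: PiE_iff extensional_def split: prod.splits)
      have "(\<Prod>i\<in>S. (z $ i - a $ i) ^ (if i = j then m else k i)) = (\<Prod>i\<in>S. (z $ i - a $ i) ^ k i)" for m k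
        using insert.hyps by (intro prod.cong) auto
      thus "c ((\<lambda>(m, k). k(j := m)) b) * (\<Prod>i\<in>insert j S. (z $ i - a $ i) ^ (\<lambda>(m, k). k(j := m)) b i) = ?g b"
        using insert.hyps r by (auto simp: c_def split: prod.splits)
    qed (use insert.hyps in \<open>auto simp: fun_eq_iff PiE_iff extensional_def\<close>)
    finally show ?thesis .
  qed
  ultimately show ?case by (intro exI[of _ c]) auto
qed

section \<open>Real points of holomorphic functions and holomorphic extensions of real power
  series\<close>

definition cvec :: "real ^ 'n \<Rightarrow> complex ^ 'n" where
  "cvec x = (\<chi> i. of_real (x $ i))"

lemma cvec_nth [simp]: "cvec x $ i = of_real (x $ i)"
  by (simp add: cvec_def)

lemma inner_axis_1: "x \<bullet> axis i (1::real) = x $ i"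
  by (simp add: inner_axis)

text \<open>At real points the monomials are real, so the real parts of the complex coefficients
  form the series. The half radius leaves the margin for Cauchy's inequality; the reindexing turns
  exponents labelled by coordinates into exponents labelled by basis vectors.\<close>

lemma has_power_series_at_Re_sep_holo:
  fixes a :: "real ^ 'n" and f :: "complex ^ 'n \<Rightarrow> complex"
  assumes "0 < R" "sep_holo (cvec a) R f" "\<And>z. z \<in> polydisc (cvec a) R \<Longrightarrow> norm (f z) \<le> M"
  shows "has_power_series_at (\<lambda>x. Re (f (cvec x))) a"
proof -
  obtain c where c: "\<And>z. z \<in> polydisc (cvec a) (R / 2) \<Longrightarrow>
      ((\<lambda>k. c k * (\<Prod>i\<in>UNIV. (z $ i - cvec a $ i) ^ k i)) has_sum f z) (UNIV \<rightarrow>\<^sub>E UNIV)"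
    using sep_holo_power_series_partial[of UNIV "R / 2" R "cvec a" f M] assms by auto
  define e where "e = (\<lambda>i::'n. axis i (1::real))"
  have e: "bij_betw e UNIV Basis"
    unfolding bij_betw_def e_def by (auto simp: inj_on_def axis_eq_axis Basis_vec_def)
  define c' where "c' k = Re (c (k \<circ> e))" for k
  show ?thesis unfolding has_power_series_at_def
  proof (intro exI conjI ballI)
    show "R / 2 > 0" using assms by simp
    fix x assume x: "x \<in> ball a (R / 2)"
    have "\<bar>x $ i - a $ i\<bar> < R / 2" for i
      using x component_le_norm_cart[of "x - a" i] by (simp add: dist_norm norm_minus_commute)
    hence "cvec x \<in> polydisc (cvec a) (R / 2)"
      unfolding polydisc_def by (simp add: dist_norm abs_minus_commute flip: of_real_diff)
    from has_sum_Re[OF c[OF this]]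
    have "((\<lambda>k. Re (c k) * (\<Prod>i\<in>UNIV. (x $ i - a $ i) ^ k i)) has_sum Re (f (cvec x))) (UNIV \<rightarrow>\<^sub>E UNIV)"
      by (simp flip: of_real_diff of_real_power of_real_prod)
    also have "?this \<longleftrightarrow> ((\<lambda>k. c' k * (\<Prod>b\<in>Basis. ((x - a) \<bullet> b) ^ k b)) has_sum Re (f (cvec x))) (Basis \<rightarrow>\<^sub>E UNIV)"
    proof (rule has_sum_reindex_bij_witness[where j = "\<lambda>k. restrict (k \<circ> inv e) Basis" and i = "\<lambda>k. k \<circ> e"])
      have ie: "inv e (e i) = i" for i using e by (simp add: bij_betw_def)
      have eB: "e i \<in> Basis" for i by (simp add: e_def)
      have ei: "e (inv e b) = b" if "b \<in> Basis" for b
        using e that by (metis bij_betw_def f_inv_into_f)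
      show r: "restrict (k \<circ> inv e) Basis \<circ> e = k" for k :: "'n \<Rightarrow> nat"
        using ie eB by (auto simp: fun_eq_iff)
      show "restrict ((k \<circ> e) \<circ> inv e) Basis = k" if "k \<in> Basis \<rightarrow>\<^sub>E UNIV" for k :: "real ^ 'n \<Rightarrow> nat"
        using that ei by (auto simp: fun_eq_iff PiE_iff extensional_def)
      fix k :: "'n \<Rightarrow> nat"
      have "(\<Prod>b\<in>Basis. ((x - a) \<bullet> b) ^ restrict (k \<circ> inv e) Basis b) = (\<Prod>i\<in>UNIV. ((x - a) \<bullet> e i) ^ (k i))"
        using ie eB by (subst prod.reindex_bij_betw[OF e, symmetric]) auto
      thus "c' (restrict (k \<circ> inv e) Basis) * (\<Prod>b\<in>Basis. ((x - a) \<bullet> b) ^ restrict (k \<circ> inv e) Basis b) =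
         Re (c k) * (\<Prod>i\<in>UNIV. (x $ i - a $ i) ^ k i)"
        by (simp only: c'_def r) (simp add: e_def inner_axis_1)
    qed auto
    finally show "((\<lambda>k. c' k * (\<Prod>b\<in>Basis. ((x - a) \<bullet> b) ^ k b)) has_sum Re (f (cvec x))) (Basis \<rightarrow>\<^sub>E UNIV)" .
  qed
qed

text \<open>The only basis vector of the reals is 1, so a multi-index is a single exponent, and
  unordered summability implies convergence of the ordinary series.\<close>

lemma has_power_series_at_realD:
  fixes g :: "real \<Rightarrow> real"
  assumes "has_power_series_at g a"
  obtains \<rho> c where "\<rho> > 0" "\<And>x. \<bar>x - a\<bar> < \<rho> \<Longrightarrow> (\<lambda>n. c n * (x - a) ^ n) sums g x"
proof -
  obtain \<rho> c where \<rho>: "\<rho> > 0" and c: "\<And>x. x \<in> ball a \<rho> \<Longrightarrow>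
      ((\<lambda>k. c k * (\<Prod>b\<in>Basis. ((x - a) \<bullet> b) ^ k b)) has_sum g x) (Basis \<rightarrow>\<^sub>E UNIV)"
    using assms unfolding has_power_series_at_def by blast
  let ?k = "\<lambda>n::nat. \<lambda>b\<in>{1::real}. n"
  have "(\<lambda>n. c (?k n) * (x - a) ^ n) sums g x" if x: "\<bar>x - a\<bar> < \<rho>" for x
  proof (rule has_sum_imp_sums)
    have "((\<lambda>k. c k * (x - a) ^ k 1) has_sum g x) ({1} \<rightarrow>\<^sub>E UNIV)"
      using c[of x] x by (simp add: dist_norm abs_minus_commute)
    also have "?this \<longleftrightarrow> ((\<lambda>n. c (?k n) * (x - a) ^ n) has_sum g x) UNIV"
      by (rule has_sum_reindex_bij_witness[where j = "\<lambda>k. k 1" and i = ?k])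
         (auto simp: PiE_iff extensional_def fun_eq_iff intro!: arg_cong[where f = c] split: if_splits)
    finally show "((\<lambda>n. c (?k n) * (x - a) ^ n) has_sum g x) UNIV" .
  qed
  with \<rho> show ?thesis by (rule that)
qed

lemma has_power_series_at_holomorphic:
  fixes g :: "real \<Rightarrow> real"
  assumes "has_power_series_at g a"
  shows "\<exists>\<rho> f. \<rho> > 0 \<and> f holomorphic_on ball (complex_of_real a) \<rho> \<and>
     (\<forall>x. \<bar>x - a\<bar> < \<rho> \<longrightarrow> f (of_real x) = of_real (g x))"
proof -
  obtain \<rho> c where \<rho>: "\<rho> > 0" and c: "\<And>x. \<bar>x - a\<bar> < \<rho> \<Longrightarrow> (\<lambda>n. c n * (x - a) ^ n) sums g x"
    using has_power_series_at_realD[OF assms] by blast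
  define f where "f z = (\<Sum>n. complex_of_real (c n) * (z - of_real a) ^ n)" for z
  have summ: "summable (\<lambda>n. complex_of_real (c n) * (z - of_real a) ^ n)"
    if z: "z \<in> ball (of_real a) \<rho>" for z
  proof -
    obtain r where r: "norm (z - of_real a) < r" "r < \<rho>"
      using z dense[of "norm (z - of_real a)" \<rho>] by (auto simp: dist_norm norm_minus_commute)
    have "0 < r" using r(1) norm_ge_zero le_less_trans by blast
    \<comment> \<open>Convergence at the real point \<open>a + r\<close> forces convergence at every
      complex point closer to \<open>a\<close>.\<close>
    hence "\<bar>(a + r) - a\<bar> < \<rho>" using r by simp
    from sums_of_real[OF c[OF this], where 'a = complex]
    have "summable (\<lambda>n. complex_of_real (c n) * of_real r ^ n)"
      by (simp add: sums_iff)
    thus ?thesis by (rule powser_inside) (use r in auto)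
  qed
  have "f holomorphic_on ball (of_real a) \<rho>"
    by (rule power_series_holomorphic) (use summ in \<open>auto simp: f_def intro: summable_sums\<close>)
  moreover have "f (of_real x) = of_real (g x)" if "\<bar>x - a\<bar> < \<rho>" for x
    using sums_of_real[OF c[OF that], where 'a = complex] by (simp add: f_def sums_iff)
  ultimately show ?thesis using \<rho> by blast
qed

text \<open>The extensions of the local series are glued. Two of them agree where the shrunken balls
  meet, because they agree at real points and the identity theorem applies on the convex
  intersection of the full balls.\<close>

lemma real_analytic_on_holomorphic_extension:
  fixes G :: "real \<Rightarrow> real"
  assumes "real_analytic_on G S"
  obtains \<Omega> Gc where "open \<Omega>" "complex_of_real ` S \<subseteq> \<Omega>" "Gc holomorphic_on \<Omega>"
    "\<And>x. x \<in> S \<Longrightarrow> Gc (of_real x) = of_real (G x)"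
proof -
  obtain U g where g: "\<And>x. x \<in> S \<Longrightarrow> g x = G x" "\<And>a. a \<in> S \<Longrightarrow> has_power_series_at g a"
    using assms unfolding real_analytic_on_def by (metis subsetD)
  obtain \<rho> f where \<rho>: "\<And>a. a \<in> S \<Longrightarrow> \<rho> a > 0"
    and f: "\<And>a. a \<in> S \<Longrightarrow> f a holomorphic_on ball (complex_of_real a) (\<rho> a)"
      "\<And>a x. a \<in> S \<Longrightarrow> \<bar>x - a\<bar> < \<rho> a \<Longrightarrow> f a (of_real x) = of_real (g x)"
    using has_power_series_at_holomorphic[OF g(2)] by metis
  \<comment> \<open>With thirds, two meeting balls have centres closer than two thirds of the larger
    radius, so the centre with the smaller radius lies in both full balls, and real points
    accumulate there.\<close>
  let ?B = "\<lambda>a. ball (complex_of_real a) (\<rho> a / 3)"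
  have agree1: "f a z = f b z" if ab: "a \<in> S" "b \<in> S" "\<rho> b \<le> \<rho> a" and z: "z \<in> ?B a" "z \<in> ?B b" for a b z
  proof -
    let ?I = "ball (complex_of_real a) (\<rho> a) \<inter> ball (complex_of_real b) (\<rho> b)"
    have "dist (complex_of_real a) (of_real b) \<le> dist (of_real a) z + dist (of_real b) z"
      by (rule dist_triangle2)
    hence "\<bar>a - b\<bar> < 2 / 3 * \<rho> a"
      using z ab by (auto simp: dist_norm simp flip: of_real_diff)
    hence b: "complex_of_real b \<in> ?I"
      using \<rho>[OF ab(1)] \<rho>[OF ab(2)] by (auto simp: dist_norm simp flip: of_real_diff)
    have "f a z - f b z = 0"
    proof (rule analytic_continuation[where f = "\<lambda>z. f a z - f b z" and S = ?I
            and U = "?I \<inter> \<real>" and \<xi> = "of_real b"])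
      show "(\<lambda>z. f a z - f b z) holomorphic_on ?I"
        using f(1)[OF ab(1)] f(1)[OF ab(2)] by (auto intro!: holomorphic_intros elim: holomorphic_on_subset)
      show "connected ?I" by (intro convex_connected convex_Int convex_ball)
      show "complex_of_real b \<in> ?I" by (rule b)
      show "complex_of_real b islimpt (?I \<inter> \<real>)"
      proof -
        have lim: "complex_of_real b islimpt \<real>"
          unfolding islimpt_approachable
        proof (intro allI impI)
          fix e :: real assume e: "e > 0"
          show "\<exists>x'\<in>\<real>. x' \<noteq> complex_of_real b \<and> dist x' (of_real b) < e"
            by (rule bexI[of _ "of_real (b + e / 2)"]) (use e in \<open>auto simp: dist_norm\<close>)
        qed
        have "eventually (\<lambda>y. y \<in> ?I) (at (complex_of_real b))"
          using b by (intro eventually_at_in_open' open_Int open_ball)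
        from islimpt_Int_eventually[OF lim this] show ?thesis by (simp only: Int_commute)
      qed
      show "z \<in> ?I" using z \<rho>[OF ab(1)] \<rho>[OF ab(2)] by (auto intro: less_trans)
      fix w assume "w \<in> ?I \<inter> \<real>"
      then obtain x where "w = of_real x" "\<bar>x - a\<bar> < \<rho> a" "\<bar>x - b\<bar> < \<rho> b"
        by (auto elim!: Reals_cases simp: dist_norm abs_minus_commute simp flip: of_real_diff)
      thus "f a w - f b w = 0" using f(2) ab by simp
    qed auto
    thus ?thesis by simp
  qed
  have agree: "f a z = f b z" if "a \<in> S" "b \<in> S" "z \<in> ?B a" "z \<in> ?B b" for a b z
    using agree1[of a b z] agree1[of b a z] that by fastforce
  define Gc where "Gc z = f (SOME a. a \<in> S \<and> z \<in> ?B a) z" for z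
  have Gc: "Gc z = f a z" if "a \<in> S" "z \<in> ?B a" for a z
  proof -
    let ?b = "SOME a. a \<in> S \<and> z \<in> ?B a"
    have "?b \<in> S \<and> z \<in> ?B ?b" by (rule someI[of _ a]) (use that in auto)
    thus ?thesis unfolding Gc_def using agree that by blast
  qed
  show ?thesis
  proof (rule that[of "\<Union>a\<in>S. ?B a" Gc])
    show "complex_of_real ` S \<subseteq> (\<Union>a\<in>S. ?B a)" using \<rho> by force
    show "Gc holomorphic_on (\<Union>a\<in>S. ?B a)"
    proof (rule holomorphic_on_UN_open)
      fix a assume a: "a \<in> S"
      have "f a holomorphic_on ?B a" using f(1)[OF a] \<rho>[OF a] by (auto elim!: holomorphic_on_subset)
      thus "Gc holomorphic_on ?B a" using Gc[OF a] by (subst holomorphic_cong[OF refl, of _ Gc "f a"]) auto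
    qed auto
    show "Gc (of_real x) = of_real (G x)" if "x \<in> S" for x
      using Gc[OF that, of "of_real x"] \<rho>[OF that] f(2)[OF that, of x] g(1)[OF that] by simp
  qed auto
qed

section \<open>Transfer operators of contracting branch systems\<close>

lemma hoelder_on_imp_continuous_on:
  assumes "hoelder_on X \<gamma> K f" "0 < \<gamma>"
  shows "continuous_on X f"
proof (cases "X = {}")
  case False
  then obtain x0 where "x0 \<in> X" by blast
  hence "\<bar>f x0\<bar> \<le> K" using assms by (auto simp: hoelder_on_def)
  hence K: "0 \<le> K" by linarith
  have fh: "\<bar>f x - f y\<bar> \<le> K * dist x y powr \<gamma>" if "x \<in> X" "y \<in> X" for x y
    using assms that by (auto simp: hoelder_on_def)
  show ?thesis
  proof (rule continuous_onI)
    fix x e assume x: "x \<in> X" and e: "(e::real) > 0"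
    define d where "d = (e / (K + 1)) powr (1 / \<gamma>)"
    have "d > 0" using e K by (simp add: d_def)
    moreover have "dist (f y) (f x) \<le> e" if y: "y \<in> X" "dist y x < d" for y
    proof -
      have "dist y x powr \<gamma> \<le> d powr \<gamma>" using y assms(2) by (intro powr_mono2) auto
      also have "\<dots> = e / (K + 1)" using assms(2) e K by (simp add: d_def powr_powr)
      finally have "K * dist y x powr \<gamma> \<le> K * (e / (K + 1))" using K by (rule mult_left_mono)
      also have "\<dots> \<le> e" using K e by (simp add: field_simps)
      finally show ?thesis using fh[OF y(1) x] by (simp add: dist_real_def)
    qed
    ultimately show "\<exists>d>0. \<forall>x'\<in>X. dist x' x < d \<longrightarrow> dist (f x') (f x) \<le> e" by blast
  qed
qed simp

text \<open>Convexity of \<open>exp\<close> on the segment from 0 to \<open>a * t\<close>. It weighs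
  the gain from lowering a cone parameter from \<open>a\<close> to \<open>b\<close> against the cost
  of removing a constant.\<close>

lemma exp_diff_ge:
  fixes a b t :: real
  assumes "0 \<le> b" "b \<le> a" "0 < a"
  shows "(a - b) / a * (exp (a * t) - 1) \<le> exp (a * t) - exp (b * t)"
proof -
  have "exp ((1 - b / a) *\<^sub>R 0 + (b / a) *\<^sub>R (a * t)) \<le> (1 - b / a) * exp 0 + (b / a) * exp (a * t)"
    by (rule convex_onD[OF exp_convex]) (use assms in auto)
  hence "exp (b * t) \<le> (1 - b / a) + (b / a) * exp (a * t)"
    using assms by simp
  moreover have eq: "(a - b) / a = 1 - b / a" using assms by (simp add: field_simps)
  ultimately show ?thesis unfolding eq by (simp add: left_diff_distrib right_diff_distrib)
qed

text \<open>An expanding map with full branches, known only through its inverse branches and their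
  Jacobian weights. The unit volume makes the constant 1 a probability density;
  \<open>J_dist\<close> is bounded distortion, and \<open>integral_transfer\<close> says that the
  transfer operator preserves mass.\<close>

locale branch_system =
  fixes X :: "'a::euclidean_space set" and S :: "'s set"
    and \<psi> :: "'s \<Rightarrow> 'a \<Rightarrow> 'a" and J :: "'s \<Rightarrow> 'a \<Rightarrow> real" and l C :: real
  assumes X: "compact X" "emeasure lebesgue X = 1" and fin: "finite S"
    and l: "0 < l" "l < 1" and C: "0 \<le> C"
    and \<psi>_in: "\<And>s x. s \<in> S \<Longrightarrow> x \<in> X \<Longrightarrow> \<psi> s x \<in> X"
    and \<psi>_contr: "\<And>s x y. s \<in> S \<Longrightarrow> x \<in> X \<Longrightarrow> y \<in> X \<Longrightarrow> dist (\<psi> s x) (\<psi> s y) \<le> l * dist x y"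
    and J_pos: "\<And>s x. s \<in> S \<Longrightarrow> x \<in> X \<Longrightarrow> 0 < J s x"
    and J_cont: "\<And>s. s \<in> S \<Longrightarrow> continuous_on X (J s)"
    and J_dist: "\<And>s x y. s \<in> S \<Longrightarrow> x \<in> X \<Longrightarrow> y \<in> X \<Longrightarrow> J s x \<le> exp (C * dist x y) * J s y"
    and integral_transfer: "\<And>\<phi>. continuous_on X \<phi> \<Longrightarrow>
      (LINT x|lebesgue_on X. (\<Sum>s\<in>S. J s x * \<phi> (\<psi> s x))) = (LINT x|lebesgue_on X. \<phi> x)"
begin

definition transfer :: "('a \<Rightarrow> real) \<Rightarrow> 'a \<Rightarrow> real" where
  "transfer \<phi> x = (\<Sum>s\<in>S. J s x * \<phi> (\<psi> s x))"

abbreviation Leb :: "('a \<Rightarrow> real) \<Rightarrow> real" where "Leb \<phi> \<equiv> (LINT x|lebesgue_on X. \<phi> x)"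

definition cone :: "real \<Rightarrow> real \<Rightarrow> ('a \<Rightarrow> real) \<Rightarrow> bool" where
  "cone \<gamma> a \<phi> \<longleftrightarrow> continuous_on X \<phi> \<and> (\<forall>x\<in>X. 0 \<le> \<phi> x) \<and>
     (\<forall>x\<in>X. \<forall>y\<in>X. \<phi> x \<le> exp (a * dist x y powr \<gamma>) * \<phi> y)"

definition D :: real where "D = diameter X + 1"

lemma X_sets: "X \<in> sets lebesgue"
  using X(1) by (simp add: compact_imp_closed)

lemma emeasure_X: "emeasure (lebesgue_on X) X = 1"
  using X(2) X_sets by (subst emeasure_restrict_space) (simp_all del: emeasure_completion)

lemma fin_measure: "finite_measure (lebesgue_on X)"
  using emeasure_X by (intro finite_measureI) (simp add: space_restrict_space)

lemma measure_X [simp]: "measure (lebesgue_on X) X = 1"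
  using emeasure_X by (simp add: measure_def)

lemma D: "x \<in> X \<Longrightarrow> y \<in> X \<Longrightarrow> dist x y \<le> D" "D \<ge> 1"
  using diameter_bounded_bound[of X x y] diameter_ge_0[of X] X(1)
  by (auto simp: D_def compact_imp_bounded intro: add_increasing2)

lemma X_ne: "X \<noteq> {}"
  using X(2) by auto

lemma integrable_cont:
  assumes "continuous_on X (\<phi> :: 'a \<Rightarrow> real)"
  shows "integrable (lebesgue_on X) \<phi>"
proof -
  interpret finite_measure "lebesgue_on X" by (rule fin_measure)
  obtain B where "\<And>x. x \<in> X \<Longrightarrow> norm (\<phi> x) \<le> B"
    using compact_imp_bounded[OF compact_continuous_image[OF assms X(1)]] by (auto simp: bounded_iff)
  thus ?thesis
    using continuous_imp_measurable_on_sets_lebesgue[OF assms X_sets]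
    by (intro integrable_const_bound[of _ B]) (auto simp: space_restrict_space)
qed

lemma Int_const: "Leb (\<lambda>x. c) = c"
  by (simp add: space_restrict_space)

lemma Int_cong: "(\<And>x. x \<in> X \<Longrightarrow> \<phi> x = \<phi>' x) \<Longrightarrow> Leb \<phi> = Leb \<phi>'"
  by (rule Bochner_Integration.integral_cong) (auto simp: space_restrict_space)

lemma Int_mono:
  "continuous_on X \<phi> \<Longrightarrow> continuous_on X \<phi>' \<Longrightarrow> (\<And>x. x \<in> X \<Longrightarrow> \<phi> x \<le> \<phi>' x) \<Longrightarrow> Leb \<phi> \<le> Leb \<phi>'"
  by (intro Bochner_Integration.integral_mono integrable_cont) (auto simp: space_restrict_space)

lemma \<psi>_cont: "s \<in> S \<Longrightarrow> continuous_on X (\<psi> s)"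
  by (rule lipschitz_on_continuous_on[of l]) (use l \<psi>_contr in \<open>auto intro: lipschitz_onI\<close>)

lemma transfer_cont: "continuous_on X \<phi> \<Longrightarrow> continuous_on X (transfer \<phi>)"
  unfolding transfer_def
  by (intro continuous_intros J_cont continuous_on_compose2[of X \<phi> X "\<psi> s" for s] \<psi>_cont)
     (use \<psi>_in in auto)

lemma transfer_cong: "(\<And>x. x \<in> X \<Longrightarrow> \<phi> x = \<phi>' x) \<Longrightarrow> x \<in> X \<Longrightarrow> transfer \<phi> x = transfer \<phi>' x"
  unfolding transfer_def by (intro sum.cong) (use \<psi>_in in auto)

lemma transfer_diff: "transfer (\<lambda>x. \<phi> x - \<phi>' x) = (\<lambda>x. transfer \<phi> x - transfer \<phi>' x)"
  unfolding transfer_def fun_eq_iff by (simp add: algebra_simps sum_subtractf)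

lemma transfer_cmult: "transfer (\<lambda>x. c * \<phi> x) = (\<lambda>x. c * transfer \<phi> x)"
  unfolding transfer_def fun_eq_iff by (simp add: algebra_simps sum_distrib_left)

lemma Int_transfer: "continuous_on X \<phi> \<Longrightarrow> Leb (transfer \<phi>) = Leb \<phi>"
  unfolding transfer_def by (rule integral_transfer)

lemma iter_cont: "continuous_on X \<phi> \<Longrightarrow> continuous_on X ((transfer ^^ n) \<phi>)"
  by (induction n) (auto intro: transfer_cont)

lemma Int_iter: "continuous_on X \<phi> \<Longrightarrow> Leb ((transfer ^^ n) \<phi>) = Leb \<phi>"
  by (induction n) (auto simp: Int_transfer iter_cont)

lemma iter_diff: "(transfer ^^ n) (\<lambda>x. \<phi> x - \<phi>' x) = (\<lambda>x. (transfer ^^ n) \<phi> x - (transfer ^^ n) \<phi>' x)"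
  by (induction n) (simp_all add: transfer_diff)

lemma iter_cmult: "(transfer ^^ n) (\<lambda>x. c * \<phi> x) = (\<lambda>x. c * (transfer ^^ n) \<phi> x)"
  by (induction n) (simp_all add: transfer_cmult)

lemma dist_powr:
  assumes "0 < \<gamma>" "\<gamma> \<le> 1" "x \<in> X" "y \<in> X"
  shows "dist x y \<le> D powr (1 - \<gamma>) * dist x y powr \<gamma>" "dist x y powr \<gamma> \<le> D powr \<gamma>"
proof -
  have "dist x y = dist x y powr (1 - \<gamma>) * dist x y powr \<gamma>"
    by (simp flip: powr_add)
  also have "\<dots> \<le> D powr (1 - \<gamma>) * dist x y powr \<gamma>"
    using assms D by (intro mult_right_mono powr_mono2) auto
  finally show "dist x y \<le> D powr (1 - \<gamma>) * dist x y powr \<gamma>" .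
  show "dist x y powr \<gamma> \<le> D powr \<gamma>" using assms D by (intro powr_mono2) auto
qed

lemma coneD:
  assumes "cone \<gamma> a \<phi>"
  shows "continuous_on X \<phi>" "\<And>x. x \<in> X \<Longrightarrow> 0 \<le> \<phi> x"
    "\<And>x y. x \<in> X \<Longrightarrow> y \<in> X \<Longrightarrow> \<phi> x \<le> exp (a * dist x y powr \<gamma>) * \<phi> y"
  using assms by (auto simp: cone_def)

lemma cone_mono:
  assumes "cone \<gamma> a \<phi>" "a \<le> b"
  shows "cone \<gamma> b \<phi>"
  unfolding cone_def
proof (intro conjI ballI coneD[OF assms(1)])
  fix x y assume xy: "x \<in> X" "y \<in> X"
  have "exp (a * dist x y powr \<gamma>) * \<phi> y \<le> exp (b * dist x y powr \<gamma>) * \<phi> y"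
    using assms(2) coneD(2)[OF assms(1) xy(2)] by (intro mult_right_mono) (auto intro: mult_right_mono)
  with coneD(3)[OF assms(1) xy] show "\<phi> x \<le> exp (b * dist x y powr \<gamma>) * \<phi> y" by linarith
qed

lemma cone_cmult:
  assumes "cone \<gamma> a \<phi>" "0 \<le> c"
  shows "cone \<gamma> a (\<lambda>x. c * \<phi> x)"
  unfolding cone_def
proof (intro conjI ballI continuous_intros coneD(1)[OF assms(1)])
  show "0 \<le> c * \<phi> x" if "x \<in> X" for x using coneD(2)[OF assms(1) that] assms by simp
  fix x y assume xy: "x \<in> X" "y \<in> X"
  show "c * \<phi> x \<le> exp (a * dist x y powr \<gamma>) * (c * \<phi> y)"
    using mult_left_mono[OF coneD(3)[OF assms(1) xy] assms(2)] by (simp only: mult.left_commute)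
qed

text \<open>On a bounded set a Lipschitz bound is a Hoelder bound. This brings the log-Lipschitz
  density and observables of exponent \<gamma> into the same cone.\<close>

lemma cone_exponent:
  assumes "cone 1 a \<phi>" "0 \<le> a" "0 < \<gamma>" "\<gamma> \<le> 1"
  shows "cone \<gamma> (a * D powr (1 - \<gamma>)) \<phi>"
  unfolding cone_def
proof (intro conjI ballI)
  fix x y assume xy: "x \<in> X" "y \<in> X"
  have "\<phi> x \<le> exp (a * dist x y powr 1) * \<phi> y" using coneD[OF assms(1)] xy by blast
  also have "\<dots> \<le> exp (a * D powr (1 - \<gamma>) * dist x y powr \<gamma>) * \<phi> y"
    using coneD[OF assms(1)] xy dist_powr[OF assms(3,4) xy] assms
    by (intro mult_right_mono) (auto simp: mult.assoc intro: mult_left_mono)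
  finally show "\<phi> x \<le> exp (a * D powr (1 - \<gamma>) * dist x y powr \<gamma>) * \<phi> y" .
qed (use coneD[OF assms(1)] in auto)

text \<open>A Harnack inequality: values at any two points are comparable, and averaging over one of
  them is harmless because \<open>X\<close> has volume 1.\<close>

lemma cone_Int:
  assumes "cone \<gamma> a \<phi>" "0 < \<gamma>" "\<gamma> \<le> 1" "0 \<le> a" "x \<in> X"
  shows "Leb \<phi> \<le> exp (a * D powr \<gamma>) * \<phi> x" "\<phi> x \<le> exp (a * D powr \<gamma>) * Leb \<phi>"
proof -
  note c = coneD[OF assms(1)]
  have *: "\<phi> x \<le> exp (a * D powr \<gamma>) * \<phi> y" if "x \<in> X" "y \<in> X" for x y
  proof -
    have "\<phi> x \<le> exp (a * dist x y powr \<gamma>) * \<phi> y" by (rule c(3)[OF that])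
    also have "\<dots> \<le> exp (a * D powr \<gamma>) * \<phi> y"
      using that c(2) dist_powr[OF assms(2,3) that] assms by (intro mult_right_mono) (auto intro: mult_left_mono)
    finally show ?thesis .
  qed
  have "Leb \<phi> \<le> Leb (\<lambda>_. exp (a * D powr \<gamma>) * \<phi> x)"
    using c * assms by (intro Int_mono) auto
  thus "Leb \<phi> \<le> exp (a * D powr \<gamma>) * \<phi> x" by (simp add: Int_const)
  have "Leb (\<lambda>_. \<phi> x) \<le> Leb (\<lambda>y. exp (a * D powr \<gamma>) * \<phi> y)"
    using c * assms by (intro Int_mono) (auto intro!: continuous_intros)
  thus "\<phi> x \<le> exp (a * D powr \<gamma>) * Leb \<phi>" by (simp add: Int_const)
qed

text \<open>The Lasota-Yorke mechanism: contraction of the branches multiplies the logarithmic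
  Hoelder constant by \<open>l powr \<gamma>\<close>, and distortion of the weights adds a fixed
  amount. The comparison holds term by term and survives summation.\<close>

lemma transfer_cone:
  assumes "cone \<gamma> a \<phi>" "0 < \<gamma>" "\<gamma> \<le> 1" "0 \<le> a"
  shows "cone \<gamma> (C * D powr (1 - \<gamma>) + l powr \<gamma> * a) (transfer \<phi>)"
  unfolding cone_def
proof (intro conjI ballI)
  note c = coneD[OF assms(1)]
  show "continuous_on X (transfer \<phi>)" using c by (intro transfer_cont)
  show "0 \<le> transfer \<phi> x" if "x \<in> X" for x
    unfolding transfer_def using c J_pos \<psi>_in that
    by (intro sum_nonneg mult_nonneg_nonneg) (auto intro: less_imp_le)
  fix x y assume xy: "x \<in> X" "y \<in> X"
  let ?d = "dist x y powr \<gamma>"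
  have "J s x * \<phi> (\<psi> s x) \<le> exp ((C * D powr (1 - \<gamma>) + l powr \<gamma> * a) * ?d) * (J s y * \<phi> (\<psi> s y))"
    if s: "s \<in> S" for s
  proof -
    have "J s x \<le> exp (C * dist x y) * J s y" by (rule J_dist[OF s xy])
    also have "\<dots> \<le> exp (C * D powr (1 - \<gamma>) * ?d) * J s y"
      using J_pos[OF s xy(2)] dist_powr[OF assms(2,3) xy] C
      by (intro mult_right_mono) (auto simp: mult.assoc intro: mult_left_mono)
    finally have 1: "J s x \<le> exp (C * D powr (1 - \<gamma>) * ?d) * J s y" .
    have "dist (\<psi> s x) (\<psi> s y) powr \<gamma> \<le> (l * dist x y) powr \<gamma>"
      using \<psi>_contr[OF s xy] assms by (intro powr_mono2) auto
    also have "\<dots> = l powr \<gamma> * ?d" using l by (simp add: powr_mult)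
    finally have "a * dist (\<psi> s x) (\<psi> s y) powr \<gamma> \<le> l powr \<gamma> * a * ?d"
      using assms by (simp add: mult_left_mono mult.left_commute mult.assoc)
    hence "exp (a * dist (\<psi> s x) (\<psi> s y) powr \<gamma>) * \<phi> (\<psi> s y) \<le> exp (l powr \<gamma> * a * ?d) * \<phi> (\<psi> s y)"
      using c(2)[OF \<psi>_in[OF s xy(2)]] by (intro mult_right_mono) auto
    with c(3)[OF \<psi>_in[OF s xy(1)] \<psi>_in[OF s xy(2)]]
    have 2: "\<phi> (\<psi> s x) \<le> exp (l powr \<gamma> * a * ?d) * \<phi> (\<psi> s y)" by linarith
    have "J s x * \<phi> (\<psi> s x) \<le> (exp (C * D powr (1 - \<gamma>) * ?d) * J s y) * (exp (l powr \<gamma> * a * ?d) * \<phi> (\<psi> s y))"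
      using 1 2 J_pos[OF s xy(2)] c(2)[OF \<psi>_in[OF s xy(1)]] by (intro mult_mono) auto
    also have "\<dots> = exp ((C * D powr (1 - \<gamma>) + l powr \<gamma> * a) * ?d) * (J s y * \<phi> (\<psi> s y))"
      by (simp add: distrib_right exp_add)
    finally show ?thesis .
  qed
  thus "transfer \<phi> x \<le> exp ((C * D powr (1 - \<gamma>) + l powr \<gamma> * a) * ?d) * transfer \<phi> y"
    unfolding transfer_def sum_distrib_left by (rule sum_mono)
qed

text \<open>The solution of \<open>C * D powr (1 - \<gamma>) + l powr \<gamma> * a = a - 1\<close>:
  from this parameter on, one step lowers the parameter by a full unit, and that unit pays for the
  removal of a constant.\<close>

definition aper :: "real \<Rightarrow> real" where
  "aper \<gamma> = (C * D powr (1 - \<gamma>) + 1) / (1 - l powr \<gamma>)"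

text \<open>The exponential is the Harnack lower bound of a function with parameter
  \<open>a - 1\<close> relative to its mass. Division by \<open>a\<close> is what
  \<open>exp_diff_ge\<close> requires; the factor 2 keeps \<open>eta\<close> at most 1/2, so that
  the rate \<open>1 - eta\<close> is positive.\<close>

definition eta :: "real \<Rightarrow> real \<Rightarrow> real" where
  "eta \<gamma> a = exp (- ((a - 1) * D powr \<gamma>)) / (2 * a)"

lemma aper:
  assumes "0 < \<gamma>" "aper \<gamma> \<le> a"
  shows "C * D powr (1 - \<gamma>) + l powr \<gamma> * a \<le> a - 1" "1 \<le> a"
proof -
  have q: "0 < l powr \<gamma>" "l powr \<gamma> < 1"
    using l assms powr_less_mono2[of \<gamma> l 1] by auto
  show *: "C * D powr (1 - \<gamma>) + l powr \<gamma> * a \<le> a - 1"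
    using assms(2) q by (simp add: aper_def field_simps)
  have "0 \<le> C * D powr (1 - \<gamma>)" using C by simp
  hence "(1 - l powr \<gamma>) * a \<ge> 1" using * by (simp add: algebra_simps)
  moreover from this have "a > 0" using q by (metis diff_gt_0_iff_gt less_le_trans zero_less_mult_pos zero_less_one)
  ultimately show "1 \<le> a" using q by (smt (verit) mult_left_le_one_le)
qed

lemma eta: "0 < \<gamma> \<Longrightarrow> 1 \<le> a \<Longrightarrow> 0 < eta \<gamma> a \<and> eta \<gamma> a \<le> 1 / 2"
proof -
  assume "0 < \<gamma>" and a: "1 \<le> a"
  have "exp (- ((a - 1) * D powr \<gamma>)) \<le> 1" using a by simp
  hence "exp (- ((a - 1) * D powr \<gamma>)) \<le> a" using a by linarith
  thus ?thesis using a by (simp add: eta_def field_simps)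
qed

text \<open>The contraction: a fixed fraction of the mass becomes uniformly distributed, and removing it
  does not leave the cone.\<close>

lemma transfer_cone_minus:
  assumes "cone \<gamma> a \<phi>" "0 < \<gamma>" "\<gamma> \<le> 1" "aper \<gamma> \<le> a"
  shows "cone \<gamma> a (\<lambda>x. transfer \<phi> x - eta \<gamma> a * Leb \<phi>)"
  unfolding cone_def
proof (intro conjI ballI)
  note a = aper[OF assms(2,4)]
  have c1: "cone \<gamma> (a - 1) (transfer \<phi>)"
    using cone_mono[OF transfer_cone[OF assms(1-3)]] a by simp
  note c = coneD[OF c1]
  show "continuous_on X (\<lambda>x. transfer \<phi> x - eta \<gamma> a * Leb \<phi>)"
    using c by (intro continuous_intros) 
  have I: "Leb (transfer \<phi>) = Leb \<phi>" using coneD[OF assms(1)] by (simp add: Int_transfer)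
  have low: "2 * a * (eta \<gamma> a * Leb \<phi>) \<le> transfer \<phi> x" if "x \<in> X" for x
  proof -
    have "Leb \<phi> \<le> exp ((a - 1) * D powr \<gamma>) * transfer \<phi> x"
      using cone_Int(1)[OF c1 assms(2,3) _ that] a I by simp
    hence "exp (- ((a - 1) * D powr \<gamma>)) * Leb \<phi> \<le> transfer \<phi> x"
      using mult_left_mono[of "Leb \<phi>" "exp ((a - 1) * D powr \<gamma>) * transfer \<phi> x" "exp (- ((a - 1) * D powr \<gamma>))"]
      by (simp add: mult.assoc[symmetric] flip: exp_add)
    thus ?thesis using a by (simp add: eta_def)
  qed
  have Ip: "0 \<le> Leb \<phi>" 
    using Int_mono[of "\<lambda>_. 0" \<phi>] coneD[OF assms(1)] by (simp add: Int_const)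
  have e0: "0 \<le> eta \<gamma> a * Leb \<phi>" using eta[OF assms(2), of a] a Ip by simp
  have low1: "a * (eta \<gamma> a * Leb \<phi>) \<le> transfer \<phi> x" if "x \<in> X" for x
    using low[OF that] mult_nonneg_nonneg[of a "eta \<gamma> a * Leb \<phi>"] a e0 by linarith
  show "0 \<le> transfer \<phi> x - eta \<gamma> a * Leb \<phi>" if "x \<in> X" for x
    using low1[OF that] mult_right_mono[OF a(2) e0] by simp
  fix x y assume xy: "x \<in> X" "y \<in> X"
  let ?d = "dist x y powr \<gamma>"
  \<comment> \<open>The unit gained in the exponent: moving from \<open>a - 1\<close> to
    \<open>a\<close> absorbs the subtracted constant, which is at most
    \<open>transfer \<phi> y / a\<close>.\<close>
  have "1 / a * (exp (a * ?d) - 1) \<le> exp (a * ?d) - exp ((a - 1) * ?d)"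
    using exp_diff_ge[of "a - 1" a ?d] a by simp
  hence 1: "(exp (a * ?d) - 1) \<le> a * (exp (a * ?d) - exp ((a - 1) * ?d))"
    using a by (simp add: field_simps)
  have "(exp (a * ?d) - 1) * (eta \<gamma> a * Leb \<phi>)
      \<le> a * (exp (a * ?d) - exp ((a - 1) * ?d)) * (eta \<gamma> a * Leb \<phi>)"
    by (rule mult_right_mono[OF 1 e0])
  also have "\<dots> = (exp (a * ?d) - exp ((a - 1) * ?d)) * (a * (eta \<gamma> a * Leb \<phi>))" by simp
  also have "\<dots> \<le> (exp (a * ?d) - exp ((a - 1) * ?d)) * transfer \<phi> y"
    by (rule mult_left_mono[OF low1[OF xy(2)]]) (auto intro: mult_right_mono)
  finally show "transfer \<phi> x - eta \<gamma> a * Leb \<phi> \<le> exp (a * ?d) * (transfer \<phi> y - eta \<gamma> a * Leb \<phi>)"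
    using c(3)[OF xy] by (simp add: algebra_simps)
qed

lemma iter_cone:
  assumes "cone \<gamma> a \<phi>" "0 < \<gamma>" "\<gamma> \<le> 1" "aper \<gamma> \<le> a"
  shows "cone \<gamma> a ((transfer ^^ n) \<phi>)"
proof (induction n)
  case (Suc n)
  note a = aper[OF assms(2,4)]
  show ?case using cone_mono[OF transfer_cone[OF Suc assms(2,3)], of a] a by simp
qed (use assms in auto)

text \<open>Equal masses mean that the same constant is removed from both functions in each step.
  The constants cancel in the difference, while the remainders stay in the cone and their mass
  shrinks by \<open>1 - eta\<close>.\<close>

lemma iter_coupling:
  assumes "cone \<gamma> a \<phi>" "cone \<gamma> a \<phi>'" "Leb \<phi> = Leb \<phi>'" "0 < \<gamma>" "\<gamma> \<le> 1" "aper \<gamma> \<le> a" 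
  shows "\<exists>u v. cone \<gamma> a u \<and> cone \<gamma> a v \<and> Leb u = (1 - eta \<gamma> a) ^ n * Leb \<phi> \<and>
     Leb v = (1 - eta \<gamma> a) ^ n * Leb \<phi> \<and>
     (\<forall>x\<in>X. (transfer ^^ n) \<phi> x - (transfer ^^ n) \<phi>' x = u x - v x)"
proof (induction n)
  case 0
  show ?case by (intro exI[of _ \<phi>] exI[of _ \<phi>']) (simp add: assms)
next
  case (Suc n)
  let ?t = "1 - eta \<gamma> a"
  obtain u v where uv: "cone \<gamma> a u" "cone \<gamma> a v" "Leb u = ?t ^ n * Leb \<phi>" "Leb v = ?t ^ n * Leb \<phi>"
    "\<And>x. x \<in> X \<Longrightarrow> (transfer ^^ n) \<phi> x - (transfer ^^ n) \<phi>' x = u x - v x"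
    using Suc by blast
  have I: "Leb (\<lambda>x. transfer w x - eta \<gamma> a * Leb w) = ?t * Leb w" if "cone \<gamma> a w" for w
    using coneD(1)[OF that] 
    by (subst Bochner_Integration.integral_diff)
       (auto simp: Int_transfer Int_const transfer_cont intro!: integrable_cont, simp add: algebra_simps)
  show ?case
  proof (intro exI conjI ballI)
    show "cone \<gamma> a (\<lambda>x. transfer u x - eta \<gamma> a * Leb u)" "cone \<gamma> a (\<lambda>x. transfer v x - eta \<gamma> a * Leb v)"
      by (rule transfer_cone_minus[OF uv(1) assms(4-6)], rule transfer_cone_minus[OF uv(2) assms(4-6)])
    show "Leb (\<lambda>x. transfer u x - eta \<gamma> a * Leb u) = ?t ^ Suc n * Leb \<phi>"
         "Leb (\<lambda>x. transfer v x - eta \<gamma> a * Leb v) = ?t ^ Suc n * Leb \<phi>"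
      by (rule trans[OF I[OF uv(1)]], simp only: uv power_Suc mult.assoc,
          rule trans[OF I[OF uv(2)]], simp only: uv power_Suc mult.assoc)
    fix x assume x: "x \<in> X"
    have "(transfer ^^ Suc n) \<phi> x - (transfer ^^ Suc n) \<phi>' x =
        transfer (\<lambda>x. (transfer ^^ n) \<phi> x - (transfer ^^ n) \<phi>' x) x"
      by (simp add: transfer_diff)
    also have "\<dots> = transfer (\<lambda>x. u x - v x) x" by (rule transfer_cong[OF uv(5) x])
    finally show "(transfer ^^ Suc n) \<phi> x - (transfer ^^ Suc n) \<phi>' x =
        transfer u x - eta \<gamma> a * Leb u - (transfer v x - eta \<gamma> a * Leb v)"
      using uv by (simp add: transfer_diff)
  qed
qed

text \<open>Both remainders of the coupling lie between 0 and the Harnack multiple of their mass,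
  which therefore bounds their difference.\<close>

lemma iter_contract:
  assumes "cone \<gamma> a \<phi>" "cone \<gamma> a \<phi>'" "Leb \<phi> = Leb \<phi>'" "0 < \<gamma>" "\<gamma> \<le> 1" "aper \<gamma> \<le> a" "x \<in> X"
  shows "\<bar>(transfer ^^ n) \<phi> x - (transfer ^^ n) \<phi>' x\<bar> \<le> exp (a * D powr \<gamma>) * (1 - eta \<gamma> a) ^ n * Leb \<phi>"
proof -
  obtain u v where uv: "cone \<gamma> a u" "cone \<gamma> a v" "Leb u = (1 - eta \<gamma> a) ^ n * Leb \<phi>"
    "Leb v = (1 - eta \<gamma> a) ^ n * Leb \<phi>" "(transfer ^^ n) \<phi> x - (transfer ^^ n) \<phi>' x = u x - v x"
    using iter_coupling[OF assms(1-6)] assms(7) by blast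
  have "a \<ge> 0" using aper[OF assms(4,6)] by simp
  hence "u x \<le> exp (a * D powr \<gamma>) * Leb u" "v x \<le> exp (a * D powr \<gamma>) * Leb v"
    using cone_Int(2) uv assms by blast+
  moreover have "0 \<le> u x" "0 \<le> v x" using uv(1,2) assms(7) by (auto dest: coneD)
  ultimately show ?thesis using uv(3-5) by (simp add: mult.assoc)
qed

lemma cone_1: "0 \<le> a \<Longrightarrow> cone \<gamma> a (\<lambda>_. 1)"
  by (auto simp: cone_def)

section \<open>The invariant density and exponential convergence to it\<close>

definition density_fun :: "'a \<Rightarrow> real" where
  "density_fun x = lim (\<lambda>n. (transfer ^^ n) (\<lambda>_. 1) x)"

text \<open>The function 1 and its \<open>k\<close>-th iterate lie in the same cone and have the
  same mass, so \<open>n\<close> further steps bring them together at the coupling rate.\<close>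

lemma iter_1_cauchy:
  assumes "x \<in> X"
  shows "\<bar>(transfer ^^ (n + k)) (\<lambda>_. 1) x - (transfer ^^ n) (\<lambda>_. 1) x\<bar>
    \<le> exp (aper 1 * D) * (1 - eta 1 (aper 1)) ^ n"
proof -
  have a: "1 \<le> aper 1" using aper[of 1 "aper 1"] by simp
  have c: "cone 1 (aper 1) (\<lambda>_. 1)" using a by (intro cone_1) auto
  have "cone 1 (aper 1) ((transfer ^^ k) (\<lambda>_. 1))" using iter_cone[OF c, of k] by simp
  moreover have I: "Leb ((transfer ^^ k) (\<lambda>_. 1)) = 1" "Leb (\<lambda>_. 1) = 1"
    by (simp_all only: Int_iter Int_const continuous_on_const)
  ultimately have "\<bar>(transfer ^^ n) ((transfer ^^ k) (\<lambda>_. 1)) x - (transfer ^^ n) (\<lambda>_. 1) x\<bar>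
    \<le> exp (aper 1 * D powr 1) * (1 - eta 1 (aper 1)) ^ n * Leb ((transfer ^^ k) (\<lambda>_. 1))"
    by (intro iter_contract[OF _ c _ _ _ _ assms]) (simp_all add: I)
  thus ?thesis using D(2) by (simp only: I funpow_add o_def powr_one mult_1_right)
qed

lemma density_fun_rate:
  assumes "x \<in> X"
  shows "\<bar>(transfer ^^ n) (\<lambda>_. 1) x - density_fun x\<bar> \<le> exp (aper 1 * D) * (1 - eta 1 (aper 1)) ^ n"
    and "(\<lambda>n. (transfer ^^ n) (\<lambda>_. 1) x) \<longlonglongrightarrow> density_fun x"
proof -
  let ?r = "1 - eta 1 (aper 1)" and ?u = "\<lambda>n. (transfer ^^ n) (\<lambda>_. 1) x"
  have r: "0 \<le> ?r" "?r < 1" using eta[of 1 "aper 1"] aper[of 1 "aper 1"] by auto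
  have "(\<lambda>n. exp (aper 1 * D) * ?r ^ n) \<longlonglongrightarrow> exp (aper 1 * D) * 0"
    using r by (intro tendsto_intros LIMSEQ_power_zero) auto
  hence z: "(\<lambda>n. exp (aper 1 * D) * ?r ^ n) \<longlonglongrightarrow> 0" by simp
  have "Cauchy ?u"
  proof (rule CauchyI')
    fix e :: real assume "e > 0"
    then obtain N where N: "exp (aper 1 * D) * ?r ^ n < e" if "n \<ge> N" for n
      using order_tendstoD(2)[OF z] by (auto simp: eventually_sequentially)
    show "\<exists>M. \<forall>m\<ge>M. \<forall>n>m. dist (?u m) (?u n) < e"
    proof (intro exI allI impI)
      fix m n assume "N \<le> m" "m < n"
      thus "dist (?u m) (?u n) < e"
        using iter_1_cauchy[OF assms, of m "n - m"] N[of m] by (simp add: dist_real_def abs_minus_commute)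
    qed
  qed
  thus lim: "?u \<longlonglongrightarrow> density_fun x"
    unfolding density_fun_def by (simp add: Cauchy_convergent_iff convergent_LIMSEQ_iff)
  have "(\<lambda>k. \<bar>?u (n + k) - ?u n\<bar>) \<longlonglongrightarrow> \<bar>density_fun x - ?u n\<bar>"
    using LIMSEQ_ignore_initial_segment[OF lim, of n] by (intro tendsto_intros) (simp only: add.commute)
  hence "\<bar>density_fun x - ?u n\<bar> \<le> exp (aper 1 * D) * ?r ^ n"
    by (rule LIMSEQ_le_const2) (use iter_1_cauchy[OF assms] in auto)
  thus "\<bar>?u n - density_fun x\<bar> \<le> exp (aper 1 * D) * ?r ^ n" by (simp add: abs_minus_commute)
qed

lemma density_fun:
  shows "cone 1 (aper 1) density_fun" "Leb density_fun = 1"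
    "\<And>x. x \<in> X \<Longrightarrow> transfer density_fun x = density_fun x"
    "\<And>x. x \<in> X \<Longrightarrow> density_fun x > 0"
proof -
  let ?r = "1 - eta 1 (aper 1)" and ?u = "\<lambda>n. (transfer ^^ n) (\<lambda>_. 1)" and ?h = density_fun
  have a: "1 \<le> aper 1" using aper[of 1 "aper 1"] by simp
  have r: "0 \<le> ?r" "?r < 1" using eta[of 1 "aper 1"] a by auto
  have "(\<lambda>n. exp (aper 1 * D) * ?r ^ n) \<longlonglongrightarrow> exp (aper 1 * D) * 0"
    using r by (intro tendsto_intros LIMSEQ_power_zero) auto
  hence z: "(\<lambda>n. exp (aper 1 * D) * ?r ^ n) \<longlonglongrightarrow> 0" by simp
  have c: "cone 1 (aper 1) (?u n)" for n
    using iter_cone[OF cone_1[of "aper 1" 1], of n] a by simp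
  have "uniform_limit X ?u ?h sequentially"
    unfolding uniform_limit_iff
  proof (intro allI impI)
    fix e :: real assume "e > 0"
    from order_tendstoD(2)[OF z this] show "\<forall>\<^sub>F n in sequentially. \<forall>x\<in>X. dist (?u n x) (?h x) < e"
    proof eventually_elim
      case (elim n)
      show ?case
        unfolding dist_real_def by (intro ballI le_less_trans[OF density_fun_rate(1) elim])
    qed
  qed
  hence cont: "continuous_on X ?h"
    by (rule uniform_limit_theorem[rotated]) (auto simp: iter_cont)
  show hc: "cone 1 (aper 1) ?h" unfolding cone_def
  proof (intro conjI ballI cont)
    fix x y assume xy: "x \<in> X" "y \<in> X"
    show "0 \<le> ?h x"
      by (rule LIMSEQ_le_const[OF density_fun_rate(2)[OF xy(1)]]) (use coneD(2)[OF c xy(1)] in auto)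
    show "?h x \<le> exp (aper 1 * dist x y powr 1) * ?h y"
      by (rule LIMSEQ_le[OF density_fun_rate(2)[OF xy(1)] tendsto_mult_left[OF density_fun_rate(2)[OF xy(2)]]])
         (use coneD(3)[OF c xy] in auto)
  qed
  have "\<bar>Leb ?h - 1\<bar> \<le> exp (aper 1 * D) * ?r ^ n" for n
  proof -
    have "Leb ?h - 1 = Leb ?h - Leb (?u n)" by (simp add: Int_iter Int_const)
    also have "\<dots> = Leb (\<lambda>x. ?h x - ?u n x)"
      by (intro Bochner_Integration.integral_diff[symmetric] integrable_cont iter_cont cont) auto
    also have "\<bar>\<dots>\<bar> \<le> Leb (\<lambda>x. \<bar>?h x - ?u n x\<bar>)" by (rule integral_abs_bound)
    also have "\<dots> \<le> Leb (\<lambda>_. exp (aper 1 * D) * ?r ^ n)"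
      by (intro Int_mono continuous_intros cont iter_cont) (use density_fun_rate(1)[of _ n] in \<open>auto simp: abs_minus_commute\<close>)
    finally show ?thesis by (simp add: Int_const)
  qed
  hence "\<bar>Leb ?h - 1\<bar> \<le> 0" by (intro LIMSEQ_le_const[OF z]) auto
  thus I: "Leb ?h = 1" by simp
  show "transfer ?h x = ?h x" if x: "x \<in> X" for x
  proof (rule LIMSEQ_unique)
    show "(\<lambda>n. ?u (Suc n) x) \<longlonglongrightarrow> ?h x"
      using density_fun_rate(2)[OF x] by (rule LIMSEQ_Suc)
    have "(\<lambda>n. \<Sum>s\<in>S. J s x * ?u n (\<psi> s x)) \<longlonglongrightarrow> (\<Sum>s\<in>S. J s x * ?h (\<psi> s x))"
      by (intro tendsto_intros density_fun_rate(2) \<psi>_in x)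
    thus "(\<lambda>n. ?u (Suc n) x) \<longlonglongrightarrow> transfer ?h x"
      by (simp only: funpow.simps o_def transfer_def[of _ x])
  qed
  \<comment> \<open>Mass 1 and the Harnack inequality exclude small values.\<close>
  show "?h x > 0" if x: "x \<in> X" for x
  proof -
    have "1 \<le> exp (aper 1 * D powr 1) * ?h x" using cone_Int(1)[OF hc _ _ _ x] a I by simp
    thus ?thesis by (metis exp_gt_zero less_le_trans zero_less_mult_pos zero_less_one)
  qed
qed

text \<open>After the shift, \<open>f + 2 * K\<close> has values between \<open>K\<close> and
  \<open>3 * K\<close> and oscillates by at most \<open>K * dist x y powr \<gamma>\<close>, so the
  Hoelder constant of its logarithm is at most 1, whatever \<open>K\<close> is. This makes the decay
  linear in \<open>K\<close>.\<close>

lemma hoelder_density_cone: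
  assumes f: "hoelder_on X \<gamma> K f" and \<gamma>: "0 < \<gamma>" "\<gamma> \<le> 1"
  shows "cone \<gamma> (1 + aper 1 * D powr (1 - \<gamma>)) (\<lambda>x. (f x + 2 * K) * density_fun x)"
  unfolding cone_def
proof (intro conjI ballI)
  let ?h = density_fun
  have fb: "\<bar>f x\<bar> \<le> K" if "x \<in> X" for x using f that by (auto simp: hoelder_on_def)
  have fh: "\<bar>f x - f y\<bar> \<le> K * dist x y powr \<gamma>" if "x \<in> X" "y \<in> X" for x y
    using f that by (auto simp: hoelder_on_def)
  obtain x0 where "x0 \<in> X" using X_ne by blast
  from fb[OF this] have K: "0 \<le> K" by linarith
  have a: "1 \<le> aper 1" using aper[of 1 "aper 1"] by simp
  have "cone \<gamma> (aper 1 * D powr (1 - \<gamma>)) ?h" using a by (intro cone_exponent density_fun(1) \<gamma>) simp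
  note c = coneD[OF this]
  have "continuous_on X f" by (rule hoelder_on_imp_continuous_on[OF f \<gamma>(1)])
  thus "continuous_on X (\<lambda>x. (f x + 2 * K) * ?h x)" using coneD[OF density_fun(1)] by (intro continuous_intros)
  have p: "K \<le> f x + 2 * K" if "x \<in> X" for x using fb[OF that] by linarith
  show "0 \<le> (f x + 2 * K) * ?h x" if "x \<in> X" for x
    using p[OF that] K density_fun(4)[OF that] by simp
  fix x y assume xy: "x \<in> X" "y \<in> X"
  let ?d = "dist x y powr \<gamma>"
  have "f x + 2 * K \<le> (f y + 2 * K) + K * ?d" using fh[OF xy] by linarith
  also have "\<dots> \<le> (f y + 2 * K) + (f y + 2 * K) * ?d"
    using p[OF xy(2)] by (intro add_left_mono mult_right_mono) auto
  also have "\<dots> = (1 + ?d) * (f y + 2 * K)" by (simp add: algebra_simps)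
  also have "\<dots> \<le> exp ?d * (f y + 2 * K)"
    using p[OF xy(2)] K by (intro mult_right_mono exp_ge_add_one_self) auto
  finally have 1: "f x + 2 * K \<le> exp ?d * (f y + 2 * K)" .
  have 2: "?h x \<le> exp (aper 1 * D powr (1 - \<gamma>) * ?d) * ?h y" by (rule c(3)[OF xy])
  have "(f x + 2 * K) * ?h x \<le> (exp ?d * (f y + 2 * K)) * (exp (aper 1 * D powr (1 - \<gamma>) * ?d) * ?h y)"
    using 1 2 p[OF xy(1)] p[OF xy(2)] K density_fun(4)[OF xy(1)] by (intro mult_mono) auto
  moreover have "exp ((1 + aper 1 * D powr (1 - \<gamma>)) * ?d) = exp ?d * exp (aper 1 * D powr (1 - \<gamma>) * ?d)"
    by (simp add: distrib_right exp_add)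
  ultimately show "(f x + 2 * K) * ?h x \<le> exp ((1 + aper 1 * D powr (1 - \<gamma>)) * ?d) * ((f y + 2 * K) * ?h y)"
    by (simp only: mult_ac)
qed

text \<open>The shifted product is compared with the multiple of the density of the same mass. The
  shift contributes \<open>2 * K * density_fun\<close>, which is invariant and cancels; the bound
  \<open>3 * K\<close> on the mass gives the factor 3.\<close>

theorem transfer_hoelder_decay:
  assumes \<gamma>: "0 < \<gamma>" "\<gamma> \<le> 1"
  shows "\<exists>B \<rho>. 0 < \<rho> \<and> \<rho> < 1 \<and> (\<forall>f K n x. hoelder_on X \<gamma> K f \<longrightarrow> x \<in> X \<longrightarrow>
     \<bar>(transfer ^^ n) (\<lambda>x. f x * density_fun x) x - Leb (\<lambda>x. f x * density_fun x) * density_fun x\<bar> \<le> B * K * \<rho> ^ n)"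
proof -
  let ?h = density_fun
  define a where "a = max (aper \<gamma>) (1 + aper 1 * D powr (1 - \<gamma>))"
  have a: "aper \<gamma> \<le> a" "1 + aper 1 * D powr (1 - \<gamma>) \<le> a" by (auto simp: a_def)
  have a1: "1 \<le> aper 1" "1 \<le> a" using aper[of 1 "aper 1"] aper[OF \<gamma>(1) a(1)] by auto
  have hc: "cone \<gamma> a ?h"
    using cone_mono[OF cone_exponent[OF density_fun(1) _ \<gamma>], of a] a a1 by simp
  let ?r = "1 - eta \<gamma> a"
  have r: "0 < ?r" "?r < 1" using eta[OF \<gamma>(1) a1(2)] by auto
  have "\<bar>(transfer ^^ n) (\<lambda>x. f x * ?h x) x - Leb (\<lambda>x. f x * ?h x) * ?h x\<bar> \<le> (3 * exp (a * D powr \<gamma>)) * K * ?r ^ n"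
    if f: "hoelder_on X \<gamma> K f" and x: "x \<in> X" for f K n x
  proof -
    let ?\<phi> = "\<lambda>x. (f x + 2 * K) * ?h x"
    have fc: "cone \<gamma> a ?\<phi>" by (rule cone_mono[OF hoelder_density_cone[OF f \<gamma>] a(2)])
    note cont = coneD(1)[OF hc] coneD(1)[OF fc]
    have fb: "f x \<le> K" if "x \<in> X" for x
      using f that by (auto simp: hoelder_on_def dest!: bspec intro: abs_le_D1)
    have I\<phi>: "Leb ?\<phi> \<ge> 0" using Int_mono[of "\<lambda>_. 0" ?\<phi>] coneD[OF fc] by (simp add: Int_const)
    have "Leb ?\<phi> \<le> Leb (\<lambda>x. 3 * K * ?h x)"
    proof (intro Int_mono[OF cont(2) continuous_on_mult_left[OF cont(1)]] mult_right_mono)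
      fix x assume "x \<in> X"
      with fb[of x] density_fun(4)[of x] show "f x + 2 * K \<le> 3 * K" "0 \<le> ?h x" by auto
    qed
    hence I3: "Leb ?\<phi> \<le> 3 * K" by (simp add: density_fun(2))
    have eq: "f x * ?h x = ?\<phi> x - 2 * K * ?h x" for x by (simp add: algebra_simps)
    have "Leb (\<lambda>x. f x * ?h x) = Leb ?\<phi> - Leb (\<lambda>x. 2 * K * ?h x)"
      unfolding eq by (intro Bochner_Integration.integral_diff integrable_cont continuous_on_mult_left cont)
    hence I: "Leb (\<lambda>x. f x * ?h x) = Leb ?\<phi> - 2 * K" by (simp add: density_fun(2))
    have hinv: "(transfer ^^ n) ?h y = ?h y" if "y \<in> X" for y
      using that
    proof (induction n arbitrary: y)
      case (Suc n)
      thus ?case using transfer_cong[of "(transfer ^^ n) ?h" ?h y] density_fun(3) by simp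
    qed simp
    have "\<bar>(transfer ^^ n) ?\<phi> x - (transfer ^^ n) (\<lambda>x. Leb ?\<phi> * ?h x) x\<bar> \<le> exp (a * D powr \<gamma>) * ?r ^ n * Leb ?\<phi>"
    proof (rule iter_contract[OF fc cone_cmult[OF hc I\<phi>] _ \<gamma> a(1) x])
      show "Leb ?\<phi> = Leb (\<lambda>x. Leb ?\<phi> * ?h x)" using density_fun(2) by simp
    qed
    also have "\<dots> \<le> exp (a * D powr \<gamma>) * ?r ^ n * (3 * K)"
      using I3 r by (intro mult_left_mono) auto
    finally show ?thesis
      unfolding eq iter_diff iter_cmult I using hinv[OF x]
      by (simp add: algebra_simps I)
  qed
  with r show ?thesis by (intro exI[of _ "3 * exp (a * D powr \<gamma>)"] exI[of _ ?r] conjI allI impI) 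
qed

end

section \<open>Density of Lipschitz functions in the space of integrable functions\<close>

lemma hoelder_on_add:
  assumes "hoelder_on X \<gamma> K f" "hoelder_on X \<gamma> L g"
  shows "hoelder_on X \<gamma> (K + L) (\<lambda>x. f x + g x)"
  unfolding hoelder_on_def
proof (intro conjI ballI)
  fix x assume x: "x \<in> X"
  have "\<bar>f x\<bar> \<le> K" "\<bar>g x\<bar> \<le> L" using assms x by (auto simp: hoelder_on_def)
  thus "\<bar>f x + g x\<bar> \<le> K + L" by linarith
  fix y assume y: "y \<in> X"
  have "\<bar>f x - f y\<bar> \<le> K * dist x y powr \<gamma>" "\<bar>g x - g y\<bar> \<le> L * dist x y powr \<gamma>"
    using assms x y by (auto simp: hoelder_on_def)
  thus "\<bar>f x + g x - (f y + g y)\<bar> \<le> (K + L) * dist x y powr \<gamma>"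
    by (simp add: distrib_right)
qed

lemma hoelder_on_bump:
  fixes T :: "'a::metric_space set" and k c :: real
  assumes k: "1 \<le> k"
  shows "hoelder_on X 1 (\<bar>c\<bar> * k) (\<lambda>x. c * max 0 (1 - k * infdist x T))"
  unfolding hoelder_on_def
proof (intro conjI ballI)
  let ?u = "\<lambda>x. max 0 (1 - k * infdist x T)"
  fix x :: 'a
  have "0 \<le> k * infdist x T" using k infdist_nonneg[of x T] by simp
  hence "\<bar>?u x\<bar> \<le> 1" by simp
  hence "\<bar>?u x\<bar> \<le> k" using k by linarith
  thus "\<bar>c * ?u x\<bar> \<le> \<bar>c\<bar> * k" unfolding abs_mult by (intro mult_left_mono) auto
  fix y :: 'a
  have *: "\<bar>max 0 (1 - a) - max 0 (1 - b)\<bar> \<le> \<bar>a - b\<bar>" for a b :: real by (simp add: max_def abs_if)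
  have "\<bar>?u x - ?u y\<bar> \<le> \<bar>k * infdist x T - k * infdist y T\<bar>" by (rule *)
  also have "\<dots> = k * \<bar>infdist x T - infdist y T\<bar>" using k by (simp add: abs_mult flip: right_diff_distrib)
  also have "\<dots> \<le> k * dist x y" using k by (intro mult_left_mono infdist_triangle_abs) auto
  finally have "\<bar>c\<bar> * \<bar>?u x - ?u y\<bar> \<le> \<bar>c\<bar> * (k * dist x y)" by (intro mult_left_mono) auto
  thus "\<bar>c * ?u x - c * ?u y\<bar> \<le> \<bar>c\<bar> * k * dist x y powr 1"
    by (simp add: abs_mult mult.assoc flip: right_diff_distrib)
qed

text \<open>Tent functions of the distance to \<open>T\<close> with slope tending to infinity
  converge pointwise to the indicator because \<open>T\<close> is closed; dominated convergence does
  the rest.\<close>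

lemma lipschitz_approx_closed:
  fixes X :: "'a::euclidean_space set"
  assumes X: "X \<in> sets lebesgue" and fm: "finite_measure (lebesgue_on X)" and T: "closed T" and e: "e > 0"
  shows "\<exists>u K. hoelder_on X 1 K u \<and> (LINT x|lebesgue_on X. \<bar>c * indicator T x - u x\<bar>) < e"
\<comment> \<open>\<open>infdist\<close> to the empty set is 0, so the tents would be constantly 1
  in this case.\<close>
proof (cases "T = {}")
  case True
  have "hoelder_on X 1 0 (\<lambda>_. 0)" by (simp add: hoelder_on_def)
  thus ?thesis using True e by (intro exI[of _ "\<lambda>_. 0"] exI[of _ 0]) simp
next
  case False
  let ?M = "lebesgue_on X"
  define u where "u k x = c * max 0 (1 - real (Suc k) * infdist x T)" for k x
  have h: "hoelder_on X 1 (\<bar>c\<bar> * real (Suc k)) (u k)" for k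
    unfolding u_def by (rule hoelder_on_bump) simp
  have um: "u k \<in> borel_measurable ?M" for k
    using hoelder_on_imp_continuous_on[OF h] X by (intro continuous_imp_measurable_on_sets_lebesgue) auto
  have Tm: "T \<in> sets lebesgue" using T by (simp add: borel_closed)
  have im: "(\<lambda>x. c * indicator T x) \<in> borel_measurable ?M"
    using Tm by (intro borel_measurable_times borel_measurable_const measurable_restrict_space1 borel_measurable_indicator)
  have conv: "(\<lambda>k. u k x) \<longlonglongrightarrow> c * indicator T x" for x
  proof (cases "x \<in> T")
    case True
    thus ?thesis by (simp add: u_def)
  next
    case xT: False
    have pos: "infdist x T > 0"
      using xT False T by (metis in_closed_iff_infdist_zero infdist_nonneg less_le)
    obtain N where N: "1 / infdist x T < real N" using reals_Archimedean2 by blast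
    have "u k x = 0" if "k \<ge> N" for k
    proof -
      have "1 / infdist x T \<le> real (Suc k)" using N that by linarith
      hence "1 \<le> real (Suc k) * infdist x T" using pos by (simp add: field_simps)
      thus ?thesis by (simp add: u_def max_def)
    qed
    thus ?thesis using xT by (intro tendsto_eventually) (auto simp: eventually_sequentially)
  qed
  have ub: "\<bar>u k x\<bar> \<le> \<bar>c\<bar>" for k x
  proof -
    have "0 \<le> real (Suc k) * infdist x T" by (intro mult_nonneg_nonneg infdist_nonneg) simp
    hence "\<bar>max 0 (1 - real (Suc k) * infdist x T)\<bar> \<le> 1" by simp
    thus ?thesis unfolding u_def abs_mult by (rule mult_left_le) simp
  qed
  have "(\<lambda>k. LINT x|?M. \<bar>c * indicator T x - u k x\<bar>) \<longlonglongrightarrow> (LINT x|?M. (0::real))"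
  proof (rule integral_dominated_convergence[where w = "\<lambda>_. 2 * \<bar>c\<bar>"])
    show "integrable ?M (\<lambda>_. 2 * \<bar>c\<bar>)" using finite_measure.integrable_const[OF fm] .
    show "AE x in ?M. (\<lambda>k. \<bar>c * indicator T x - u k x\<bar>) \<longlonglongrightarrow> 0"
    proof (rule AE_I2)
      fix x
      have "(\<lambda>k. \<bar>c * indicator T x - u k x\<bar>) \<longlonglongrightarrow> \<bar>c * indicator T x - c * indicator T x\<bar>"
        by (intro tendsto_intros conv)
      thus "(\<lambda>k. \<bar>c * indicator T x - u k x\<bar>) \<longlonglongrightarrow> 0" by simp
    qed
    show "AE x in ?M. norm \<bar>c * indicator T x - u k x\<bar> \<le> 2 * \<bar>c\<bar>" for k
    proof (rule AE_I2)
      fix x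
      have "\<bar>c * indicator T x\<bar> \<le> \<bar>c\<bar>" by (simp add: indicator_def)
      thus "norm \<bar>c * indicator T x - u k x\<bar> \<le> 2 * \<bar>c\<bar>" using ub[of k x] by simp
    qed
  qed (use im um in measurable)
  hence "(\<lambda>k. LINT x|?M. \<bar>c * indicator T x - u k x\<bar>) \<longlonglongrightarrow> 0" by simp
  from order_tendstoD(2)[OF this e] obtain k where "(LINT x|?M. \<bar>c * indicator T x - u k x\<bar>) < e"
    by (auto simp: eventually_sequentially)
  with h[of k] show ?thesis by blast
qed

lemma integral_abs_diff_triangle:
  assumes "integrable M f" "integrable M g" "integrable M (h :: 'a \<Rightarrow> real)"
  shows "(LINT x|M. \<bar>f x - h x\<bar>) \<le> (LINT x|M. \<bar>f x - g x\<bar>) + (LINT x|M. \<bar>g x - h x\<bar>)"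
proof -
  have "(LINT x|M. \<bar>f x - h x\<bar>) \<le> (LINT x|M. \<bar>f x - g x\<bar> + \<bar>g x - h x\<bar>)"
    using assms by (intro Bochner_Integration.integral_mono) auto
  also have "\<dots> = (LINT x|M. \<bar>f x - g x\<bar>) + (LINT x|M. \<bar>g x - h x\<bar>)"
    using assms by (intro Bochner_Integration.integral_add) auto
  finally show ?thesis .
qed

text \<open>Indicators are approximated by those of closed subsets through inner regularity;
  linearity and dominated convergence extend this to all integrable functions.\<close>

theorem lipschitz_dense_L1:
  fixes X :: "'a::euclidean_space set" and f :: "'a \<Rightarrow> real"
  assumes X: "compact X" and f: "integrable (lebesgue_on X) f" and e: "e > 0"
  shows "\<exists>u K. hoelder_on X 1 K u \<and> (LINT x|lebesgue_on X. \<bar>f x - u x\<bar>) < e"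
proof -
  let ?M = "lebesgue_on X"
  have Xs: "X \<in> sets lebesgue" using X by (simp add: compact_imp_closed)
  have fm: "finite_measure ?M"
  proof
    have "emeasure lborel X < \<infinity>" using X by (rule emeasure_compact_finite)
    thus "emeasure ?M (space ?M) \<noteq> \<infinity>"
      using X Xs by (subst emeasure_restrict_space) (auto simp: space_restrict_space compact_imp_closed borel_closed)
  qed
  have hi: "integrable ?M u" if u: "hoelder_on X 1 K u" for u K
  proof -
    have "continuous_on X u" by (rule hoelder_on_imp_continuous_on[OF u]) simp
    hence "u \<in> borel_measurable ?M" using Xs by (rule continuous_imp_measurable_on_sets_lebesgue)
    thus ?thesis using u
      by (intro finite_measure.integrable_const_bound[OF fm, of _ K]) (auto simp: hoelder_on_def space_restrict_space)
  qed
  show ?thesis using f e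
  proof (induction arbitrary: e rule: integrable_induct)
    case (base A c)
    have A: "A \<in> sets lebesgue" using base Xs by (auto simp: sets_restrict_space)
    have AX: "A \<subseteq> X" using base by (auto simp: sets_restrict_space)
    \<comment> \<open>Half of the allowance goes to the inner approximation, half to the tent;
      adding 1 covers \<open>c = 0\<close>.\<close>
    define e' where "e' = e / (2 * (\<bar>c\<bar> + 1))"
    have e': "e' > 0" using base by (simp add: e'_def)
    obtain T where T: "closed T" "T \<subseteq> A" "A - T \<in> lmeasurable" "emeasure lebesgue (A - T) < ennreal e'"
      using sets_lebesgue_inner_closed[OF A e'] by blast
    obtain u K where u: "hoelder_on X 1 K u" "(LINT x|?M. \<bar>c * indicator T x - u x\<bar>) < e / 2"
      using lipschitz_approx_closed[OF Xs fm T(1) half_gt_zero[OF base(3)], of c] by blast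
    have Tl: "T \<in> sets lebesgue" using T by (simp add: borel_closed)
    have ind: "integrable ?M (\<lambda>x. c * indicator B x)" if "B \<in> sets lebesgue" for B
      using that by (intro finite_measure.integrable_const_bound[OF fm, of _ "\<bar>c\<bar>"])
        (auto simp: indicator_def intro!: borel_measurable_times borel_measurable_const measurable_restrict_space1 borel_measurable_indicator)
    have mT: "measure ?M (A - T) < e'"
    proof -
      have "measure ?M (A - T) = measure lebesgue (A - T)"
        using AX Xs by (intro measure_restrict_space) auto
      thus ?thesis using T(3,4) e' by (metis emeasure_eq_measure2 ennreal_less_iff fmeasurableD2 measure_nonneg emeasure_eq_ennreal_measure)
    qed
    have "(LINT x|?M. \<bar>c * indicator A x - c * indicator T x\<bar>) = (LINT x|?M. \<bar>c\<bar> * indicator (A - T) x)"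
      using T(2) by (intro Bochner_Integration.integral_cong) (auto simp: indicator_def)
    also have "\<dots> = \<bar>c\<bar> * measure ?M (A - T)"
      using AX by (simp add: space_restrict_space Int_absorb2 Diff_subset[THEN order_trans])
    also have "\<dots> \<le> \<bar>c\<bar> * e'" using mT by (intro mult_left_mono) auto
    also have "\<dots> \<le> (\<bar>c\<bar> + 1) * e'" using e' by (intro mult_right_mono) auto
    also have "\<dots> = e / 2"
    proof -
      have "b * (e / (2 * b)) = e / 2" if "b > 0" for b :: real using that by simp
      from this[of "\<bar>c\<bar> + 1"] show ?thesis unfolding e'_def by simp
    qed
    finally have "(LINT x|?M. \<bar>c * indicator A x - c * indicator T x\<bar>) \<le> e / 2" .
    moreover have "(LINT x|?M. \<bar>c * indicator A x - u x\<bar>) \<le>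
        (LINT x|?M. \<bar>c * indicator A x - c * indicator T x\<bar>) + (LINT x|?M. \<bar>c * indicator T x - u x\<bar>)"
      by (rule integral_abs_diff_triangle[OF ind[OF A] ind[OF Tl] hi[OF u(1)]])
    ultimately have "(LINT x|?M. \<bar>c * indicator A x - u x\<bar>) < e" using u(2) by linarith
    thus ?case using u(1) by (auto simp: mult.commute)
  next
    case (add f g)
    obtain u K where u: "hoelder_on X 1 K u" "(LINT x|?M. \<bar>f x - u x\<bar>) < e / 2"
      using add.IH(1)[of "e / 2"] add.prems by auto
    obtain v L where v: "hoelder_on X 1 L v" "(LINT x|?M. \<bar>g x - v x\<bar>) < e / 2"
      using add.IH(2)[of "e / 2"] add.prems by auto
    have i: "integrable ?M f" "integrable ?M g" "integrable ?M u" "integrable ?M v"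
      using add.hyps hi u v by auto
    have "(LINT x|?M. \<bar>f x + g x - (u x + v x)\<bar>) \<le> (LINT x|?M. \<bar>f x - u x\<bar> + \<bar>g x - v x\<bar>)"
      using i by (intro Bochner_Integration.integral_mono) auto
    also have "\<dots> = (LINT x|?M. \<bar>f x - u x\<bar>) + (LINT x|?M. \<bar>g x - v x\<bar>)"
      using i by (intro Bochner_Integration.integral_add) auto
    finally have "(LINT x|?M. \<bar>f x + g x - (u x + v x)\<bar>) < e" using u v by linarith
    thus ?case using hoelder_on_add[OF u(1) v(1)] by blast
  next
    case (lim f s)
    have "(\<lambda>i. LINT x|?M. \<bar>f x - s i x\<bar>) \<longlonglongrightarrow> (LINT x|?M. (0::real))"
    proof (rule integral_dominated_convergence[where w = "\<lambda>x. 3 * \<bar>f x\<bar>"])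
      show "integrable ?M (\<lambda>x. 3 * \<bar>f x\<bar>)" using lim.hyps by auto
      show "AE x in ?M. (\<lambda>i. \<bar>f x - s i x\<bar>) \<longlonglongrightarrow> 0"
      proof (rule AE_I2)
        fix x assume "x \<in> space ?M"
        hence "(\<lambda>i. \<bar>f x - s i x\<bar>) \<longlonglongrightarrow> \<bar>f x - f x\<bar>" using lim.hyps by (intro tendsto_intros) auto
        thus "(\<lambda>i. \<bar>f x - s i x\<bar>) \<longlonglongrightarrow> 0" by simp
      qed
      show "AE x in ?M. norm \<bar>f x - s i x\<bar> \<le> 3 * \<bar>f x\<bar>" for i
      proof (rule AE_I2)
        fix x assume "x \<in> space ?M"
        hence "norm (s i x) \<le> 2 * norm (f x)" using lim.hyps by auto
        thus "norm \<bar>f x - s i x\<bar> \<le> 3 * \<bar>f x\<bar>" by simp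
      qed
    qed (use lim.hyps in \<open>auto dest: borel_measurable_integrable\<close>)
    hence "(\<lambda>i. LINT x|?M. \<bar>f x - s i x\<bar>) \<longlonglongrightarrow> 0" by simp
    from order_tendstoD(2)[OF this, of "e / 2"] lim.prems
    obtain i where i: "(LINT x|?M. \<bar>f x - s i x\<bar>) < e / 2" by (auto simp: eventually_sequentially)
    obtain u K where u: "hoelder_on X 1 K u" "(LINT x|?M. \<bar>s i x - u x\<bar>) < e / 2"
      using lim.IH[of "e / 2" i] lim.prems by auto
    have "(LINT x|?M. \<bar>f x - u x\<bar>) < e"
      using integral_abs_diff_triangle[of ?M f "s i" u] lim.hyps hi[OF u(1)] i u(2) by fastforce
    thus ?case using u(1) by blast
  qed
qed

section \<open>Change of variables for an arbitrary finite index type\<close>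

text \<open>The change of variables formula of the library requires a well-ordered index type; it is
  transferred to an arbitrary finite index type along an enumeration.\<close>

typedef (overloaded) ('n::finite) idx = "{..<CARD('n)}"
  by (rule exI[of _ 0]) simp

instantiation idx :: (finite) linorder
begin
definition less_eq_idx :: "'a idx \<Rightarrow> 'a idx \<Rightarrow> bool" where "x \<le> y \<longleftrightarrow> Rep_idx x \<le> Rep_idx y"
definition less_idx :: "'a idx \<Rightarrow> 'a idx \<Rightarrow> bool" where "x < y \<longleftrightarrow> Rep_idx x < Rep_idx y"
instance
proof
  fix x y z :: "'a idx"
  show "x < y \<longleftrightarrow> x \<le> y \<and> \<not> y \<le> x" unfolding less_eq_idx_def less_idx_def by linarith
  show "x \<le> x" unfolding less_eq_idx_def by simp
  show "x \<le> z" if "x \<le> y" "y \<le> z" using that unfolding less_eq_idx_def by linarith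
  show "x = y" if "x \<le> y" "y \<le> x"
    using that Rep_idx_inject[of x y] unfolding less_eq_idx_def by linarith
  show "x \<le> y \<or> y \<le> x" unfolding less_eq_idx_def by (rule linear)
qed
end

instance idx :: (finite) wellorder
proof
  fix P :: "'a idx \<Rightarrow> bool" and a
  assume *: "\<And>x. (\<And>y. y < x \<Longrightarrow> P y) \<Longrightarrow> P x"
  show "P a"
  proof (induction a rule: measure_induct_rule[where f = Rep_idx])
    case (less x)
    show ?case by (rule *, rule less) (simp add: less_idx_def)
  qed
qed

instance idx :: (finite) finite
proof
  have "(UNIV :: 'a idx set) = Abs_idx ` {..<CARD('a)}"
    using type_definition.Abs_image[OF type_definition_idx[where 'n = 'a]] by simp
  thus "finite (UNIV :: 'a idx set)" by (metis finite_imageI finite_lessThan)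
qed

lemma card_idx: "CARD('n::finite idx) = CARD('n)"
  using type_definition.card[OF type_definition_idx[where 'n = 'n]] by simp

definition reidx :: "('m \<Rightarrow> 'n) \<Rightarrow> real ^ 'n \<Rightarrow> real ^ 'm" where
  "reidx p x = (\<chi> k. x $ p k)"

lemma reidx_nth [simp]: "reidx p x $ k = x $ p k"
  by (simp add: reidx_def)

lemma linear_reidx: "linear (reidx p)"
  by (rule linearI) (auto simp: vec_eq_iff)

context
  fixes p :: "'m::finite \<Rightarrow> 'n::finite"
  assumes p: "bij p"
begin

lemma reidx_inv [simp]: "reidx (inv p) (reidx p x) = x" "reidx p (reidx (inv p) y) = y"
  using p by (auto simp: vec_eq_iff bij_inv_eq_iff bij_is_surj surj_f_inv_f bij_is_inj inv_f_f)

lemma reidx_cbox: "reidx p ` cbox a b = cbox (reidx p a) (reidx p b)"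
proof
  show "reidx p ` cbox a b \<subseteq> cbox (reidx p a) (reidx p b)"
    by (auto simp: mem_box_cart)
  show "cbox (reidx p a) (reidx p b) \<subseteq> reidx p ` cbox a b"
  proof
    fix y assume y: "y \<in> cbox (reidx p a) (reidx p b)"
    have "reidx (inv p) y \<in> cbox a b"
      using y p unfolding mem_box_cart reidx_nth by (metis bij_inv_eq_iff)
    thus "y \<in> reidx p ` cbox a b" by (metis reidx_inv(2) image_eqI)
  qed
qed

lemma content_reidx: "measure lborel (reidx p ` cbox a b) = measure lborel (cbox a b)"
proof (cases "cbox a b = {}")
  case False
  hence "cbox (reidx p a) (reidx p b) \<noteq> {}" using reidx_cbox[of a b] by blast
  moreover have "(\<Prod>k\<in>UNIV. b $ p k - a $ p k) = (\<Prod>i\<in>UNIV. b $ i - a $ i)"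
    by (rule prod.reindex_bij_betw[OF p, of "\<lambda>i. b $ i - a $ i"])
  ultimately show ?thesis using False by (simp add: reidx_cbox content_cbox_cart)
qed simp

end

text \<open>Relabelling coordinates maps boxes to boxes of the same content. Boundedness of
  \<open>A\<close> lets the integrand be extended by zero to one box.\<close>

lemma has_integral_reidx:
  fixes p :: "'m::finite \<Rightarrow> 'n::finite" and f :: "real ^ 'n \<Rightarrow> real"
  assumes p: "bij p" and A: "bounded A" and f: "(f has_integral i) A"
  shows "((\<lambda>y. f (reidx (inv p) y)) has_integral i) (reidx p ` A)"
proof -
  obtain c where c: "A \<subseteq> cbox (-c) c" using bounded_subset_cbox_symmetric[OF A] by blast
  have ip: "bij (inv p)" using p by (rule bij_imp_bij_inv)
  have iip: "inv (inv p) = p" using p by (rule inv_inv_eq)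
  have "((\<lambda>x. if x \<in> A then f x else 0) has_integral i) (cbox (-c) c)"
    using f has_integral_restrict[OF c] by blast
  note A_int = this
  have "((\<lambda>y. if reidx (inv p) y \<in> A then f (reidx (inv p) y) else 0) has_integral (1 / 1) *\<^sub>R i) (reidx p ` cbox (-c) c)"
  proof (rule has_integral_twiddle[where g = "reidx (inv p)" and h = "reidx p", OF _ _ _ _ _ _ _ A_int])
    show "reidx p (reidx (inv p) y) = y" "reidx (inv p) (reidx p x) = x" for x y using p by simp_all
    show "continuous (at y) (reidx (inv p))" for y
      using linear_reidx by (rule linear_continuous_at[OF linear_conv_bounded_linear[THEN iffD1]])
    show "\<exists>w z. reidx (inv p) ` cbox u v = cbox w z" for u v using reidx_cbox[OF ip] by blast
    show "\<exists>w z. reidx p ` cbox u v = cbox w z" for u v using reidx_cbox[OF p] by blast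
    show "measure lborel (reidx (inv p) ` cbox u v) = 1 * measure lborel (cbox u v)" for u v
      using content_reidx[OF ip] by simp
  qed simp
  moreover have "reidx (inv p) y \<in> A \<longleftrightarrow> y \<in> reidx p ` A" for y
  proof
    show "y \<in> reidx p ` A" if "reidx (inv p) y \<in> A"
      using imageI[OF that, of "reidx p"] by (simp only: reidx_inv(2)[OF p])
    show "reidx (inv p) y \<in> A" if "y \<in> reidx p ` A"
      using that by (auto simp only: reidx_inv(1)[OF p])
  qed
  ultimately show ?thesis using has_integral_restrict[of "reidx p ` A" "reidx p ` cbox (-c) c"] c
    by (simp add: image_mono)
qed

lemma absolutely_integrable_reidx:
  fixes p :: "'m::finite \<Rightarrow> 'n::finite" and f :: "real ^ 'n \<Rightarrow> real"
  assumes p: "bij p" and A: "bounded A" and f: "f absolutely_integrable_on A"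
  shows "(\<lambda>y. f (reidx (inv p) y)) absolutely_integrable_on (reidx p ` A)"
    and "integral (reidx p ` A) (\<lambda>y. f (reidx (inv p) y)) = integral A f"
proof -
  have 1: "(f has_integral integral A f) A" and 2: "((\<lambda>x. norm (f x)) has_integral integral A (\<lambda>x. norm (f x))) A"
    using f unfolding absolutely_integrable_on_def by auto
  note r = has_integral_reidx[OF p A 1] has_integral_reidx[OF p A 2]
  show "(\<lambda>y. f (reidx (inv p) y)) absolutely_integrable_on (reidx p ` A)"
    using r unfolding absolutely_integrable_on_def by blast
  show "integral (reidx p ` A) (\<lambda>y. f (reidx (inv p) y)) = integral A f"
    using r(1) by (rule integral_unique)
qed

definition enum_idx :: "'n::finite idx \<Rightarrow> 'n" where
  "enum_idx = (SOME p. bij p)"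

lemma bij_enum_idx: "bij (enum_idx :: 'n::finite idx \<Rightarrow> 'n)"
proof -
  have "\<exists>p :: 'n idx \<Rightarrow> 'n. bij_betw p UNIV UNIV"
    by (rule finite_same_card_bij) (auto simp: card_idx)
  thus ?thesis unfolding enum_idx_def by (rule someI_ex)
qed

text \<open>The modulus of the determinant of \<open>L\<close>, written in enumerated coordinates
  because the change of variables takes place there.\<close>

definition jac :: "(real ^ 'n \<Rightarrow> real ^ 'n) \<Rightarrow> real" where
  "jac L = \<bar>det (matrix (\<lambda>y. reidx enum_idx (L (reidx (inv enum_idx) y))) :: real ^ 'n idx ^ 'n idx)\<bar>"

theorem absolutely_integrable_change_of_variables:
  fixes g :: "real ^ 'n::finite \<Rightarrow> real ^ 'n" and f :: "real ^ 'n \<Rightarrow> real"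
  assumes S: "compact S" and g: "\<And>x. x \<in> S \<Longrightarrow> (g has_derivative g' x) (at x within S)"
    and inj: "inj_on g S" and f: "f absolutely_integrable_on (g ` S)"
  shows "(\<lambda>x. jac (g' x) * f (g x)) absolutely_integrable_on S"
    and "integral S (\<lambda>x. jac (g' x) * f (g x)) = integral (g ` S) f"
proof -
  define p where "p = (enum_idx :: 'n idx \<Rightarrow> 'n)"
  have p: "bij p" unfolding p_def by (rule bij_enum_idx)
  have ip: "bij (inv p)" using p by (rule bij_imp_bij_inv)
  have iip: "inv (inv p) = p" using p by (rule inv_inv_eq)
  let ?R = "reidx p" and ?Q = "reidx (inv p)"
  have RQ [simp]: "?R (?Q y) = y" "?Q (?R x) = x" for x y using p by simp_all
  have contg: "continuous_on S g" using g by (meson has_derivative_continuous_on)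
  have bS: "bounded S" and bg: "bounded (g ` S)"
    using S compact_continuous_image[OF contg S] by (auto simp: compact_imp_bounded)
  have linQ: "bounded_linear ?Q" and linR: "bounded_linear ?R"
    using linear_reidx linear_conv_bounded_linear by blast+
  let ?S = "?R ` S" and ?g = "\<lambda>y. ?R (g (?Q y))" and ?g' = "\<lambda>y z. ?R (g' (?Q y) (?Q z))"
  have im: "?g ` ?S = ?R ` (g ` S)" by (force simp: image_iff)
  have der: "(?g has_derivative ?g' y) (at y within ?S)" if "y \<in> ?S" for y
  proof -
    have y: "?Q y \<in> S" using that by auto
    have QS: "?Q ` ?S = S" by (force simp: image_iff)
    have "(g has_derivative g' (?Q y)) (at (?Q y) within ?Q ` ?S)" using g[OF y] QS by simp
    from has_derivative_in_compose[OF bounded_linear_imp_has_derivative[OF linQ] this]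
    have "((\<lambda>y. g (?Q y)) has_derivative (\<lambda>z. g' (?Q y) (?Q z))) (at y within ?S)" .
    from bounded_linear.has_derivative[OF linR this] show ?thesis .
  qed
  have "inj_on ?g ?S"
  proof (rule inj_onI)
    fix y y' assume "y \<in> ?S" "y' \<in> ?S" "?g y = ?g y'"
    hence "g (?Q y) = g (?Q y')" "?Q y \<in> S" "?Q y' \<in> S" using RQ by (metis, auto)
    hence "?Q y = ?Q y'" using inj by (simp add: inj_on_eq_iff)
    thus "y = y'" using RQ by metis
  qed
  moreover have "?S \<in> sets lebesgue"
    using S compact_continuous_image[OF linear_continuous_on[OF linR] S] by (simp add: compact_imp_closed)
  \<comment> \<open>The formula is for vector-valued integrands, so real values are wrapped into
    \<open>real ^ 1\<close>.\<close>
  ultimately have cov: "(\<lambda>y. \<bar>det (matrix (?g' y))\<bar> *\<^sub>R (vec (f (?Q (?g y))) :: real ^ 1)) absolutely_integrable_on ?S \<and>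
      integral ?S (\<lambda>y. \<bar>det (matrix (?g' y))\<bar> *\<^sub>R (vec (f (?Q (?g y))) :: real ^ 1)) = b \<longleftrightarrow>
      (\<lambda>y. vec (f (?Q y)) :: real ^ 1) absolutely_integrable_on (?g ` ?S) \<and>
      integral (?g ` ?S) (\<lambda>y. vec (f (?Q y)) :: real ^ 1) = b" for b
    by (intro has_absolute_integral_change_of_variables[where g = ?g and g' = ?g' and S = ?S and
          f = "\<lambda>y. vec (f (?Q y)) :: real ^ 1"] der)
  have f1: "(\<lambda>y. f (?Q y)) absolutely_integrable_on (?g ` ?S)" "integral (?g ` ?S) (\<lambda>y. f (?Q y)) = integral (g ` S) f"
    using absolutely_integrable_reidx[OF p bg f] im by simp_all
  have vec_eq: "\<bar>det (matrix (?g' y))\<bar> *\<^sub>R (vec (f (?Q (?g y))) :: real ^ 1) = vec (jac (g' (?Q y)) * f (g (?Q y)))" for y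
    by (simp add: jac_def p_def[symmetric] vec_eq_iff)
  have "(\<lambda>y. vec (f (?Q y)) :: real ^ 1) absolutely_integrable_on (?g ` ?S) \<and>
     integral (?g ` ?S) (\<lambda>y. vec (f (?Q y)) :: real ^ 1) = vec (integral (g ` S) f)"
    using f1 by (simp add: absolutely_integrable_on_1_iff integral_on_1_eq vec_eq_iff)
  hence "(\<lambda>y. vec (jac (g' (?Q y)) * f (g (?Q y))) :: real ^ 1) absolutely_integrable_on ?S \<and>
     integral ?S (\<lambda>y. vec (jac (g' (?Q y)) * f (g (?Q y))) :: real ^ 1) = vec (integral (g ` S) f)"
    using cov unfolding vec_eq by blast
  hence 2: "(\<lambda>y. jac (g' (?Q y)) * f (g (?Q y))) absolutely_integrable_on ?S"
     "integral ?S (\<lambda>y. jac (g' (?Q y)) * f (g (?Q y))) = integral (g ` S) f"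
    by (simp_all add: absolutely_integrable_on_1_iff integral_on_1_eq vec_eq_iff)
  have bRS: "bounded ?S" using bS linR by (rule bounded_linear_image)
  have QRS: "?Q ` ?S = S" by (force simp: image_iff)
  from absolutely_integrable_reidx[OF ip bRS 2(1), unfolded iip QRS] 2(2)
  show "(\<lambda>x. jac (g' x) * f (g x)) absolutely_integrable_on S"
    and "integral S (\<lambda>x. jac (g' x) * f (g x)) = integral (g ` S) f"
    by simp_all
qed

section \<open>Expansion of the coupled map\<close>

text \<open>Pythagoras: a constant part and a fluctuation of sum zero are orthogonal.\<close>

lemma sum_norm_power2_mean:
  fixes u :: "'i::finite \<Rightarrow> 'a::real_inner"
  assumes "(\<Sum>i\<in>UNIV. u i) = 0"
  shows "(\<Sum>i\<in>UNIV. (norm (m + u i))\<^sup>2) = real CARD('i) * (norm m)\<^sup>2 + (\<Sum>i\<in>UNIV. (norm (u i))\<^sup>2)"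
proof -
  have "(\<Sum>i\<in>UNIV. (norm (m + u i))\<^sup>2) = (\<Sum>i\<in>UNIV. (norm m)\<^sup>2 + 2 * (m \<bullet> u i) + (norm (u i))\<^sup>2)"
    by (simp add: power2_norm_eq_inner inner_add_left inner_add_right inner_commute algebra_simps)
  also have "\<dots> = real CARD('i) * (norm m)\<^sup>2 + 2 * (m \<bullet> (\<Sum>i\<in>UNIV. u i)) + (\<Sum>i\<in>UNIV. (norm (u i))\<^sup>2)"
    by (simp add: sum.distrib inner_sum_right sum_distrib_left)
  finally show ?thesis using assms by simp
qed

text \<open>Young's inequality with weight \<open>c = L - 1\<close>, read off from the square of
  \<open>c *\<^sub>R a + b\<close>. The factor \<open>L\<close> in front of \<open>a\<close> is the
  one allowed for the fluctuations.\<close>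

lemma norm_diff_power2_le:
  fixes a b :: "'a::real_inner" and L :: real
  assumes "L > 1"
  shows "(norm (a - b))\<^sup>2 \<le> L * (norm a)\<^sup>2 + L / (L - 1) * (norm b)\<^sup>2"
proof -
  define c where "c = L - 1"
  have c: "c > 0" "L = 1 + c" using assms by (simp_all add: c_def)
  have "0 \<le> (norm (c *\<^sub>R a + b))\<^sup>2 / c" using c by simp
  also have "(norm (c *\<^sub>R a + b))\<^sup>2 = c\<^sup>2 * (a \<bullet> a) + 2 * c * (a \<bullet> b) + b \<bullet> b"
    unfolding power2_norm_eq_inner
    by (simp add: inner_add_left inner_add_right inner_commute power2_eq_square algebra_simps del: dot_square_norm)
  also have "\<dots> / c = c * (a \<bullet> a) + 2 * (a \<bullet> b) + (b \<bullet> b) / c"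
    using c by (simp add: add_divide_distrib power2_eq_square)
  finally have "0 \<le> c * (a \<bullet> a) + 2 * (a \<bullet> b) + (b \<bullet> b) / c" .
  moreover have "L / (L - 1) * (b \<bullet> b) = b \<bullet> b + (b \<bullet> b) / c"
    using c by (simp add: field_simps)
  moreover have "(a - b) \<bullet> (a - b) = a \<bullet> a - 2 * (a \<bullet> b) + b \<bullet> b"
    by (simp add: inner_diff_left inner_diff_right inner_commute)
  ultimately show ?thesis unfolding power2_norm_eq_inner c(2) by (simp add: distrib_right)
qed

text \<open>After splitting \<open>v\<close> and \<open>v + w m\<close> into mean and fluctuation, the claim becomes
  \<open>0 \<le> (L - 1 - L W)\<^sup>2 / (L - 1)\<close> with \<open>W\<close> the mean of \<open>w\<close>.\<close>

lemma mean_field_expansion: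
  fixes v :: "'i::finite \<Rightarrow> 'a::real_inner" and w :: "'i \<Rightarrow> real" and L s :: real
  assumes L: "L > 1" and s: "s \<le> 4 * (L - 1)" and w: "\<And>i. 0 \<le> w i \<and> w i \<le> s"
    and m: "(\<Sum>i\<in>UNIV. v i) = real CARD('i) *\<^sub>R m"
  shows "(\<Sum>i\<in>UNIV. (norm (v i))\<^sup>2) \<le> L * (\<Sum>i\<in>UNIV. (norm (v i + w i *\<^sub>R m))\<^sup>2)"
proof -
  let ?N = "real CARD('i)"
  have N: "?N > 0" by simp
  define W where "W = (\<Sum>i\<in>UNIV. w i) / ?N"
  have W: "(\<Sum>i\<in>UNIV. w i) = ?N * W" by (simp add: W_def)
  have W0: "0 \<le> W" unfolding W_def using w by (intro divide_nonneg_nonneg sum_nonneg) auto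
  \<comment> \<open>The fluctuation of \<open>v + w m\<close>, whose mean is
    \<open>(1 + W) m\<close>.\<close>
  define \<zeta> where "\<zeta> i = (v i - m) + (w i - W) *\<^sub>R m" for i
  have s0: "(\<Sum>i\<in>UNIV. v i - m) = 0" by (simp add: sum_subtractf m sum_constant_scaleR)
  have sw: "(\<Sum>i\<in>UNIV. w i - W) = 0" using W by (simp add: sum_subtractf)
  have s1: "(\<Sum>i\<in>UNIV. \<zeta> i) = 0"
    unfolding \<zeta>_def using s0 sw by (simp add: sum.distrib flip: scaleR_left.sum)
  have 1: "(\<Sum>i\<in>UNIV. (norm (v i))\<^sup>2) = ?N * (norm m)\<^sup>2 + (\<Sum>i\<in>UNIV. (norm (v i - m))\<^sup>2)"
    using sum_norm_power2_mean[OF s0, of m] by simp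
  have z: "v i + w i *\<^sub>R m = (1 + W) *\<^sub>R m + \<zeta> i" for i by (simp add: \<zeta>_def algebra_simps)
  have 2: "(\<Sum>i\<in>UNIV. (norm (v i + w i *\<^sub>R m))\<^sup>2) = ?N * ((1 + W)\<^sup>2 * (norm m)\<^sup>2) + (\<Sum>i\<in>UNIV. (norm (\<zeta> i))\<^sup>2)"
    unfolding z using sum_norm_power2_mean[OF s1, of "(1 + W) *\<^sub>R m"] by (simp add: power_mult_distrib)
  have vm: "v i - m = \<zeta> i - (w i - W) *\<^sub>R m" for i by (simp add: \<zeta>_def)
  have 3: "(\<Sum>i\<in>UNIV. (norm (v i - m))\<^sup>2) \<le>
     (\<Sum>i\<in>UNIV. L * (norm (\<zeta> i))\<^sup>2 + L / (L - 1) * ((w i - W)\<^sup>2 * (norm m)\<^sup>2))"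
    unfolding vm by (intro sum_mono order_trans[OF norm_diff_power2_le[OF L]]) (simp add: power_mult_distrib)
  have "(\<Sum>i\<in>UNIV. (w i - W)\<^sup>2) = (\<Sum>i\<in>UNIV. (w i)\<^sup>2 - 2 * W * w i + W\<^sup>2)"
    by (intro sum.cong) (auto simp: power2_diff)
  also have "\<dots> = (\<Sum>i\<in>UNIV. (w i)\<^sup>2) - 2 * W * (?N * W) + ?N * W\<^sup>2"
    by (simp add: sum.distrib sum_subtractf W flip: sum_distrib_left)
  \<comment> \<open>Values in \<open>[0, s]\<close> with mean \<open>W\<close> have variance at most
    \<open>W * (s - W)\<close>.\<close>
  also have "(\<Sum>i\<in>UNIV. (w i)\<^sup>2) \<le> (\<Sum>i\<in>UNIV. s * w i)"
    using w by (intro sum_mono) (auto simp: power2_eq_square intro: mult_right_mono)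
  also have "\<dots> = s * (?N * W)" by (simp add: W flip: sum_distrib_left)
  finally have "(\<Sum>i\<in>UNIV. (w i - W)\<^sup>2) \<le> ?N * (s * W - W\<^sup>2)"
    by (simp add: power2_eq_square algebra_simps)
  also have "s * W \<le> 4 * (L - 1) * W" using s W0 by (rule mult_right_mono)
  finally have 4: "(\<Sum>i\<in>UNIV. (w i - W)\<^sup>2) \<le> ?N * (4 * (L - 1) * W - W\<^sup>2)" using N by simp
  have "0 \<le> (L - 1 - L * W)\<^sup>2 / (L - 1)" using L by simp
  also have "\<dots> = L * (1 + W)\<^sup>2 - 1 - L / (L - 1) * (4 * (L - 1) * W - W\<^sup>2)"
    using L by (simp add: field_simps power2_eq_square)
  finally have 5: "1 + L / (L - 1) * (4 * (L - 1) * W - W\<^sup>2) \<le> L * (1 + W)\<^sup>2" by simp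
  have "(\<Sum>i\<in>UNIV. (norm (v i))\<^sup>2) \<le> ?N * (norm m)\<^sup>2 + (L * (\<Sum>i\<in>UNIV. (norm (\<zeta> i))\<^sup>2) +
      L / (L - 1) * ((\<Sum>i\<in>UNIV. (w i - W)\<^sup>2) * (norm m)\<^sup>2))"
    using 1 3 by (simp add: sum.distrib sum_distrib_left sum_distrib_right)
  also have "\<dots> \<le> ?N * (norm m)\<^sup>2 + (L * (\<Sum>i\<in>UNIV. (norm (\<zeta> i))\<^sup>2) +
      L / (L - 1) * (?N * (4 * (L - 1) * W - W\<^sup>2) * (norm m)\<^sup>2))"
    using 4 L by (intro add_left_mono mult_left_mono mult_right_mono) auto
  also have "\<dots> = ?N * (norm m)\<^sup>2 * (1 + L / (L - 1) * (4 * (L - 1) * W - W\<^sup>2)) + L * (\<Sum>i\<in>UNIV. (norm (\<zeta> i))\<^sup>2)"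
    by (simp add: algebra_simps)
  also have "\<dots> \<le> ?N * (norm m)\<^sup>2 * (L * (1 + W)\<^sup>2) + L * (\<Sum>i\<in>UNIV. (norm (\<zeta> i))\<^sup>2)"
    by (intro add_right_mono mult_left_mono 5) auto
  also have "\<dots> = L * (\<Sum>i\<in>UNIV. (norm (v i + w i *\<^sub>R m))\<^sup>2)"
    unfolding 2 by (simp add: algebra_simps)
  finally show ?thesis .
qed

text \<open>
  The estimate behind the hypothesis on the derivative of \<open>G\<close>: it makes \<open>mean_field_expansion\<close>
  applicable with \<open>L = 5 K\<^sup>2 / 6\<close>, where \<open>K\<close> is the least slope of the Moebius map with parameter \<open>t\<close>.
\<close>

lemma coupling_bound:
  fixes t :: real
  assumes "0 \<le> t" "t \<le> 2 / 5"
  defines "K \<equiv> 2 * (2 - t) / (2 + t)"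
  shows "(25 - 50 * t) / (4 - t\<^sup>2) \<le> 4 * (K\<^sup>2 * (5 / 6) - 1)" "K\<^sup>2 * (5 / 6) > 1" "K > 0"
proof -
  have t: "2 - t > 0" "2 + t > 0" using assms by auto
  \<comment> \<open>The claim is cleared of denominators, leaving the cubic below. Its quadratic
    part is smallest at \<open>t = 101 / 276\<close>, and the cubic term is bounded by its value at
    \<open>2 / 5\<close>; what remains is positive.\<close>
  have "t ^ 3 \<le> (2 / 5) ^ 3" using assms by (intro power_mono) auto
  moreover have "0 \<le> 138 * (t - 101 / 276)\<^sup>2" by simp
  ultimately have "0 \<le> 74 / 3 - 101 * t + 138 * t\<^sup>2 - 28 / 3 * t ^ 3"
    by (simp add: power2_eq_square power3_eq_cube algebra_simps)
  moreover have "4 * (10 / 3 * (2 - t)\<^sup>2 - (2 + t)\<^sup>2) * (2 - t) - (25 - 50 * t) * (2 + t) =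
      74 / 3 - 101 * t + 138 * t\<^sup>2 - 28 / 3 * t ^ 3"
    by (simp add: power2_eq_square power3_eq_cube field_simps)
  ultimately have "(25 - 50 * t) * (2 + t) \<le> 4 * (10 / 3 * (2 - t)\<^sup>2 - (2 + t)\<^sup>2) * (2 - t)"
    by linarith
  hence "(25 - 50 * t) * (2 + t) / ((2 + t)\<^sup>2 * (2 - t)) \<le>
      4 * (10 / 3 * (2 - t)\<^sup>2 - (2 + t)\<^sup>2) * (2 - t) / ((2 + t)\<^sup>2 * (2 - t))"
    using t by (intro divide_right_mono) auto
  moreover have "(25 - 50 * t) * (2 + t) / ((2 + t)\<^sup>2 * (2 - t)) = (25 - 50 * t) / (4 - t\<^sup>2)"
  proof -
    have "4 - t\<^sup>2 = (2 + t) * (2 - t)" by (simp add: power2_eq_square algebra_simps)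
    thus ?thesis using t by (simp add: power2_eq_square)
  qed
  moreover have "4 * (10 / 3 * (2 - t)\<^sup>2 - (2 + t)\<^sup>2) * (2 - t) / ((2 + t)\<^sup>2 * (2 - t)) = 4 * (K\<^sup>2 * (5 / 6) - 1)"
  proof -
    have "4 * (10 / 3 * a\<^sup>2 - b\<^sup>2) * a / (b\<^sup>2 * a) = 4 * ((2 * a / b)\<^sup>2 * (5 / 6) - 1)"
      if "a > 0" "b > 0" for a b :: real
      using that by (simp add: power_divide power_mult_distrib divide_simps)
    from this[OF t] show ?thesis by (simp only: K_def)
  qed
  ultimately show "(25 - 50 * t) / (4 - t\<^sup>2) \<le> 4 * (K\<^sup>2 * (5 / 6) - 1)" by simp
  show "K > 0" using t by (simp add: K_def)
  have "4 / 3 \<le> K" using assms t by (simp add: K_def field_simps)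
  hence "(4 / 3)\<^sup>2 \<le> K\<^sup>2" by (intro power_mono) auto
  thus "K\<^sup>2 * (5 / 6) > 1" by (simp add: power2_eq_square)
qed

section \<open>The Moebius maps and the cube\<close>

definition mob_slope :: "'a::field \<Rightarrow> 'a \<Rightarrow> 'a" where
  "mob_slope r x = (4 - r\<^sup>2) / (2 * (1 + r * x)\<^sup>2)"

text \<open>The derivative of the Moebius map in its parameter \<open>r\<close>. It vanishes at both
  ends of the interval, whose images do not depend on \<open>r\<close>. As with
  \<open>mob_slope\<close>, one formula serves real and complex arguments.\<close>

definition mob_tilt :: "'a::field \<Rightarrow> 'a \<Rightarrow> 'a" where
  "mob_tilt r x = (1 - 4 * x\<^sup>2) / (2 * (1 + r * x)\<^sup>2)"

definition cmob :: "complex \<Rightarrow> complex \<Rightarrow> complex" where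
  "cmob r x = ((r + 4) * x + (r + 1)) / (2 * r * x + 2)"

definition mean :: "'a::real_field ^ 'n \<Rightarrow> 'a" where
  "mean z = (\<Sum>i\<in>UNIV. z $ i) / of_nat CARD('n)"

lemma mean_field_eq: "mean_field x = mean x"
  by (simp add: mean_field_def mean_def)

lemma bounded_linear_mean: "bounded_linear (mean :: 'a::{real_field,euclidean_space} ^ 'n \<Rightarrow> 'a)"
  unfolding linear_conv_bounded_linear[symmetric]
  by (rule linearI) (auto simp: mean_def divide_inverse sum.distrib distrib_right simp flip: scaleR_sum_right)

lemma mob_quotient_rule:
  fixes r x a b :: "'a::field_char_0"
  assumes "1 + r * x \<noteq> 0"
  shows "((a * x + (r + 4) * b + a) * (2 * (1 + r * x)) - ((r + 4) * x + (r + 1)) * (2 * (a * x + r * b))) /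
      ((2 * (1 + r * x)) * (2 * (1 + r * x))) = mob_slope r x * b + mob_tilt r x * a"
proof -
  define d where "d = 1 + r * x"
  have d: "d \<noteq> 0" using assms by (simp add: d_def)
  have "(a * x + (r + 4) * b + a) * (2 * d) - ((r + 4) * x + (r + 1)) * (2 * (a * x + r * b)) =
      2 * ((4 - r\<^sup>2) * b + (1 - 4 * x\<^sup>2) * a)"
    unfolding d_def by (simp add: power2_eq_square algebra_simps)
  moreover have "2 * ((4 - r\<^sup>2) * b + (1 - 4 * x\<^sup>2) * a) / ((2 * d) * (2 * d)) = mob_slope r x * b + mob_tilt r x * a"
    using d unfolding mob_slope_def mob_tilt_def d_def[symmetric] by (simp add: field_simps power2_eq_square)
  ultimately show ?thesis by (simp only: d_def)
qed

lemma mob_has_derivative: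
  fixes f g :: "'b::real_normed_vector \<Rightarrow> 'a::{real_normed_field,field_char_0}"
  assumes f: "(f has_derivative f') (at z within S)" and g: "(g has_derivative g') (at z within S)"
    and nz: "1 + f z * g z \<noteq> 0"
  shows "((\<lambda>z. ((f z + 4) * g z + (f z + 1)) / (2 * (1 + f z * g z))) has_derivative
    (\<lambda>v. mob_slope (f z) (g z) * g' v + mob_tilt (f z) (g z) * f' v)) (at z within S)"
proof -
  have n: "((\<lambda>z. (f z + 4) * g z + (f z + 1)) has_derivative (\<lambda>v. (f z + 4) * g' v + f' v * g z + f' v)) (at z within S)"
    by (auto intro!: derivative_eq_intros f g)
  have d: "((\<lambda>z. 2 * (1 + f z * g z)) has_derivative (\<lambda>v. 2 * (f z * g' v + f' v * g z))) (at z within S)"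
    by (auto intro!: derivative_eq_intros f g)
  have "2 * (1 + f z * g z) \<noteq> 0" using nz by (metis mult_eq_0_iff zero_neq_numeral)
  from has_derivative_divide'[OF n d this] show ?thesis
    unfolding mob_quotient_rule[OF nz, symmetric]
    by (rule has_derivative_eq_rhs) (simp add: fun_eq_iff mult_ac add_ac)
qed

lemma unit_int_iff: "x \<in> unit_int \<longleftrightarrow> \<bar>x\<bar> \<le> 1 / 2"
  by (auto simp: unit_int_def abs_le_iff)

lemma cubeD: "x \<in> cube \<Longrightarrow> \<bar>x $ i\<bar> \<le> 1 / 2"
  by (simp add: cube_def unit_int_iff)

lemma cube_cbox: "cube = cbox (\<chi> i. - 1 / 2) (\<chi> i. 1 / 2)"
  by (auto simp: cube_def mem_box_cart unit_int_def)

lemma compact_cube: "compact (cube :: (real ^ 'n) set)"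
  unfolding cube_cbox by (rule compact_cbox)

lemma convex_cube: "convex (cube :: (real ^ 'n) set)"
  unfolding cube_cbox by (rule convex_box)

lemma emeasure_cube: "emeasure lebesgue (cube :: (real ^ 'n) set) = 1"
proof -
  let ?B = "cbox (\<chi> i. - 1 / 2) (\<chi> i. 1 / 2) :: (real ^ 'n) set"
  have "0 \<in> ?B" by (auto simp: mem_box_cart)
  hence "measure lborel ?B = 1" by (subst content_cbox_cart) auto
  hence "emeasure lborel ?B = 1"
    using emeasure_eq_ennreal_measure[OF less_imp_neq[OF emeasure_lborel_cbox_finite[unfolded infinity_ennreal_def]]]
    by (metis ennreal_1)
  thus ?thesis unfolding cube_cbox by (subst emeasure_completion) simp_all
qed

lemma mean_cube: "(x :: real ^ 'n) \<in> cube \<Longrightarrow> mean x \<in> unit_int"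
proof -
  assume x: "x \<in> (cube :: (real ^ 'n) set)"
  have "\<bar>\<Sum>i\<in>UNIV. x $ i\<bar> \<le> (\<Sum>i\<in>(UNIV :: 'n set). 1 / 2)"
    using cubeD[OF x] by (intro order_trans[OF sum_abs] sum_mono)
  thus ?thesis by (simp add: unit_int_iff mean_def abs_divide field_simps)
qed

lemma mean_cvec: "mean (cvec x) = of_real (mean x)"
  by (simp add: mean_def)

lemma norm_vec_power2: "(norm (v :: 'a::real_normed_vector ^ 'n))\<^sup>2 = (\<Sum>i\<in>UNIV. (norm (v $ i))\<^sup>2)"
  by (simp add: norm_vec_def L2_set_def sum_nonneg)

lemma norm_cvec [simp]: "norm (cvec x) = norm x"
  by (simp add: norm_vec_def)

lemma bounded_linear_cvec: "bounded_linear cvec"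
  unfolding linear_conv_bounded_linear[symmetric]
  by (rule linearI) (simp_all add: vec_eq_iff complex_eq_iff)

lemma cvec_diff: "cvec (x - y) = cvec x - cvec y"
  and cvec_add: "cvec (x + y) = cvec x + cvec y"
  by (simp_all add: vec_eq_iff)

lemma dist_cvec [simp]: "dist (cvec x) (cvec y) = dist x y"
  by (simp add: dist_norm flip: cvec_diff)

lemma cvec_inject [simp]: "cvec x = cvec y \<longleftrightarrow> x = y"
  by (simp add: vec_eq_iff)

definition rvec :: "complex ^ 'n \<Rightarrow> real ^ 'n" where
  "rvec z = (\<chi> i. Re (z $ i))"

lemma rvec_cvec [simp]: "rvec (cvec x) = x"
  by (simp add: rvec_def vec_eq_iff)

lemma bounded_linear_rvec: "bounded_linear rvec"
  unfolding linear_conv_bounded_linear[symmetric]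
  by (rule linearI) (auto simp: vec_eq_iff rvec_def)

lemma mob_den:
  assumes "\<bar>r\<bar> \<le> 2 / 5" "\<bar>x\<bar> \<le> 1 / 2"
  shows "(4 / 5 :: real) \<le> 1 + r * x"
proof -
  have "\<bar>r * x\<bar> \<le> 2 / 5 * (1 / 2)" unfolding abs_mult using assms by (intro mult_mono) auto
  thus ?thesis by simp
qed

lemma mob_eq: "mob r x = ((r + 4) * x + (r + 1)) / (2 * (1 + r * x))"
  by (simp add: mob_def algebra_simps)

text \<open>Differences of Moebius values factor exactly, so monotonicity in the point, and likewise
  in the parameter, is a matter of signs.\<close>

lemma mob_diff_x:
  assumes "1 + r * x > 0" "1 + r * y > 0"
  shows "mob r y - mob r x = (4 - r\<^sup>2) * (y - x) / (2 * (1 + r * x) * (1 + r * y))"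
  using assms unfolding mob_eq by (simp add: divide_simps) (simp add: power2_eq_square algebra_simps)

lemma mob_diff_r:
  assumes "1 + r * x > 0" "1 + s * x > 0"
  shows "mob s x - mob r x = (s - r) * (1 - 4 * x\<^sup>2) / (2 * (1 + r * x) * (1 + s * x))"
  using assms unfolding mob_eq by (simp add: divide_simps) (simp add: power2_eq_square algebra_simps)

lemma r_square: "\<bar>r\<bar> \<le> 2 / 5 \<Longrightarrow> r\<^sup>2 < (4 :: real)"
proof -
  assume "\<bar>r\<bar> \<le> 2 / 5"
  hence "r\<^sup>2 \<le> (2 / 5)\<^sup>2" using power_mono[of "\<bar>r\<bar>" "2 / 5" 2] by simp
  thus ?thesis by (simp add: power2_eq_square)
qed

lemma mob_less_iff:
  assumes "\<bar>r\<bar> \<le> 2 / 5" "\<bar>x\<bar> \<le> 1 / 2" "\<bar>y\<bar> \<le> 1 / 2"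
  shows "mob r x < mob r y \<longleftrightarrow> x < y"
proof -
  have "1 + r * x > 0" "1 + r * y > 0" using mob_den assms by fastforce+
  moreover have "c * (y - x) / d > 0 \<longleftrightarrow> x < y" if "c > 0" "d > 0" for c d :: real
    using that by (simp add: zero_less_divide_iff zero_less_mult_iff not_less)
  ultimately have "mob r y - mob r x > 0 \<longleftrightarrow> x < y"
    using mob_diff_x r_square[OF assms(1)] by simp
  thus ?thesis by simp
qed

lemma mob_mono_r:
  assumes "\<bar>r\<bar> \<le> 2 / 5" "\<bar>s\<bar> \<le> 2 / 5" "\<bar>x\<bar> \<le> 1 / 2" "r \<le> s"
  shows "mob r x \<le> mob s x"
proof -
  have *: "1 + r * x > 0" "1 + s * x > 0" using mob_den assms by fastforce+
  have "x\<^sup>2 \<le> (1 / 2)\<^sup>2" using assms by (simp add: abs_le_square_iff[symmetric])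
  hence "0 \<le> 1 - 4 * x\<^sup>2" by (simp add: power2_eq_square)
  hence "0 \<le> mob s x - mob r x" unfolding mob_diff_r[OF *] using * assms by (intro divide_nonneg_nonneg mult_nonneg_nonneg) auto
  thus ?thesis by simp
qed

lemma mob_ends:
  assumes "\<bar>r\<bar> \<le> 2 / 5"
  shows "mob r (- 1 / 2) = - 1 / 2" "mob r (1 / 2) = 3 / 2" "mob r (break_pt r) = 1 / 2" "\<bar>break_pt r\<bar> \<le> 1 / 2"
proof -
  have r: "\<bar>r\<bar> \<le> 2 / 5" using assms .
  hence "2 - r > 0" "2 + r > 0" "4 - r\<^sup>2 > 0" using r_square by auto
  thus "mob r (- 1 / 2) = - 1 / 2" "mob r (1 / 2) = 3 / 2" "mob r (break_pt r) = 1 / 2"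
    unfolding mob_eq break_pt_def by (simp_all add: field_simps power2_eq_square)
  show "\<bar>break_pt r\<bar> \<le> 1 / 2" using r by (simp add: break_pt_def)
qed

definition mob_inv :: "real \<Rightarrow> real \<Rightarrow> real" where
  "mob_inv r y = (2 * y - 1 - r) / (r + 4 - 2 * r * y)"

lemma mob_inv:
  assumes r: "\<bar>r\<bar> \<le> 2 / 5" and y: "- 1 / 2 \<le> y" "y \<le> 3 / 2"
  shows "r + 4 - 2 * r * y > 0" "\<bar>mob_inv r y\<bar> \<le> 1 / 2" "mob r (mob_inv r y) = y"
proof -
  have "\<bar>r * (2 * y - 1)\<bar> \<le> 2 / 5 * 2" unfolding abs_mult using assms by (intro mult_mono) auto
  hence "r * (2 * y - 1) \<le> 4 / 5" by simp
  moreover have "r * (2 * y - 1) = 2 * r * y - r" by (simp add: algebra_simps)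
  ultimately show d: "r + 4 - 2 * r * y > 0" by linarith
  have "0 \<le> (2 - r) * (2 * y + 1)" "0 \<le> (2 + r) * (3 - 2 * y)" using assms by (auto intro!: mult_nonneg_nonneg)
  hence "2 * (2 * y - 1 - r) \<le> r + 4 - 2 * r * y" "- (r + 4 - 2 * r * y) \<le> 2 * (2 * y - 1 - r)"
    by (simp_all add: algebra_simps)
  thus "\<bar>mob_inv r y\<bar> \<le> 1 / 2" using d unfolding mob_inv_def abs_le_iff
    by (simp add: divide_simps)
  have r2: "4 - r\<^sup>2 > 0" using r_square[OF r] by simp
  have e1: "1 + r * mob_inv r y = (4 - r\<^sup>2) / (r + 4 - 2 * r * y)"
    using d unfolding mob_inv_def by (simp add: divide_simps) (simp add: power2_eq_square algebra_simps)
  have e2: "(r + 4) * mob_inv r y + (r + 1) = 2 * y * (4 - r\<^sup>2) / (r + 4 - 2 * r * y)"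
    using d unfolding mob_inv_def by (simp add: divide_simps) (simp add: power2_eq_square algebra_simps)
  have "2 * y * c / e / (2 * (c / e)) = y" if "c > 0" "e > 0" for c e :: real
    using that by simp
  from this[OF r2 d] show "mob r (mob_inv r y) = y" unfolding mob_eq e1 e2 .
qed

section \<open>The lifted map: bijectivity, derivative and expansion\<close>

definition image_box :: "(real ^ 'n) set" where
  "image_box = {y. \<forall>i. - 1 / 2 \<le> y $ i \<and> y $ i \<le> 3 / 2}"

text \<open>\<open>G'\<close> enters through the derivative of the holomorphic extension
  \<open>Gc\<close>, so one complex differentiation covers the real map as well. \<open>Om\<close>
  may be any open neighbourhood of the interval.\<close>

locale gcm =
  fixes G G' :: "real \<Rightarrow> real" and Gc :: "complex \<Rightarrow> complex" and Om :: "complex set"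
  assumes open_Om: "open Om" and Gc_holo: "Gc holomorphic_on Om"
    and unit_Om: "\<And>x. x \<in> unit_int \<Longrightarrow> complex_of_real x \<in> Om"
    and Gc_real: "\<And>x. x \<in> unit_int \<Longrightarrow> Gc (of_real x) = of_real (G x)"
    and dGc_real: "\<And>x. x \<in> unit_int \<Longrightarrow> deriv Gc (of_real x) = of_real (G' x)"
    and G_bound: "\<And>x. x \<in> unit_int \<Longrightarrow> \<bar>G x\<bar> \<le> 2 / 5"
    and G_mono: "\<And>x y. x \<in> unit_int \<Longrightarrow> y \<in> unit_int \<Longrightarrow> x \<le> y \<Longrightarrow> G x \<le> G y"
    and dG_nonneg: "\<And>x. x \<in> unit_int \<Longrightarrow> 0 \<le> G' x"
    and dG_le: "\<And>x. x \<in> unit_int \<Longrightarrow> G' x \<le> 25 - 50 * \<bar>G x\<bar>"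
begin

text \<open>The lift of the coupled map, that is, its coordinates before 1 is subtracted. It has no
  discontinuity at the break points.\<close>

definition F :: "real ^ 'n \<Rightarrow> real ^ 'n" where
  "F x = (\<chi> i. mob (G (mean x)) (x $ i))"

definition Fc :: "complex ^ 'n \<Rightarrow> complex ^ 'n" where
  "Fc z = (\<chi> i. ((Gc (mean z) + 4) * z $ i + (Gc (mean z) + 1)) / (2 * (1 + Gc (mean z) * z $ i)))"

definition dom :: "(complex ^ 'n) set" where
  "dom = {z. mean z \<in> Om \<and> (\<forall>i. 1 + Gc (mean z) * z $ i \<noteq> 0)}"

definition DFc :: "complex ^ 'n \<Rightarrow> complex ^ 'n \<Rightarrow> complex ^ 'n" where
  "DFc z v = (\<chi> i. mob_slope (Gc (mean z)) (z $ i) * v $ i +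
      mob_tilt (Gc (mean z)) (z $ i) * (deriv Gc (mean z) * mean v))"

definition DF :: "real ^ 'n \<Rightarrow> real ^ 'n \<Rightarrow> real ^ 'n" where
  "DF x v = (\<chi> i. mob_slope (G (mean x)) (x $ i) * v $ i +
      mob_tilt (G (mean x)) (x $ i) * (G' (mean x) * mean v))"

lemma G_cube: "x \<in> cube \<Longrightarrow> \<bar>G (mean x)\<bar> \<le> 2 / 5"
  using G_bound mean_cube by blast

text \<open>Let the first point have the smaller parameter. Monotonicity in the parameter forces
  \<open>y $ i \<le> x $ i\<close> for all \<open>i\<close>, hence the mean of \<open>y\<close> is
  not larger, and monotonicity of \<open>G\<close> makes the parameters equal; then each coordinate
  is recovered from its Moebius image.\<close>

lemma F_inj: "inj_on F (cube :: (real ^ 'n) set)"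
proof (rule inj_onI)
  have *: "x = y" if xy: "x \<in> cube" "y \<in> cube" "F x = F y" "G (mean x) \<le> G (mean y)" for x y :: "real ^ 'n"
  proof -
    let ?r = "G (mean x)" and ?s = "G (mean y)"
    have eq: "mob ?r (x $ i) = mob ?s (y $ i)" for i
      using xy(3) by (simp add: F_def vec_eq_iff)
    have "y $ i \<le> x $ i" for i
    proof (rule ccontr)
      assume "\<not> y $ i \<le> x $ i"
      hence "mob ?r (x $ i) < mob ?r (y $ i)"
        using mob_less_iff[OF G_cube[OF xy(1)] cubeD[OF xy(1)] cubeD[OF xy(2)]] by (simp add: not_le)
      also have "\<dots> \<le> mob ?s (y $ i)"
        by (rule mob_mono_r[OF G_cube[OF xy(1)] G_cube[OF xy(2)] cubeD[OF xy(2)] xy(4)])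
      finally show False using eq[of i] by simp
    qed
    hence "mean y \<le> mean x" unfolding mean_def by (intro divide_right_mono sum_mono) auto
    hence "?s = ?r" using G_mono[OF mean_cube[OF xy(2)] mean_cube[OF xy(1)]] xy(4) by simp
    hence "x $ i = y $ i" for i
      using eq[of i] mob_less_iff[OF G_cube[OF xy(1)] cubeD[OF xy(1)] cubeD[OF xy(2)]]
        mob_less_iff[OF G_cube[OF xy(1)] cubeD[OF xy(2)] cubeD[OF xy(1)]]
      by (metis less_irrefl linorder_neqE)
    thus ?thesis by (simp add: vec_eq_iff)
  qed
  fix x y :: "real ^ 'n" assume "x \<in> cube" "y \<in> cube" "F x = F y"
  thus "x = y" using *[of x y] *[of y x] by (metis linear)
qed

lemma continuous_on_G: "continuous_on unit_int G"
proof -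
  have "continuous_on unit_int (\<lambda>x. Re (Gc (of_real x)))"
    using unit_Om by (intro continuous_intros continuous_on_compose2[OF holomorphic_on_imp_continuous_on[OF Gc_holo]]) auto
  thus ?thesis by (rule continuous_on_eq) (simp add: Gc_real)
qed

text \<open>Surjectivity: a trial parameter \<open>r\<close> determines a candidate preimage
  coordinate by coordinate. It is a true preimage when \<open>r = G (mean (X r))\<close>, and since
  \<open>G\<close> maps into \<open>[-2/5, 2/5]\<close>, the difference of the two sides changes
  sign on that interval.\<close>

lemma F_image: "F ` cube = (image_box :: (real ^ 'n) set)"
proof
  show "F ` cube \<subseteq> (image_box :: (real ^ 'n) set)"
  proof
    fix y :: "real ^ 'n" assume "y \<in> F ` cube"
    then obtain x where x: "x \<in> cube" "y = F x" by blast
    note r = G_cube[OF x(1)]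
    have "- 1 / 2 \<le> mob (G (mean x)) (x $ i) \<and> mob (G (mean x)) (x $ i) \<le> 3 / 2" for i
      using mob_less_iff[OF r, of "x $ i" "- 1 / 2"] mob_less_iff[OF r, of "1 / 2" "x $ i"]
        mob_ends[OF r] cubeD[OF x(1), of i] by (simp add: abs_le_iff) linarith
    thus "y \<in> image_box" by (simp add: image_box_def x F_def)
  qed
  show "(image_box :: (real ^ 'n) set) \<subseteq> F ` cube"
  proof
    fix y :: "real ^ 'n" assume y: "y \<in> image_box"
    define X where "X r = (\<chi> i. mob_inv r (y $ i))" for r
    have y': "- 1 / 2 \<le> y $ i" "y $ i \<le> 3 / 2" for i using y by (auto simp: image_box_def)
    have X: "X r \<in> cube" if "\<bar>r\<bar> \<le> 2 / 5" for r
      using mob_inv(2)[OF that y'] by (simp add: X_def cube_def unit_int_iff)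
    have "continuous_on {-2/5..2/5} (\<lambda>r. r - G (mean (X r)))"
    proof (intro continuous_intros continuous_on_compose2[OF continuous_on_G])
      show "continuous_on {-2/5..2/5} (\<lambda>r. mean (X r))"
      proof -
        have "r + 4 - 2 * r * y $ i \<noteq> 0" if "r \<in> {-2/5..2/5}" for r i
        proof -
          have "\<bar>r\<bar> \<le> 2 / 5" using that by (auto simp: abs_le_iff)
          from mob_inv(1)[OF this y', of i] show ?thesis by simp
        qed
        thus ?thesis unfolding mean_def X_def mob_inv_def vec_lambda_beta
          by (intro continuous_intros) auto
      qed
      show "(\<lambda>r. mean (X r)) ` {-2/5..2/5} \<subseteq> unit_int"
        using mean_cube[OF X] by (auto simp: abs_le_iff)
    qed
    moreover have "-2/5 - G (mean (X (-2/5))) \<le> 0" "0 \<le> 2/5 - G (mean (X (2/5)))"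
      using G_cube[OF X, of "-2/5"] G_cube[OF X, of "2/5"] by (auto simp: abs_le_iff)
    ultimately obtain r where r: "-2/5 \<le> r" "r \<le> 2/5" "r - G (mean (X r)) = 0"
      using IVT'[of "\<lambda>r. r - G (mean (X r))" "-2/5" 0 "2/5"] by auto
    hence r': "\<bar>r\<bar> \<le> 2 / 5" by (simp add: abs_le_iff)
    have "F (X r) = y"
      using mob_inv(3)[OF r' y'] r(3) by (simp add: F_def vec_eq_iff X_def)
    thus "y \<in> F ` cube" using X[OF r'] by blast
  qed
qed

lemma Fc_cvec: "x \<in> cube \<Longrightarrow> Fc (cvec x) = cvec (F x)"
  by (simp add: Fc_def F_def vec_eq_iff mean_cvec Gc_real mean_cube mob_eq)

lemma cvec_dom: "(x :: real ^ 'n) \<in> cube \<Longrightarrow> cvec x \<in> dom"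
proof -
  assume x: "x \<in> (cube :: (real ^ 'n) set)"
  have "1 + G (mean x) * x $ i \<noteq> 0" for i
    using mob_den[OF G_cube[OF x] cubeD[OF x, of i]] by auto
  hence "1 + complex_of_real (G (mean x)) * of_real (x $ i) \<noteq> 0" for i
    by (metis of_real_1 of_real_add of_real_eq_0_iff of_real_mult)
  thus ?thesis using unit_Om[OF mean_cube[OF x]] by (simp add: dom_def mean_cvec Gc_real mean_cube[OF x])
qed

lemma continuous_mean: "continuous_on S (mean :: complex ^ 'n \<Rightarrow> complex)"
  by (rule linear_continuous_on[OF bounded_linear_mean])

lemma continuous_on_Gc_mean:
  assumes "S \<subseteq> {z. mean z \<in> Om}"
  shows "continuous_on S (\<lambda>z :: complex ^ 'n. Gc (mean z))" "continuous_on S (\<lambda>z :: complex ^ 'n. deriv Gc (mean z))"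
  using assms holomorphic_deriv[OF Gc_holo open_Om]
  by (auto intro!: continuous_on_compose2[OF holomorphic_on_imp_continuous_on continuous_mean] Gc_holo)

lemma open_dom: "open (dom :: (complex ^ 'n) set)"
proof -
  have 1: "open {z :: complex ^ 'n. mean z \<in> Om}"
    using open_vimage[OF open_Om continuous_mean] by (simp add: vimage_def)
  have 2: "open {z \<in> {z :: complex ^ 'n. mean z \<in> Om}. 1 + Gc (mean z) * z $ i \<noteq> 0}" for i
  proof -
    have "continuous_on {z :: complex ^ 'n. mean z \<in> Om} (\<lambda>z. 1 + Gc (mean z) * z $ i)"
      by (intro continuous_intros continuous_on_Gc_mean(1)[OF subset_refl])
    from continuous_open_preimage[OF this 1, of "- {0}"] show ?thesis
      by (simp add: vimage_def Int_def open_Compl)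
  qed
  have "dom = (\<Inter>i. {z \<in> {z :: complex ^ 'n. mean z \<in> Om}. 1 + Gc (mean z) * z $ i \<noteq> 0})"
    by (auto simp: dom_def)
  thus ?thesis using 2 by (simp only:) (rule open_INT, auto)
qed

lemma Fc_has_derivative:
  fixes z :: "complex ^ 'n"
  assumes "z \<in> dom"
  shows "(Fc has_derivative DFc z) (at z)"
proof -
  have Om: "mean z \<in> Om" and nz: "\<And>i. 1 + Gc (mean z) * z $ i \<noteq> 0" using assms by (auto simp: dom_def)
  have "(Gc has_field_derivative deriv Gc (mean z)) (at (mean z))"
    using holomorphic_derivI[OF Gc_holo open_Om Om] .
  from has_derivative_compose[OF bounded_linear_imp_has_derivative[OF bounded_linear_mean]
      this[unfolded has_field_derivative_def]]
  have g: "((\<lambda>z. Gc (mean z)) has_derivative (\<lambda>v. deriv Gc (mean z) * mean v)) (at z)" .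
  have "((\<lambda>z. Fc z $ i) has_derivative (\<lambda>v. DFc z v $ i)) (at z)" for i
    unfolding Fc_def DFc_def vec_lambda_beta
    by (rule mob_has_derivative[OF g bounded_linear_imp_has_derivative[OF bounded_linear_vec_nth] nz])
  thus ?thesis
    by (subst has_derivative_componentwise_within)
       (auto simp: Basis_vec_def inner_axis intro!: has_derivative_inner_left)
qed

lemma DFc_cvec: "x \<in> cube \<Longrightarrow> DFc (cvec x) (cvec v) = cvec (DF x v)"
  by (simp add: DFc_def DF_def vec_eq_iff mean_cvec Gc_real dGc_real mean_cube mob_slope_def mob_tilt_def)

text \<open>The complex derivative restricted to real directions; \<open>rvec\<close> undoes the
  embedding \<open>cvec\<close>.\<close>

lemma F_has_derivative:
  fixes x :: "real ^ 'n"
  assumes x: "x \<in> cube"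
  shows "(F has_derivative DF x) (at x within cube)"
proof -
  have "((\<lambda>y. Fc (cvec y)) has_derivative (\<lambda>v. DFc (cvec x) (cvec v))) (at x within cube)"
    by (rule has_derivative_compose[OF bounded_linear_imp_has_derivative[OF bounded_linear_cvec]
          Fc_has_derivative[OF cvec_dom[OF x]]])
  from bounded_linear.has_derivative[OF bounded_linear_rvec this]
  have "((\<lambda>y. rvec (Fc (cvec y))) has_derivative DF x) (at x within cube)"
    by (simp add: DFc_cvec[OF x])
  thus ?thesis
    by (rule has_derivative_transform[OF x, rotated]) (simp add: Fc_cvec)
qed

text \<open>Over a real point the slopes and tilts are real, so the mean-field estimate applies with
  complex components. The constant \<open>5 / 6\<close> is the quotient of
  \<open>L = 5 K\<^sup>2 / 6\<close> by the squared least slope.\<close>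

lemma DFc_expansion:
  fixes v :: "complex ^ 'n"
  assumes x: "x \<in> cube"
  shows "(norm v)\<^sup>2 \<le> 5 / 6 * (norm (DFc (cvec x) v))\<^sup>2"
proof -
  define r where "r = G (mean x)"
  define t where "t = \<bar>r\<bar>"
  define K where "K = 2 * (2 - t) / (2 + t)"
  \<comment> \<open>The quotient of tilt and slope, times \<open>G'\<close>; the denominators
    \<open>(1 + r * x $ i)\<^sup>2\<close> cancel.\<close>
  define w where "w i = G' (mean x) * (1 - 4 * (x $ i)\<^sup>2) / (4 - r\<^sup>2)" for i
  have r: "\<bar>r\<bar> \<le> 2 / 5" using G_cube[OF x] by (simp add: r_def)
  have t: "0 \<le> t" "t \<le> 2 / 5" "t\<^sup>2 = r\<^sup>2" using r by (auto simp: t_def)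
  note cb = coupling_bound[OF t(1,2), folded K_def]
  have r2: "4 - r\<^sup>2 > 0" using r_square[OF r] by simp
  have g: "0 \<le> G' (mean x)" "G' (mean x) \<le> 25 - 50 * t"
    using dG_nonneg dG_le mean_cube[OF x] by (auto simp: t_def r_def)
  have x2: "0 \<le> 1 - 4 * (x $ i)\<^sup>2" "1 - 4 * (x $ i)\<^sup>2 \<le> 1" for i
  proof -
    have "(x $ i)\<^sup>2 \<le> (1 / 2)\<^sup>2" using cubeD[OF x, of i] by (simp add: abs_le_square_iff[symmetric])
    thus "0 \<le> 1 - 4 * (x $ i)\<^sup>2" by (simp add: power2_eq_square)
  qed auto
  have w: "0 \<le> w i \<and> w i \<le> (25 - 50 * t) / (4 - t\<^sup>2)" for i
  proof
    show "0 \<le> w i" unfolding w_def using g x2 r2 by (intro divide_nonneg_nonneg mult_nonneg_nonneg) auto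
    have "G' (mean x) * (1 - 4 * (x $ i)\<^sup>2) \<le> (25 - 50 * t) * 1" using g x2 by (intro mult_mono) auto
    thus "w i \<le> (25 - 50 * t) / (4 - t\<^sup>2)" unfolding w_def t(3) using r2 by (intro divide_right_mono) auto
  qed
  have comp: "DFc (cvec x) v $ i = of_real (mob_slope r (x $ i)) * (v $ i + w i *\<^sub>R mean v)" for i
  proof -
    have "mob_tilt r (x $ i) * G' (mean x) = mob_slope r (x $ i) * w i"
      using r2 by (simp add: mob_slope_def mob_tilt_def w_def)
    hence "of_real (mob_tilt r (x $ i) * G' (mean x)) = complex_of_real (mob_slope r (x $ i) * w i)" by simp
    moreover have "DFc (cvec x) v $ i = of_real (mob_slope r (x $ i)) * v $ i +
        of_real (mob_tilt r (x $ i) * G' (mean x)) * mean v"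
      by (simp add: DFc_def mean_cvec Gc_real dGc_real mean_cube[OF x] mob_slope_def mob_tilt_def r_def)
    ultimately show ?thesis by (simp add: scaleR_conv_of_real algebra_simps)
  qed
  \<comment> \<open>The factor \<open>1 + r * x $ i\<close> is at most \<open>(2 + t) / 2\<close>,
    and this value turns the slope into \<open>K\<close>.\<close>
  have slope: "K \<le> mob_slope r (x $ i)" for i
  proof -
    have d: "0 < 1 + r * x $ i" using mob_den[OF r cubeD[OF x, of i]] by simp
    have "\<bar>r * x $ i\<bar> \<le> t * (1 / 2)" unfolding abs_mult t_def using cubeD[OF x, of i] by (intro mult_left_mono) auto
    hence "1 + r * x $ i \<le> (2 + t) / 2" by (simp add: abs_le_iff)
    hence "(1 + r * x $ i)\<^sup>2 \<le> ((2 + t) / 2)\<^sup>2" using d by (intro power_mono) auto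
    hence "(4 - r\<^sup>2) / (2 * ((2 + t) / 2)\<^sup>2) \<le> mob_slope r (x $ i)"
      unfolding mob_slope_def using r2 d by (intro divide_left_mono mult_pos_pos) auto
    moreover have "(4 - r\<^sup>2) / (2 * ((2 + t) / 2)\<^sup>2) = K"
    proof -
      have "(a * b) / (2 * (b / 2)\<^sup>2) = 2 * a / b" if "b > 0" for a b :: real
        using that by (simp add: power2_eq_square)
      moreover have "4 - t\<^sup>2 = (2 - t) * (2 + t)" by (simp add: power2_eq_square algebra_simps)
      ultimately show ?thesis unfolding t(3)[symmetric] K_def using t(1) by simp
    qed
    ultimately show ?thesis by simp
  qed
  have m: "(\<Sum>i\<in>UNIV. v $ i) = real CARD('n) *\<^sub>R mean v"
    by (simp add: mean_def scaleR_conv_of_real)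
  have "(norm v)\<^sup>2 \<le> K\<^sup>2 * (5 / 6) * (\<Sum>i\<in>UNIV. (norm (v $ i + w i *\<^sub>R mean v))\<^sup>2)"
    unfolding norm_vec_power2 by (rule mean_field_expansion[OF cb(2,1) w m])
  also have "\<dots> = 5 / 6 * (\<Sum>i\<in>UNIV. K\<^sup>2 * (norm (v $ i + w i *\<^sub>R mean v))\<^sup>2)"
    by (simp add: sum_distrib_left mult_ac)
  also have "\<dots> \<le> 5 / 6 * (\<Sum>i\<in>UNIV. (norm (DFc (cvec x) v $ i))\<^sup>2)"
  proof (intro mult_left_mono sum_mono)
    fix i
    have "K * norm (v $ i + w i *\<^sub>R mean v) \<le> norm (DFc (cvec x) v $ i)"
      unfolding comp norm_mult using slope[of i] cb(3) by (intro mult_right_mono) auto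
    hence "(K * norm (v $ i + w i *\<^sub>R mean v))\<^sup>2 \<le> (norm (DFc (cvec x) v $ i))\<^sup>2"
      using cb(3) by (intro power_mono) auto
    thus "K\<^sup>2 * (norm (v $ i + w i *\<^sub>R mean v))\<^sup>2 \<le> (norm (DFc (cvec x) v $ i))\<^sup>2"
      by (simp add: power_mult_distrib)
  qed auto
  finally show ?thesis by (simp add: norm_vec_power2)
qed

end

section \<open>Complex inverse branches\<close>

text \<open>Holomorphy as real Frechet differentiability with a derivative that commutes with
  complex scalars. Derivatives of inverse maps can thus be taken over the reals, complex linearity
  being checked afterwards.\<close>

definition vholo :: "(complex ^ 'n \<Rightarrow> complex ^ 'm) \<Rightarrow> complex ^ 'n \<Rightarrow> bool" where
  "vholo f z \<longleftrightarrow> (\<exists>f'. (f has_derivative f') (at z) \<and> (\<forall>c v. f' (c *s v) = c *s f' v))"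

definition cholo :: "(complex ^ 'n \<Rightarrow> complex) \<Rightarrow> complex ^ 'n \<Rightarrow> bool" where
  "cholo f z \<longleftrightarrow> (\<exists>f'. (f has_derivative f') (at z) \<and> (\<forall>c v. f' (c *s v) = c * f' v))"

lemma cholo_const: "cholo (\<lambda>_. c) z"
  unfolding cholo_def by (intro exI[of _ "\<lambda>_. 0"]) auto

lemma cholo_nth: "cholo (\<lambda>z. z $ i) z"
  unfolding cholo_def
  by (intro exI[of _ "\<lambda>v. v $ i"] conjI bounded_linear_imp_has_derivative bounded_linear_vec_nth) simp

lemma cholo_add:
  assumes "cholo f z" "cholo g z"
  shows "cholo (\<lambda>z. f z + g z) z"
proof -
  obtain f' g' where d: "(f has_derivative f') (at z)" "(g has_derivative g') (at z)"
    and l: "\<forall>c v. f' (c *s v) = c * f' v" "\<forall>c v. g' (c *s v) = c * g' v"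
    using assms unfolding cholo_def by blast
  show ?thesis unfolding cholo_def
    by (intro exI[of _ "\<lambda>v. f' v + g' v"] conjI has_derivative_add d) (simp add: l algebra_simps)
qed

lemma cholo_mult:
  assumes "cholo f z" "cholo g z"
  shows "cholo (\<lambda>z. f z * g z) z"
proof -
  obtain f' g' where d: "(f has_derivative f') (at z)" "(g has_derivative g') (at z)"
    and l: "\<forall>c v. f' (c *s v) = c * f' v" "\<forall>c v. g' (c *s v) = c * g' v"
    using assms unfolding cholo_def by blast
  show ?thesis unfolding cholo_def
    by (intro exI[of _ "\<lambda>v. f z * g' v + f' v * g z"] conjI has_derivative_mult d) (simp add: l algebra_simps)
qed

lemma cholo_compose:
  assumes "cholo f z" "h field_differentiable (at (f z))"
  shows "cholo (\<lambda>z. h (f z)) z"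
proof -
  obtain f' where d: "(f has_derivative f') (at z)" and l: "\<forall>c v. f' (c *s v) = c * f' v"
    using assms unfolding cholo_def by blast
  obtain h' where "(h has_field_derivative h') (at (f z))" using assms(2) field_differentiable_def by blast
  hence h: "(h has_derivative (*) h') (at (f z))" by (simp add: has_field_derivative_def)
  show ?thesis unfolding cholo_def
    by (intro exI[of _ "\<lambda>v. h' * f' v"] conjI has_derivative_compose[OF d h]) (simp add: l)
qed

lemma cholo_divide:
  assumes "cholo f z" "cholo g z" "g z \<noteq> 0"
  shows "cholo (\<lambda>z. f z / g z) z"
proof -
  have "cholo (\<lambda>z. f z * inverse (g z)) z"
    by (intro cholo_mult assms cholo_compose[where h = inverse] field_differentiable_inverse field_differentiable_ident)
  thus ?thesis by (simp add: divide_inverse)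
qed

lemma cholo_sum: "(\<And>i. i \<in> A \<Longrightarrow> cholo (f i) z) \<Longrightarrow> cholo (\<lambda>z. \<Sum>i\<in>A. f i z) z"
  by (induction A rule: infinite_finite_induct) (simp_all add: cholo_const cholo_add)

lemma cholo_prod: "(\<And>i. i \<in> A \<Longrightarrow> cholo (f i) z) \<Longrightarrow> cholo (\<lambda>z. \<Prod>i\<in>A. f i z) z"
  by (induction A rule: infinite_finite_induct) (simp_all add: cholo_const cholo_mult)

lemma cholo_vcompose:
  assumes "vholo f z" "cholo g (f z)"
  shows "cholo (\<lambda>z. g (f z)) z"
proof -
  obtain f' g' where d: "(f has_derivative f') (at z)" "(g has_derivative g') (at (f z))"
    and l: "\<forall>c v. f' (c *s v) = c *s f' v" "\<forall>c v. g' (c *s v) = c * g' v"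
    using assms unfolding cholo_def vholo_def by blast
  show ?thesis unfolding cholo_def
    by (intro exI[of _ "\<lambda>v. g' (f' v)"] conjI has_derivative_compose[OF d]) (simp add: l)
qed

lemma cholo_imp_continuous: "cholo f z \<Longrightarrow> isCont f z"
  unfolding cholo_def using has_derivative_continuous by blast

lemma cholo_line:
  assumes "cholo f (z + t *s v)"
  shows "(\<lambda>t. f (z + t *s v)) field_differentiable (at t)"
proof -
  obtain f' where d: "(f has_derivative f') (at (z + t *s v))" and l: "\<forall>c v. f' (c *s v) = c * f' v"
    using assms unfolding cholo_def by blast
  have "bounded_linear (\<lambda>t. t *s v)"
    unfolding linear_conv_bounded_linear[symmetric]
    by (rule linearI) (auto simp: vec_eq_iff algebra_simps)
  hence "((\<lambda>t. z + t *s v) has_derivative (\<lambda>t. t *s v)) (at t)"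
    by (auto intro!: derivative_eq_intros bounded_linear_imp_has_derivative)
  from has_derivative_compose[OF this d] have "((\<lambda>t. f (z + t *s v)) has_derivative (\<lambda>t. t * f' v)) (at t)"
    using l by simp
  thus ?thesis unfolding field_differentiable_def has_field_derivative_def
    by (intro exI[of _ "f' v"]) (simp add: mult.commute[of _ "f' v"])
qed

lemma vupd_eq_line: "vupd z j w = (vupd z j 0) + w *s axis j 1"
  by (simp add: vec_eq_iff axis_def)

lemma cholo_imp_sep_holo:
  assumes "\<And>z. z \<in> polydisc a R \<Longrightarrow> cholo f z"
  shows "sep_holo a R f"
  unfolding sep_holo_def
proof (intro ballI allI)
  fix z j assume z: "z \<in> polydisc a R"
  show "(\<lambda>w. f (vupd z j w)) holomorphic_on ball (a $ j) R"
    unfolding holomorphic_on_def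
  proof
    fix w assume "w \<in> ball (a $ j) R"
    hence "cholo f (vupd z j w)" using assms vupd_polydisc[OF z] by blast
    hence "cholo f (vupd z j 0 + w *s axis j 1)" by (subst (asm) vupd_eq_line)
    from cholo_line[OF this] have "(\<lambda>w. f (vupd z j w)) field_differentiable (at w)"
      by (subst (asm) vupd_eq_line[symmetric])
    thus "(\<lambda>w. f (vupd z j w)) field_differentiable (at w within ball (a $ j) R)"
      by (rule field_differentiable_at_within)
  qed
qed

text \<open>Cauchy's estimate on the complex line through \<open>a\<close> and \<open>z\<close>.\<close>

lemma cholo_bounded_imp_lipschitz:
  assumes f: "\<And>z. z \<in> ball a (2 * d) \<Longrightarrow> cholo f z" "\<And>z. z \<in> ball a (2 * d) \<Longrightarrow> norm (f z) \<le> M"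
    and z: "z \<in> ball a d"
  shows "norm (f z - f a) \<le> M / d * dist z a"
proof (cases "z = a")
  case False
  define n where "n = dist z a"
  have n: "0 < n" "n < d" "d > 0" using False z by (auto simp: n_def dist_commute intro: le_less_trans[OF zero_le_dist])
  \<comment> \<open>The parameter disc of radius \<open>R\<close> just fits into the ball of radius
    \<open>2 * d\<close>. Since \<open>R > 2\<close>, discs of radius \<open>R / 2\<close> around
    points of the closed unit disc stay inside.\<close>
  define R where "R = 2 * d / n"
  have R: "R > 2" using n by (simp add: R_def field_simps)
  let ?g = "\<lambda>t. f (a + t *s (z - a))"
  have norm_s: "norm (t *s v) = norm t * norm v" for t and v :: "complex ^ 'a"
    by (simp add: norm_vec_def L2_set_def norm_mult power_mult_distrib real_sqrt_mult flip: sum_distrib_left)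
  have inb: "a + t *s (z - a) \<in> ball a (2 * d)" if "t \<in> ball 0 R" for t
  proof -
    have "norm (t *s (z - a)) < R * n"
      unfolding norm_s using that n by (simp add: n_def dist_norm)
    moreover have "R * n = 2 * d" using n by (simp add: R_def)
    moreover have "dist a (a + t *s (z - a)) = norm (t *s (z - a))"
      by (subst dist_commute) (simp only: dist_norm add_diff_cancel_left')
    ultimately show ?thesis by simp
  qed
  have fd: "?g field_differentiable (at t)" if "t \<in> ball 0 R" for t
    by (rule cholo_line[OF f(1)[OF inb[OF that]]])
  have hol: "?g holomorphic_on ball 0 R"
    unfolding holomorphic_on_def using fd field_differentiable_at_within by blast
  have der: "norm (deriv ?g t) \<le> M / d * n" if t: "t \<in> cball 0 1" for t
  proof -
    have sub: "cball t (R / 2) \<subseteq> ball 0 R"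
    proof
      fix u assume "u \<in> cball t (R / 2)"
      hence "norm u \<le> norm t + R / 2" 
        using norm_triangle_ineq[of t "u - t"] by (simp add: dist_norm norm_minus_commute)
      thus "u \<in> ball 0 R" using t R by simp
    qed
    have "norm ((deriv ^^ 1) ?g t) \<le> fact 1 * M / (R / 2) ^ 1"
    proof (rule Cauchy_inequality)
      show "?g holomorphic_on ball t (R / 2)"
        using hol by (rule holomorphic_on_subset) (use sub ball_subset_cball in blast)
      show "continuous_on (cball t (R / 2)) ?g"
        using holomorphic_on_imp_continuous_on[OF hol] sub by (rule continuous_on_subset)
      show "norm (?g u) \<le> M" if "norm (t - u) = R / 2" for u
        using that sub by (intro f(2) inb) (auto simp: dist_norm)
    qed (use R in auto)
    also have "fact 1 * M / (R / 2) ^ 1 = M / d * n" using n by (simp add: R_def)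
    finally show ?thesis by simp
  qed
  have "norm (?g 1 - ?g 0) \<le> M / d * n * norm (1 - 0 :: complex)"
  proof (rule field_differentiable_bound[where f' = "deriv ?g"])
    show "convex (cball 0 1 :: complex set)" by simp
    show "(?g has_field_derivative deriv ?g t) (at t within cball 0 1)" if "t \<in> cball 0 1" for t
    proof -
      have "t \<in> ball 0 R" using that R by simp
      from fd[OF this] have "(?g has_field_derivative deriv ?g t) (at t)"
        by (simp only: DERIV_deriv_iff_field_differentiable)
      thus ?thesis by (rule has_field_derivative_at_within)
    qed
  qed (use der in auto)
  thus ?thesis by (simp add: n_def)
qed simp

text \<open>Uniform continuity in which only one of the two points has to lie in the compact set; it
  follows from a Lebesgue number for a cover by balls of pointwise continuity.\<close>

lemma compact_nbhd_uniform:
  fixes f :: "'a::metric_space \<Rightarrow> 'b::metric_space"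
  assumes K: "compact K" and U: "open U" "K \<subseteq> U" and f: "continuous_on U f" and e: "e > 0"
  shows "\<exists>d>0. \<forall>x\<in>K. \<forall>z\<in>ball x d. z \<in> U \<and> dist (f z) (f x) < e"
proof -
  have "\<exists>d>0. ball x d \<subseteq> U \<and> (\<forall>z\<in>ball x d. dist (f z) (f x) < e / 2)" if "x \<in> K" for x
  proof -
    have "isCont f x" using f U that by (auto simp: continuous_on_eq_continuous_at)
    from this[unfolded continuous_at_eps_delta, rule_format, OF half_gt_zero[OF e]]
    have "\<exists>d>0. \<forall>z. dist z x < d \<longrightarrow> dist (f z) (f x) < e / 2" by simp
    then obtain d1 where d1: "d1 > 0" "\<And>z. dist z x < d1 \<Longrightarrow> dist (f z) (f x) < e / 2"
      by auto
    have "x \<in> U" using U that by auto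
    then obtain d2 where "d2 > 0" "ball x d2 \<subseteq> U" using openE[OF U(1)] by auto
    with d1 show ?thesis by (intro exI[of _ "min d1 d2"]) (auto simp: dist_commute)
  qed
  then obtain d where d: "\<And>x. x \<in> K \<Longrightarrow> d x > 0" "\<And>x. x \<in> K \<Longrightarrow> ball x (d x) \<subseteq> U"
    "\<And>x z. x \<in> K \<Longrightarrow> z \<in> ball x (d x) \<Longrightarrow> dist (f z) (f x) < e / 2" by metis
  obtain r where r: "r > 0" "\<forall>x\<in>K. \<exists>B\<in>(\<lambda>x. ball x (d x)) ` K. ball x r \<subseteq> B"
  proof (rule Heine_Borel_lemma[OF K, of "(\<lambda>x. ball x (d x)) ` K"])
    show "K \<subseteq> \<Union> ((\<lambda>x. ball x (d x)) ` K)" using d(1) by force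
  qed auto
  show ?thesis
  proof (intro exI[of _ r] conjI r ballI)
    fix x z assume x: "x \<in> K" and z: "z \<in> ball x r"
    then obtain y where y: "y \<in> K" "ball x r \<subseteq> ball y (d y)" using r(2) by blast
    have "x \<in> ball x r" using r by simp
    hence xz: "x \<in> ball y (d y)" "z \<in> ball y (d y)" using subsetD[OF y(2)] z by blast+
    thus "z \<in> U" using d(2)[OF y(1)] by auto
    show "dist (f z) (f x) < e"
      using d(3)[OF y(1) xz(1)] d(3)[OF y(1) xz(2)] dist_triangle2[of "f z" "f x" "f y"] by linarith
  qed
qed

lemma LIMSEQ_close:
  fixes u v :: "nat \<Rightarrow> 'a::metric_space" and a :: 'a and \<epsilon> :: "nat \<Rightarrow> real"
  assumes v: "v \<longlonglongrightarrow> a" and uv: "\<And>n. dist (v n) (u n) \<le> \<epsilon> n" and \<epsilon>: "\<epsilon> \<longlonglongrightarrow> 0"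
  shows "u \<longlonglongrightarrow> a"
proof (rule metric_tendsto_imp_tendsto)
  have "(\<lambda>n. dist (v n) a + \<epsilon> n) \<longlonglongrightarrow> 0 + 0"
    by (rule tendsto_add[OF tendsto_dist_iff[THEN iffD1, OF v] \<epsilon>])
  thus "(\<lambda>n. dist (v n) a + \<epsilon> n) \<longlonglongrightarrow> 0" by simp
  show "\<forall>\<^sub>F n in sequentially. dist (u n) a \<le> dist (dist (v n) a + \<epsilon> n) 0"
  proof (intro always_eventually allI)
    fix n
    show "dist (u n) a \<le> dist (dist (v n) a + \<epsilon> n) 0"
      using uv[of n] dist_triangle3[of "u n" a "v n"] unfolding dist_real_def by linarith
  qed
qed

text \<open>If every neighbourhood failed, pairs of distinct points with equal values would
  accumulate at two points of \<open>K\<close>; continuity and injectivity on \<open>K\<close> make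
  these one point, where local injectivity is contradicted.\<close>

lemma locally_injective_nbhd:
  fixes f :: "'a::metric_space \<Rightarrow> 'b::metric_space"
  assumes K: "compact K" and U: "open U" "K \<subseteq> U" and f: "continuous_on U f" and inj: "inj_on f K"
    and loc: "\<And>x. x \<in> K \<Longrightarrow> \<exists>r>0. inj_on f (ball x r)"
  shows "\<exists>d>0. (\<Union>x\<in>K. ball x d) \<subseteq> U \<and> inj_on f (\<Union>x\<in>K. ball x d)"
proof (rule ccontr)
  obtain d0 where d0: "d0 > 0" "\<And>x z. x \<in> K \<Longrightarrow> z \<in> ball x d0 \<Longrightarrow> z \<in> U"
    using compact_nbhd_uniform[OF K U f, of 1] by auto
  assume not: "\<not> ?thesis"
  define P where "P d p \<longleftrightarrow> (case p of (x, y, a, b) \<Rightarrow>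
    x \<in> K \<and> y \<in> K \<and> dist x a < d \<and> dist y b < d \<and> a \<noteq> b \<and> f a = f b)" for d p
  have "\<exists>p. P d p" if d: "d > 0" for d
  proof -
    let ?d = "min d d0"
    have "(\<Union>x\<in>K. ball x ?d) \<subseteq> U" using d0(2) by auto
    hence "\<not> inj_on f (\<Union>x\<in>K. ball x ?d)" using not d d0(1) by (meson min_less_iff_conj)
    then obtain a b x y where "x \<in> K" "y \<in> K" "a \<in> ball x ?d" "b \<in> ball y ?d" "a \<noteq> b" "f a = f b"
      unfolding inj_on_def by blast
    thus ?thesis by (intro exI[of _ "(x, y, a, b)"]) (simp add: P_def)
  qed
  hence "\<forall>n. \<exists>p. P (inverse (real (Suc n))) p" by simp
  from choice[OF this] obtain p where p: "\<And>n. P (inverse (real (Suc n))) (p n)" by blast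
  define x y a b where "x n = fst (p n)" and "y n = fst (snd (p n))"
    and "a n = fst (snd (snd (p n)))" and "b n = snd (snd (snd (p n)))" for n
  have s: "\<And>n. x n \<in> K" "\<And>n. y n \<in> K" "\<And>n. dist (x n) (a n) < inverse (real (Suc n))"
    "\<And>n. dist (y n) (b n) < inverse (real (Suc n))" "\<And>n. a n \<noteq> b n" "\<And>n. f (a n) = f (b n)"
    using p unfolding P_def x_def y_def a_def b_def by (auto simp: case_prod_beta)
  have "compact (K \<times> K)" using K by (intro compact_Times)
  note this[unfolded compact_def, rule_format, of "\<lambda>n. (x n, y n)"]
  then obtain l r where lr: "l \<in> K \<times> K" "strict_mono r" "((\<lambda>n. (x n, y n)) \<circ> r) \<longlonglongrightarrow> l"
    using s(1,2) by blast
  obtain lx ly where l: "l = (lx, ly)" by force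
  have z: "(\<lambda>n. inverse (real (Suc (r n)))) \<longlonglongrightarrow> 0"
    using LIMSEQ_subseq_LIMSEQ[OF LIMSEQ_inverse_real_of_nat lr(2)] by (simp add: o_def)
  have xy: "(\<lambda>n. (x (r n), y (r n))) \<longlonglongrightarrow> (lx, ly)"
    using lr(3) unfolding o_def l .
  have x: "(\<lambda>n. x (r n)) \<longlonglongrightarrow> lx" using tendsto_fst[OF xy] unfolding fst_conv .
  have y: "(\<lambda>n. y (r n)) \<longlonglongrightarrow> ly" using tendsto_snd[OF xy] unfolding snd_conv .
  have a: "(\<lambda>n. a (r n)) \<longlonglongrightarrow> lx" and b: "(\<lambda>n. b (r n)) \<longlonglongrightarrow> ly"
    by (rule LIMSEQ_close[OF x _ z], rule less_imp_le[OF s(3)], rule LIMSEQ_close[OF y _ z], rule less_imp_le[OF s(4)])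
  have K': "lx \<in> K" "ly \<in> K" using lr(1) l by auto
  hence "isCont f lx" "isCont f ly" using f U continuous_on_eq_continuous_at by blast+
  hence "(\<lambda>n. f (a (r n))) \<longlonglongrightarrow> f lx" "(\<lambda>n. f (b (r n))) \<longlonglongrightarrow> f ly"
    using a b by (auto intro: isCont_tendsto_compose)
  hence "f lx = f ly" unfolding s(6) by (rule LIMSEQ_unique)
  hence eq: "lx = ly" using inj K' by (simp add: inj_on_eq_iff)
  obtain e where e: "e > 0" "inj_on f (ball lx e)" using loc[OF K'(1)] by blast
  have "\<forall>\<^sub>F n in sequentially. a (r n) \<in> ball lx e" "\<forall>\<^sub>F n in sequentially. b (r n) \<in> ball lx e"
    using tendstoD[OF a e(1)] tendstoD[OF b e(1)] eq by (auto simp: dist_commute)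
  hence "\<forall>\<^sub>F n in sequentially. False"
  proof eventually_elim
    case (elim n)
    thus ?case using e(2) s(5)[of "r n"] s(6)[of "r n"] by (simp add: inj_on_eq_iff)
  qed
  thus False by simp
qed

lemma det_of_real: "det (\<chi> i j. complex_of_real (A $ i $ j)) = of_real (det (A :: real ^ 'n ^ 'n))"
  unfolding det_def by simp

section \<open>The Jacobian determinant and the complex inverse of the lifted map\<close>

context gcm
begin

text \<open>The matrix behind \<open>jac\<close>, for complex points. No modulus is taken, so its
  determinant is holomorphic.\<close>

definition jacobian :: "complex ^ 'n \<Rightarrow> complex ^ 'n idx ^ 'n idx" where
  "jacobian z = (\<chi> k l. (if k = l then mob_slope (Gc (mean z)) (z $ enum_idx k) else 0) +
      mob_tilt (Gc (mean z)) (z $ enum_idx k) * (deriv Gc (mean z) / of_nat CARD('n)))"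

lemma dom_cholo:
  fixes z :: "complex ^ 'n"
  assumes "z \<in> dom"
  shows "cholo (\<lambda>z. det (jacobian z)) z"
proof -
  have Om: "mean z \<in> Om" and nz: "\<And>i. 1 + Gc (mean z) * z $ i \<noteq> 0" using assms by (auto simp: dom_def)
  have m: "cholo (mean :: complex ^ 'n \<Rightarrow> complex) z"
    unfolding mean_def by (intro cholo_divide cholo_sum cholo_nth cholo_const) simp
  have G: "cholo (\<lambda>z. Gc (mean z)) z" and dG: "cholo (\<lambda>z. deriv Gc (mean z)) z"
    using holomorphic_on_imp_differentiable_at[OF Gc_holo open_Om Om]
      holomorphic_on_imp_differentiable_at[OF holomorphic_deriv[OF Gc_holo open_Om] open_Om Om]
    by (auto intro: cholo_compose[OF m])
  have sq: "cholo (\<lambda>z. (f z)\<^sup>2) z" if "cholo f z" for f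
    unfolding power2_eq_square by (intro cholo_mult that)
  have diff: "cholo (\<lambda>z. f z - g z) z" if "cholo f z" "cholo g z" for f g
    using cholo_add[OF that(1) cholo_mult[OF cholo_const[of "-1"] that(2)]] by simp
  have den: "cholo (\<lambda>z. 2 * (1 + Gc (mean z) * z $ i)\<^sup>2) z" for i
    by (intro cholo_mult cholo_const sq cholo_add G cholo_nth)
  have "cholo (\<lambda>z. mob_slope (Gc (mean z)) (z $ i)) z" for i
    unfolding mob_slope_def by (intro cholo_divide den diff cholo_const sq G) (simp add: nz)
  moreover have "cholo (\<lambda>z. mob_tilt (Gc (mean z)) (z $ i)) z" for i
    unfolding mob_tilt_def by (intro cholo_divide den diff cholo_mult cholo_const sq cholo_nth) (simp add: nz)
  ultimately have "cholo (\<lambda>z. jacobian z $ k $ l) z" for k l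
    unfolding jacobian_def vec_lambda_beta
    by (cases "k = l") (auto intro!: cholo_add cholo_mult cholo_divide cholo_const dG)
  thus ?thesis unfolding det_def by (intro cholo_sum cholo_mult cholo_const cholo_prod)
qed

lemma mean_linear:
  fixes u v :: "'a::{real_field,euclidean_space} ^ 'n"
  shows "mean (u + v) = mean u + mean v" "mean (r *\<^sub>R v) = r *\<^sub>R mean v"
  by (rule linear_add[OF bounded_linear.linear[OF bounded_linear_mean]],
      rule linear_scale[OF bounded_linear.linear[OF bounded_linear_mean]])

lemma linear_DF: "linear (DF x)"
  by (rule linearI) (simp_all add: DF_def vec_eq_iff mean_linear algebra_simps)

lemma linear_DFc: "linear (DFc z)"
  by (rule linearI) (simp_all add: DFc_def vec_eq_iff mean_linear algebra_simps)

lemma Blinfun_DFc: "blinfun_apply (Blinfun (DFc z)) = DFc z"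
  by (rule bounded_linear_Blinfun_apply[OF linear_conv_bounded_linear[THEN iffD1, OF linear_DFc]])

lemma DFc_scale: "DFc z (c *s v) = c *s DFc z v"
  by (simp add: DFc_def vec_eq_iff mean_def algebra_simps flip: sum_distrib_left)

text \<open>At real points the entries are real, and the expansion estimate makes the derivative
  injective, so the determinant cannot vanish.\<close>

lemma jacobian_cvec:
  fixes x :: "real ^ 'n"
  assumes x: "x \<in> cube"
  shows "norm (det (jacobian (cvec x))) = jac (DF x)" "Im (det (jacobian (cvec x))) = 0" "jac (DF x) > 0"
proof -
  let ?f = "\<lambda>y :: real ^ 'n idx. reidx enum_idx (DF x (reidx (inv enum_idx) y))"
  have b: "bij (enum_idx :: 'n idx \<Rightarrow> 'n)" by (rule bij_enum_idx)
  have ax: "reidx (inv enum_idx) (axis l (1::real)) = axis (enum_idx l) 1" for l :: "'n idx"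
    using b by (auto simp: vec_eq_iff axis_def bij_inv_eq_iff bij_is_inj inv_f_f)
  have mean_axis: "mean (axis j (1::real)) = 1 / real CARD('n)" for j :: 'n
    by (simp add: mean_def axis_def)
  have eq: "enum_idx k = enum_idx l \<longleftrightarrow> k = l" for k l :: "'n idx"
    using b by (simp add: bij_is_inj inj_eq)
  have entry: "matrix ?f $ k $ l = (if k = l then mob_slope (G (mean x)) (x $ enum_idx k) else 0) +
      mob_tilt (G (mean x)) (x $ enum_idx k) * (G' (mean x) / real CARD('n))" for k l
    unfolding matrix_def vec_lambda_beta ax by (simp add: DF_def mean_axis) (simp add: axis_def eq)
  have "jacobian (cvec x) = (\<chi> k l. complex_of_real (matrix ?f $ k $ l))"
    unfolding entry jacobian_def
    by (simp add: vec_eq_iff mean_cvec Gc_real dGc_real mean_cube[OF x] mob_slope_def mob_tilt_def)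
  hence d: "det (jacobian (cvec x)) = of_real (det (matrix ?f))" by (simp add: det_of_real)
  show "norm (det (jacobian (cvec x))) = jac (DF x)" unfolding d jac_def by simp
  show "Im (det (jacobian (cvec x))) = 0" unfolding d by simp
  have lin: "linear ?f"
    using linear_compose[OF linear_compose[OF linear_reidx linear_DF] linear_reidx] by (simp add: o_def)
  have "inj ?f"
    unfolding linear_injective_0[OF lin]
  proof (intro allI impI)
    fix y assume "?f y = 0"
    hence "reidx (inv enum_idx) (reidx enum_idx (DF x (reidx (inv enum_idx) y))) = reidx (inv enum_idx) 0" by simp
    hence "DF x (reidx (inv enum_idx) y) = 0"
      using b by (simp add: vec_eq_iff)
    hence "DFc (cvec x) (cvec (reidx (inv enum_idx) y)) = 0"
      by (simp add: DFc_cvec[OF x] vec_eq_iff)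
    hence "reidx (inv enum_idx) y = 0"
      using DFc_expansion[OF x, of "cvec (reidx (inv enum_idx) y)"] by simp
    hence "reidx enum_idx (reidx (inv enum_idx) y) = reidx enum_idx 0" by simp
    thus "y = 0" using b by (simp add: vec_eq_iff)
  qed
  thus "jac (DF x) > 0" unfolding jac_def using det_nz_iff_inj[OF lin] by simp
qed

definition reg :: "(complex ^ 'n) set" where
  "reg = {z \<in> dom. det (jacobian z) \<noteq> 0}"

lemma continuous_on_det: "continuous_on dom (\<lambda>z. det (jacobian z))"
  using dom_cholo cholo_imp_continuous by (blast intro: continuous_at_imp_continuous_on)

lemma open_reg: "open (reg :: (complex ^ 'n) set)"
  using continuous_open_preimage[OF continuous_on_det open_dom, of "- {0}"]
  by (simp add: reg_def Int_def vimage_def open_Compl)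

lemma cvec_reg: "cvec ` cube \<subseteq> reg"
  using cvec_dom jacobian_cvec(1,3) by (force simp: reg_def)

text \<open>A continuous real function without zeros on the connected cube. Multiplying by the sign
  \<sigma> replaces taking the modulus, and so the reciprocal of \<open>jac\<close> acquires a
  holomorphic extension.\<close>

lemma det_sign: "\<exists>\<sigma>\<in>{1, -1}. \<forall>x\<in>(cube :: (real ^ 'n) set). Re (det (jacobian (cvec x))) = \<sigma> * jac (DF x)"
proof -
  let ?g = "\<lambda>x :: real ^ 'n. Re (det (jacobian (cvec x)))"
  have abs: "\<bar>?g x\<bar> = jac (DF x)" if "x \<in> cube" for x
    using jacobian_cvec(1,2)[OF that] by (simp add: cmod_eq_Re)
  have nz: "?g x \<noteq> 0" if "x \<in> cube" for x using abs[OF that] jacobian_cvec(3)[OF that] by auto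
  have "continuous_on cube ?g"
    by (intro continuous_intros continuous_on_compose2[OF continuous_on_det linear_continuous_on[OF bounded_linear_cvec]])
       (use cvec_dom in auto)
  hence conn: "connected (?g ` cube)"
    by (intro connected_continuous_image convex_connected convex_cube)
  show ?thesis
  proof (cases "\<exists>x\<in>(cube :: (real ^ 'n) set). ?g x > 0")
    case True
    then obtain x where x: "x \<in> cube" "?g x > 0" by blast
    have "?g y > 0" if y: "y \<in> cube" for y
    proof (rule ccontr)
      assume "\<not> ?g y > 0"
      hence "0 \<in> {?g y..?g x}" using x by simp
      hence "0 \<in> ?g ` cube" using connected_contains_Icc[OF conn] x y by blast
      thus False using nz by auto
    qed
    hence "?g y = 1 * jac (DF y)" if "y \<in> cube" for y using abs[OF that] that by fastforce
    thus ?thesis by blast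
  next
    case False
    hence "?g y = -1 * jac (DF y)" if "y \<in> cube" for y using abs[OF that] that by fastforce
    thus ?thesis by blast
  qed
qed

lemma DFc_continuous: "continuous_on dom (\<lambda>z. Blinfun (DFc z) :: (complex ^ 'n) \<Rightarrow>\<^sub>L (complex ^ 'n))"
proof (rule continuous_on_blinfun_componentwise)
  fix v :: "complex ^ 'n"
  have "continuous_on dom (\<lambda>z. DFc z v)"
    unfolding DFc_def mob_slope_def mob_tilt_def
    by (intro continuous_intros continuous_on_Gc_mean) (auto simp: dom_def)
  thus "continuous_on dom (\<lambda>z. blinfun_apply (Blinfun (DFc z)) v)" by (simp add: Blinfun_DFc)
qed

lemma DFc_diff_onorm:
  "onorm (\<lambda>v. DFc z v - DFc a v) = dist (Blinfun (DFc z)) (Blinfun (DFc a))"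
  by (simp add: dist_norm norm_blinfun.rep_eq minus_blinfun.rep_eq Blinfun_DFc)

text \<open>Nonzero determinant, injectivity and expansion hold on the compact set of real points
  and survive on a neighbourhood; for injectivity the inverse function theorem supplies the local
  part.\<close>

lemma ex_complex_nbhd:
  "\<exists>e>0. (\<Union>x\<in>cube. ball (cvec x) e) \<subseteq> (reg :: (complex ^ 'n) set) \<and>
     inj_on (Fc :: complex ^ 'n \<Rightarrow> complex ^ 'n) (\<Union>x\<in>cube. ball (cvec x) e) \<and>
     (\<forall>z\<in>(\<Union>x\<in>cube. ball (cvec x) e). \<forall>v :: complex ^ 'n. norm v \<le> 20 / 21 * norm (DFc z v))"
proof -
  let ?K = "cvec ` cube :: (complex ^ 'n) set"
  have K: "compact ?K"
    by (intro compact_continuous_image linear_continuous_on bounded_linear_cvec compact_cube)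
  \<comment> \<open>\<open>219 / 200\<close> is just below the square root of \<open>6 / 5\<close>.
    Losing \<open>1 / 25\<close> leaves \<open>211 / 200\<close>, still above
    \<open>21 / 20\<close>, the inverse of the contraction constant \<open>20 / 21\<close>.\<close>
  have low: "219 / 200 * norm v \<le> norm (DFc (cvec x) v)" if "x \<in> cube" for x and v :: "complex ^ 'n"
  proof (rule power2_le_imp_le)
    have "(219 / 200 * norm v)\<^sup>2 = 47961 / 40000 * (norm v)\<^sup>2" by (simp add: power2_eq_square)
    also have "\<dots> \<le> 6 / 5 * (norm v)\<^sup>2" by (rule mult_right_mono) auto
    also have "\<dots> \<le> (norm (DFc (cvec x) v))\<^sup>2" using DFc_expansion[OF that, of v] by linarith
    finally show "(219 / 200 * norm v)\<^sup>2 \<le> (norm (DFc (cvec x) v))\<^sup>2" .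
  qed simp
  have contD: "continuous_on reg (\<lambda>z. Blinfun (DFc z) :: (complex ^ 'n) \<Rightarrow>\<^sub>L (complex ^ 'n))"
    by (rule continuous_on_subset[OF DFc_continuous]) (auto simp: reg_def)
  obtain d1 where d1: "d1 > 0" "\<And>x z. x \<in> cube \<Longrightarrow> z \<in> ball (cvec x) d1 \<Longrightarrow>
      z \<in> reg \<and> dist (Blinfun (DFc z) :: (complex ^ 'n) \<Rightarrow>\<^sub>L (complex ^ 'n)) (Blinfun (DFc (cvec x))) < 1 / 25"
    using compact_nbhd_uniform[OF K open_reg cvec_reg contD, of "1 / 25"] by auto
  have low': "norm v \<le> 20 / 21 * norm (DFc z v)"
    if x: "x \<in> cube" and z: "z \<in> ball (cvec x) d1" for x z and v :: "complex ^ 'n"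
  proof -
    have bl: "bounded_linear (\<lambda>v. DFc z v - DFc (cvec x) v)"
      using linear_DFc by (intro bounded_linear_sub) (simp_all add: linear_conv_bounded_linear)
    have "onorm (\<lambda>v. DFc z v - DFc (cvec x) v) \<le> 1 / 25"
      unfolding DFc_diff_onorm using d1(2)[OF x z] by simp
    hence "norm (DFc z v - DFc (cvec x) v) \<le> 1 / 25 * norm v"
      using onorm[OF bl, of v] by (meson mult_right_mono norm_ge_zero order_trans)
    moreover have "norm (DFc (cvec x) v) \<le> norm (DFc z v) + norm (DFc z v - DFc (cvec x) v)"
      using norm_triangle_ineq4[of "DFc z v" "DFc z v - DFc (cvec x) v"] by simp
    ultimately have "219 / 200 * norm v \<le> norm (DFc z v) + 1 / 25 * norm v" using low[OF x, of v] by linarith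
    thus ?thesis using norm_ge_zero[of "DFc z v"] by linarith
  qed
  have contF: "continuous_on reg (Fc :: complex ^ 'n \<Rightarrow> _)"
    using Fc_has_derivative by (intro continuous_at_imp_continuous_on) (auto simp: reg_def intro: has_derivative_continuous)
  have injK: "inj_on Fc ?K"
    using F_inj by (auto simp: inj_on_def Fc_cvec)
  have loc: "\<exists>r>0. inj_on Fc (ball a r)" if a: "a \<in> ?K" for a
  proof -
    obtain x where x: "x \<in> cube" "a = cvec x" using a by blast
    have inj: "inj (DFc a)"
      unfolding linear_injective_0[OF linear_DFc]
    proof (intro allI impI)
      fix v assume "DFc a v = 0"
      thus "v = 0" using DFc_expansion[OF x(1), of v] x(2) by simp
    qed
    obtain g' where g': "linear g'" "g' \<circ> DFc a = id"
      using linear_injective_left_inverse[OF linear_DFc inj] by blast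
    have a': "a \<in> reg" using cvec_reg a by blast
    obtain r where "r > 0" "ball a r \<subseteq> reg" "inj_on Fc (ball a r)"
    proof (rule has_derivative_locally_injective[where f' = DFc, OF a' open_reg _ g'(2)])
      show "bounded_linear g'" using g'(1) by (simp add: linear_conv_bounded_linear)
      show "(Fc has_derivative DFc z) (at z)" if "z \<in> reg" for z
        using that Fc_has_derivative by (auto simp: reg_def)
      fix e :: real assume e: "e > 0"
      have "isCont (\<lambda>z. Blinfun (DFc z) :: (complex ^ 'n) \<Rightarrow>\<^sub>L (complex ^ 'n)) a"
        using continuous_on_interior[OF contD] a' by (simp only: interior_open[OF open_reg])
      from this[unfolded continuous_at_eps_delta, rule_format, OF e]
      show "\<exists>d>0. \<forall>z. dist a z < d \<longrightarrow> onorm (\<lambda>v. DFc z v - DFc a v) < e"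
        unfolding DFc_diff_onorm by (simp add: dist_commute)
    qed
    thus ?thesis by blast
  qed
  obtain d2 where d2: "d2 > 0" "(\<Union>a\<in>?K. ball a d2) \<subseteq> reg" "inj_on Fc (\<Union>a\<in>?K. ball a d2)"
    using locally_injective_nbhd[OF K open_reg cvec_reg contF injK loc] by blast
  show ?thesis
  proof (intro exI[of _ "min d1 d2"] conjI)
    have sub: "(\<Union>x\<in>cube. ball (cvec x) (min d1 d2)) \<subseteq> (\<Union>a\<in>?K. ball a d2)"
    proof (rule UN_least)
      fix x :: "real ^ 'n" assume "x \<in> cube"
      moreover have "ball (cvec x) (min d1 d2) \<subseteq> ball (cvec x) d2" by (rule subset_ball) simp
      ultimately show "ball (cvec x) (min d1 d2) \<subseteq> (\<Union>a\<in>?K. ball a d2)" by blast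
    qed
    thus "(\<Union>x\<in>cube. ball (cvec x) (min d1 d2)) \<subseteq> (reg :: (complex ^ 'n) set)" by (rule order_trans[OF _ d2(2)])
    show "inj_on Fc (\<Union>x\<in>cube. ball (cvec x :: complex ^ 'n) (min d1 d2))" by (rule inj_on_subset[OF d2(3) sub])
    show "\<forall>z\<in>(\<Union>x\<in>cube. ball (cvec x) (min d1 d2)). \<forall>v :: complex ^ 'n. norm v \<le> 20 / 21 * norm (DFc z v)"
    proof (intro ballI allI)
      fix z v :: "complex ^ 'n" assume "z \<in> (\<Union>x\<in>cube. ball (cvec x) (min d1 d2))"
      then obtain x where "x \<in> cube" "z \<in> ball (cvec x) d1" by auto
      thus "norm v \<le> 20 / 21 * norm (DFc z v)" by (rule low')
    qed
  qed (use d1 d2 in auto)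
qed

definition shift_vec :: "'n set \<Rightarrow> real ^ 'n" where
  "shift_vec s = (\<chi> i. if i \<in> s then 1 else 0)"

lemma shift_image_box: "x \<in> cube \<Longrightarrow> x + shift_vec s \<in> image_box"
  unfolding image_box_def
proof (intro CollectI allI)
  fix i assume "x \<in> cube"
  hence "- 1 / 2 \<le> x $ i" "x $ i \<le> 1 / 2" using cubeD[of x i] by (simp_all add: abs_le_iff)
  thus "- 1 / 2 \<le> (x + shift_vec s) $ i \<and> (x + shift_vec s) $ i \<le> 3 / 2"
    by (cases "i \<in> s") (simp_all add: shift_vec_def)
qed

lemma compact_image_box: "compact (image_box :: (real ^ 'n) set)"
proof -
  have "(image_box :: (real ^ 'n) set) = cbox (\<chi> i. - 1 / 2) (\<chi> i. 3 / 2)"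
    by (auto simp: image_box_def mem_box_cart)
  thus ?thesis by (metis compact_cbox)
qed

text \<open>All branches are translates of one inverse of the lift, so a single \<open>Psi\<close>
  near the image box suffices. The image of the complex neighbourhood is open by invariance of
  domain, and the radius \<open>d\<close> is uniform by compactness.\<close>

lemma ex_complex_inverse:
  "\<exists>d>0. \<exists>Psi :: complex ^ 'n \<Rightarrow> complex ^ 'n.
     (\<forall>x\<in>cube. Psi (cvec (F x)) = cvec x) \<and>
     (\<forall>y\<in>image_box. \<forall>z\<in>ball (cvec y) d. Psi z \<in> reg \<and> (\<exists>g'. (Psi has_derivative g') (at z) \<and>
        onorm g' \<le> 20 / 21 \<and> (\<forall>c v. g' (c *s v) = c *s g' v)))"
proof -
  obtain e where e: "e > 0" and sub: "(\<Union>x\<in>cube. ball (cvec x) e) \<subseteq> (reg :: (complex ^ 'n) set)"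
    and inj: "inj_on Fc (\<Union>x\<in>cube. ball (cvec x :: complex ^ 'n) e)"
    and exp: "\<And>z v :: complex ^ 'n. z \<in> (\<Union>x\<in>cube. ball (cvec x) e) \<Longrightarrow> norm v \<le> 20 / 21 * norm (DFc z v)"
    using ex_complex_nbhd by blast
  define W where "W = (\<Union>x\<in>cube. ball (cvec x :: complex ^ 'n) e)"
  have W: "open W" "W \<subseteq> reg" "inj_on Fc W" using sub inj by (auto simp: W_def)
  have derF: "(Fc has_derivative DFc z) (at z)" if "z \<in> W" for z
    using that W(2) Fc_has_derivative by (auto simp: reg_def)
  have contF: "continuous_on W Fc"
    using derF by (intro continuous_at_imp_continuous_on) (auto intro: has_derivative_continuous)
  have V: "open (Fc ` W)" by (rule invariance_of_domain[OF contF W(1,3)])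
  define Psi where "Psi = the_inv_into W Fc"
  have Psi: "Psi (Fc z) = z" if "z \<in> W" for z
    unfolding Psi_def by (rule the_inv_into_f_f[OF W(3) that])
  have cW: "cvec x \<in> W" if "x \<in> cube" for x using that e unfolding W_def by (intro UN_I[of x]) auto
  have der: "\<exists>g'. (Psi has_derivative g') (at (Fc z)) \<and> onorm g' \<le> 20 / 21 \<and> (\<forall>c v. g' (c *s v) = c *s g' v)"
    if z: "z \<in> W" for z
  proof -
    have ex: "norm v \<le> 20 / 21 * norm (DFc z v)" for v using exp z unfolding W_def by blast
    have inj: "inj (DFc z)"
      unfolding linear_injective_0[OF linear_DFc]
    proof (intro allI impI)
      fix v assume "DFc z v = 0"
      thus "v = 0" using ex[of v] by simp
    qed
    obtain g' where g': "linear g'" "DFc z \<circ> g' = id"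
      using linear_surjective_right_inverse[OF linear_DFc linear_injective_imp_surjective[OF linear_DFc inj]] by blast
    have g'_inv: "DFc z (g' v) = v" for v using fun_cong[OF g'(2), of v] by simp
    have "(Psi has_derivative g') (at (Fc z))"
      by (rule has_derivative_inverse_strong[OF W(1) z contF Psi derF[OF z] g'(2)])
    moreover have "onorm g' \<le> 20 / 21"
      by (rule onorm_le) (use ex[of "g' _"] g'_inv in simp)
    \<comment> \<open>\<open>DFc z\<close> is complex linear and injective, so its inverse inherits
      complex linearity.\<close>
    moreover have "g' (c *s v) = c *s g' v" for c v
      by (rule injD[OF inj]) (simp add: DFc_scale g'_inv)
    ultimately show ?thesis by blast
  qed
  have im: "cvec ` image_box \<subseteq> Fc ` W"
    unfolding F_image[symmetric] using cW by (force simp: Fc_cvec[symmetric])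
  have comp: "compact (cvec ` (image_box :: (real ^ 'n) set))"
    by (intro compact_continuous_image linear_continuous_on bounded_linear_cvec compact_image_box)
  obtain d where d: "d > 0" "\<forall>y\<in>cvec ` image_box. \<forall>z\<in>ball y d. z \<in> Fc ` W \<and> dist z y < 1"
    using compact_nbhd_uniform[OF comp V im continuous_on_id, of 1] by auto
  show ?thesis
  proof (rule exI[of _ d], intro conjI d(1), rule exI[of _ Psi], intro conjI ballI)
    show "Psi (cvec (F x)) = cvec x" if "x \<in> cube" for x
      using Psi[OF cW[OF that]] by (simp add: Fc_cvec[OF that])
    fix y :: "real ^ 'n" and z assume "y \<in> image_box" "z \<in> ball (cvec y) d"
    then obtain w where w: "w \<in> W" "z = Fc w" using d(2) by blast
    show "Psi z \<in> reg" using Psi[OF w(1)] w W(2) by auto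
    show "\<exists>g'. (Psi has_derivative g') (at z) \<and> onorm g' \<le> 20 / 21 \<and> (\<forall>c v. g' (c *s v) = c *s g' v)"
      using der[OF w(1)] w(2) by simp
  qed
qed

end

section \<open>Analyticity of the invariant density\<close>

lemma polydisc_subset_ball:
  fixes a :: "complex ^ 'n"
  assumes "R > 0"
  shows "polydisc a (R / real CARD('n)) \<subseteq> ball a R"
proof
  fix z assume z: "z \<in> polydisc a (R / real CARD('n))"
  have "norm (a - z) \<le> (\<Sum>i\<in>UNIV. norm ((a - z) $ i))"
    unfolding norm_vec_def by (rule L2_set_le_sum) simp
  also have "\<dots> < (\<Sum>i\<in>(UNIV :: 'n set). R / real CARD('n))"
    using z by (intro sum_strict_mono) (auto simp: polydisc_def dist_norm)
  finally show "z \<in> ball a R" by (simp add: dist_norm)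
qed

text \<open>Relative errors \<open>exp p - 1\<close> and \<open>exp r - 1\<close> combine under
  products by adding the exponents, as if the factors were multiplied by \<open>exp p\<close> and
  \<open>exp r\<close>.\<close>

lemma norm_mult_diff_le:
  fixes a q :: complex and a0 q0 p r :: real
  assumes "norm (a - of_real a0) \<le> (exp p - 1) * a0" "norm (q - of_real q0) \<le> (exp r - 1) * q0"
    and "0 \<le> a0" "0 \<le> q0" "0 \<le> p" "0 \<le> r"
  shows "norm (a * q - of_real (a0 * q0)) \<le> (exp (p + r) - 1) * (a0 * q0)"
proof -
  have "norm q \<le> norm (of_real q0 :: complex) + norm (q - of_real q0)"
    using norm_triangle_sub by blast
  hence q: "norm q \<le> exp r * q0" using assms by (simp add: algebra_simps)
  have "a * q - of_real (a0 * q0) = (a - of_real a0) * q + of_real a0 * (q - of_real q0)"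
    by (simp add: algebra_simps)
  hence "norm (a * q - of_real (a0 * q0)) \<le> norm (a - of_real a0) * norm q + a0 * norm (q - of_real q0)"
    using norm_triangle_ineq[of "(a - of_real a0) * q" "of_real a0 * (q - of_real q0)"] assms(3)
    by (simp add: norm_mult)
  also have "\<dots> \<le> ((exp p - 1) * a0) * (exp r * q0) + a0 * ((exp r - 1) * q0)"
    using assms q by (intro add_mono mult_mono mult_left_mono) auto
  also have "\<dots> = (exp (p + r) - 1) * (a0 * q0)" by (simp add: exp_add algebra_simps)
  finally show ?thesis .
qed

text \<open>Closeness of the weights is relative, so it survives multiplication along orbits.
  Contraction towards the real branch maps each ball around a real point into the ball around its
  image, hence one radius \<open>d\<close> serves all iterates.\<close>

locale holo_branch_system = branch_system X S \<psi> J l C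
  for X :: "(real ^ 'n) set" and S :: "'s set" and \<psi> J l C +
  fixes \<psi>c :: "'s \<Rightarrow> complex ^ 'n \<Rightarrow> complex ^ 'n" and Jc :: "'s \<Rightarrow> complex ^ 'n \<Rightarrow> complex"
    and d B0 :: real
  assumes d: "0 < d" and B0: "0 \<le> B0"
    and \<psi>c_contr: "\<And>s x z. s \<in> S \<Longrightarrow> x \<in> X \<Longrightarrow> z \<in> ball (cvec x) d \<Longrightarrow>
      dist (\<psi>c s z) (cvec (\<psi> s x)) \<le> l * dist z (cvec x)"
    and Jc_dist: "\<And>s x z. s \<in> S \<Longrightarrow> x \<in> X \<Longrightarrow> z \<in> ball (cvec x) d \<Longrightarrow>
      norm (Jc s z - of_real (J s x)) \<le> (exp (B0 * dist z (cvec x)) - 1) * J s x"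
    and \<psi>c_holo: "\<And>s x z. s \<in> S \<Longrightarrow> x \<in> X \<Longrightarrow> z \<in> ball (cvec x) d \<Longrightarrow> vholo (\<psi>c s) z"
    and Jc_holo: "\<And>s x z. s \<in> S \<Longrightarrow> x \<in> X \<Longrightarrow> z \<in> ball (cvec x) d \<Longrightarrow> cholo (Jc s) z"
begin

definition ctransfer :: "(complex ^ 'n \<Rightarrow> complex) \<Rightarrow> complex ^ 'n \<Rightarrow> complex" where
  "ctransfer u z = (\<Sum>s\<in>S. Jc s z * u (\<psi>c s z))"

abbreviation "P n \<equiv> (transfer ^^ n) (\<lambda>_. 1)"
abbreviation "Q n \<equiv> (ctransfer ^^ n) (\<lambda>_. 1)"

text \<open>The fixed point of \<open>b = B0 + b * l\<close>, that is, the sum of the distortions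
  \<open>B0 * l ^ k\<close> along an orbit.\<close>

definition Bd :: real where "Bd = B0 / (1 - l)"
definition E :: real where "E = exp (aper 1 * D powr 1)"
definition nbd :: "(complex ^ 'n) set" where "nbd = (\<Union>x\<in>X. ball (cvec x) d)"

lemma Bd: "0 \<le> Bd" "B0 + Bd * l = Bd"
  using B0 l by (auto simp: Bd_def field_simps)

lemma \<psi>c_in:
  assumes "s \<in> S" "x \<in> X" "z \<in> ball (cvec x) d"
  shows "\<psi>c s z \<in> ball (cvec (\<psi> s x)) d"
proof -
  have "l * dist z (cvec x) \<le> 1 * dist z (cvec x)" using l by (intro mult_right_mono) auto
  with \<psi>c_contr[OF assms] assms(3) show ?thesis by (simp add: dist_commute)
qed

lemma P_pos: "x \<in> X \<Longrightarrow> 0 \<le> P n x"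
proof (induction n arbitrary: x)
  case (Suc n)
  thus ?case unfolding funpow.simps o_def transfer_def[of "P n"]
    using J_pos \<psi>_in by (intro sum_nonneg mult_nonneg_nonneg) (auto intro: less_imp_le)
qed simp

lemma P_le: "x \<in> X \<Longrightarrow> P n x \<le> E"
proof -
  assume x: "x \<in> X"
  have a: "1 \<le> aper 1" using aper[of 1 "aper 1"] by simp
  have "cone 1 (aper 1) (P n)" using a by (intro iter_cone cone_1) auto
  from cone_Int(2)[OF this _ _ _ x] a have "P n x \<le> E * Leb (P n)" by (simp add: E_def)
  thus ?thesis by (simp add: Int_iter Int_const)
qed

text \<open>Induction on \<open>n\<close>: the new weight contributes \<open>B0 * t\<close>, the old
  iterate \<open>Bd * l * t\<close> because the point has moved closer to the real set, and together
  this is \<open>Bd * t\<close>.\<close>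

lemma Q_dist:
  "x \<in> X \<Longrightarrow> z \<in> ball (cvec x) d \<Longrightarrow>
     norm (Q n z - of_real (P n x)) \<le> (exp (Bd * dist z (cvec x)) - 1) * P n x"
proof (induction n arbitrary: x z)
  case 0
  thus ?case using Bd(1) by simp
next
  case (Suc n)
  let ?t = "dist z (cvec x)"
  have trm: "norm (Jc s z * Q n (\<psi>c s z) - of_real (J s x * P n (\<psi> s x)))
     \<le> (exp (Bd * ?t) - 1) * (J s x * P n (\<psi> s x))" if s: "s \<in> S" for s
  proof -
    let ?r = "dist (\<psi>c s z) (cvec (\<psi> s x))"
    have Pp: "0 \<le> P n (\<psi> s x)" "0 < J s x" using P_pos \<psi>_in J_pos s Suc.prems by auto
    have "norm (Jc s z * Q n (\<psi>c s z) - of_real (J s x * P n (\<psi> s x)))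
       \<le> (exp (B0 * ?t + Bd * ?r) - 1) * (J s x * P n (\<psi> s x))"
      using Pp B0 Bd(1) Suc.prems s
      by (intro norm_mult_diff_le Jc_dist Suc.IH \<psi>_in \<psi>c_in) auto
    also have "B0 * ?t + Bd * ?r \<le> B0 * ?t + Bd * (l * ?t)"
      using \<psi>c_contr[OF s Suc.prems] Bd(1) by (intro add_left_mono mult_left_mono)
    also have "\<dots> = (B0 + Bd * l) * ?t" by (simp add: algebra_simps)
    also have "\<dots> = Bd * ?t" by (simp only: Bd(2))
    finally show ?thesis using Pp by (simp add: mult_right_mono)
  qed
  have "Q (Suc n) z - of_real (P (Suc n) x) =
      (\<Sum>s\<in>S. Jc s z * Q n (\<psi>c s z) - of_real (J s x * P n (\<psi> s x)))"
    by (simp add: ctransfer_def[of "Q n"] transfer_def[of "P n"] sum_subtractf)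
  also have "norm \<dots> \<le> (\<Sum>s\<in>S. (exp (Bd * ?t) - 1) * (J s x * P n (\<psi> s x)))"
    by (rule sum_norm_le[OF trm])
  also have "\<dots> = (exp (Bd * ?t) - 1) * P (Suc n) x"
    by (simp add: transfer_def[of "P n"] sum_distrib_left)
  finally show ?case .
qed

text \<open>Each step brings the argument closer to the real set by the factor \<open>l\<close>.
  Thus, up to a common factor, the part of the bound that vanishes on the real set decays like
  \<open>l ^ n\<close>, while \<alpha> is carried along unchanged.\<close>

lemma ctransfer_iter_bound:
  assumes u: "\<And>x z. x \<in> X \<Longrightarrow> z \<in> ball (cvec x) d \<Longrightarrow> norm (u z) \<le> \<alpha> + \<beta> * dist z (cvec x)"
    and ab: "0 \<le> \<alpha>" "0 \<le> \<beta>"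
  shows "x \<in> X \<Longrightarrow> z \<in> ball (cvec x) d \<Longrightarrow>
    norm ((ctransfer ^^ n) u z) \<le> (\<alpha> + \<beta> * l ^ n * dist z (cvec x)) * exp (Bd * dist z (cvec x)) * P n x"
proof (induction n arbitrary: x z)
  case 0
  have "\<alpha> + \<beta> * dist z (cvec x) \<le> (\<alpha> + \<beta> * dist z (cvec x)) * exp (Bd * dist z (cvec x))"
    using mult_left_mono[of 1 "exp (Bd * dist z (cvec x))" "\<alpha> + \<beta> * dist z (cvec x)"] ab Bd(1) by simp
  thus ?case using u[OF 0] by simp
next
  case (Suc n)
  let ?t = "dist z (cvec x)"
  let ?K = "(\<alpha> + \<beta> * l ^ Suc n * ?t) * exp (Bd * ?t)"
  have trm: "norm (Jc s z * (ctransfer ^^ n) u (\<psi>c s z)) \<le> ?K * (J s x * P n (\<psi> s x))" if s: "s \<in> S" for s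
  proof -
    let ?r = "dist (\<psi>c s z) (cvec (\<psi> s x))"
    have Pp: "0 \<le> P n (\<psi> s x)" "0 < J s x" using P_pos \<psi>_in J_pos s Suc.prems by auto
    have r: "?r \<le> l * ?t" by (rule \<psi>c_contr[OF s Suc.prems])
    have "norm (Jc s z) \<le> norm (of_real (J s x) :: complex) + norm (Jc s z - of_real (J s x))"
      using norm_triangle_sub by blast
    hence j: "norm (Jc s z) \<le> exp (B0 * ?t) * J s x"
      using Jc_dist[OF s Suc.prems] Pp by (simp add: algebra_simps)
    have "norm ((ctransfer ^^ n) u (\<psi>c s z)) \<le> (\<alpha> + \<beta> * l ^ n * ?r) * exp (Bd * ?r) * P n (\<psi> s x)"
      by (rule Suc.IH[OF \<psi>_in[OF s Suc.prems(1)] \<psi>c_in[OF s Suc.prems]])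
    also have "\<dots> \<le> (\<alpha> + \<beta> * l ^ n * (l * ?t)) * exp (Bd * (l * ?t)) * P n (\<psi> s x)"
      using r ab Bd(1) l Pp
      by (intro mult_right_mono mult_mono add_left_mono mult_left_mono) (auto intro!: mult_left_mono)
    finally have k: "norm ((ctransfer ^^ n) u (\<psi>c s z)) \<le>
        (\<alpha> + \<beta> * l ^ Suc n * ?t) * exp (Bd * l * ?t) * P n (\<psi> s x)" by (simp add: mult_ac)
    have "norm (Jc s z * (ctransfer ^^ n) u (\<psi>c s z)) \<le>
       (exp (B0 * ?t) * J s x) * ((\<alpha> + \<beta> * l ^ Suc n * ?t) * exp (Bd * l * ?t) * P n (\<psi> s x))"
      unfolding norm_mult using j k Pp by (intro mult_mono) auto
    also have "\<dots> = (\<alpha> + \<beta> * l ^ Suc n * ?t) * (exp (B0 * ?t) * exp (Bd * l * ?t)) * (J s x * P n (\<psi> s x))"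
      by (simp only: mult_ac)
    also have "exp (B0 * ?t) * exp (Bd * l * ?t) = exp ((B0 + Bd * l) * ?t)"
      by (simp add: distrib_right exp_add)
    finally show ?thesis by (simp only: Bd(2))
  qed
  have "(ctransfer ^^ Suc n) u z = (\<Sum>s\<in>S. Jc s z * (ctransfer ^^ n) u (\<psi>c s z))"
    by (simp add: ctransfer_def[of "(ctransfer ^^ n) u"])
  also have "norm \<dots> \<le> (\<Sum>s\<in>S. ?K * (J s x * P n (\<psi> s x)))"
    by (rule sum_norm_le[OF trm])
  also have "\<dots> = ?K * P (Suc n) x"
    by (simp add: transfer_def[of "P n"] sum_distrib_left)
  finally show ?case .
qed

lemma ctransfer_iter_diff:
  "(ctransfer ^^ n) (\<lambda>z. u z - v z) = (\<lambda>z. (ctransfer ^^ n) u z - (ctransfer ^^ n) v z)"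
proof (induction n)
  case (Suc n)
  have "ctransfer (\<lambda>z. f z - g z) = (\<lambda>z. ctransfer f z - ctransfer g z)" for f g
    by (simp add: fun_eq_iff ctransfer_def algebra_simps sum_subtractf)
  thus ?case using Suc by simp
qed simp

lemma exp_minus_one_le: "0 \<le> t \<Longrightarrow> t \<le> M \<Longrightarrow> exp t - 1 \<le> t * exp (M :: real)"
proof -
  assume t: "0 \<le> t" "t \<le> M"
  have "1 - t \<le> exp (- t)" using exp_ge_add_one_self[of "- t"] by simp
  hence "exp t * (1 - t) \<le> exp t * exp (- t)" by (intro mult_left_mono) auto
  hence "exp t - 1 \<le> t * exp t" by (simp add: algebra_simps flip: exp_add)
  also have "\<dots> \<le> t * exp M" using t by (intro mult_left_mono) auto
  finally show ?thesis .
qed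

text \<open>The functions \<open>Q k\<close> are close to each other on the real set and uniformly Lipschitz; applying the
  contracting operator \<open>ctransfer\<close> many times to their differences leaves only the real discrepancy.\<close>

lemma Q_uniformly_Cauchy: "uniformly_Cauchy_on nbd Q"
proof -
  define A where "A = exp (aper 1 * D)"
  define r where "r = 1 - eta 1 (aper 1)"
  \<comment> \<open>Twice the bound of \<open>Q_dist\<close>, linearised by
    \<open>exp_minus_one_le\<close> and with the real iterate estimated by \<open>E\<close>.\<close>
  define \<beta> where "\<beta> = 2 * E * Bd * exp (Bd * d)"
  define bnd where "bnd n = (2 * A * r ^ n + \<beta> * l ^ n * d) * exp (Bd * d) * E" for n
  have r: "0 \<le> r" "r < 1" using eta[of 1 "aper 1"] aper[of 1 "aper 1"] by (auto simp: r_def)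
  have E: "E > 0" and A: "A > 0" by (simp_all add: E_def A_def)
  have \<beta>: "0 \<le> \<beta>" using Bd(1) E by (simp add: \<beta>_def)
  \<comment> \<open>The difference is \<open>ctransfer ^^ n\<close> applied to
    \<open>Q k - Q m\<close>. As \<open>k\<close> and \<open>m\<close> are at least
    \<open>n\<close>, the real discrepancy of these two is already of order
    \<open>r ^ n\<close>.\<close>
  have est: "norm (Q (n + k) z - Q (n + m) z) \<le> bnd n" if z: "z \<in> nbd" and km: "n \<le> k" "n \<le> m" for n k m z
  proof -
    obtain x where x: "x \<in> X" "z \<in> ball (cvec x) d" using z by (auto simp: nbd_def)
    let ?t = "dist z (cvec x)"
    have u: "norm (Q k z - Q m z) \<le> 2 * A * r ^ n + \<beta> * dist z (cvec x)"
      if x: "x \<in> X" "z \<in> ball (cvec x) d" for x z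
    proof -
      let ?t = "dist z (cvec x)"
      have t: "0 \<le> Bd * ?t" "Bd * ?t \<le> Bd * d" using x Bd(1) by (auto simp: dist_commute intro: mult_left_mono)
      have e: "exp (Bd * ?t) - 1 \<le> Bd * ?t * exp (Bd * d)" by (rule exp_minus_one_le[OF t])
      have q: "norm (Q j z - of_real (P j x)) \<le> Bd * ?t * exp (Bd * d) * E" for j
      proof -
        have "norm (Q j z - of_real (P j x)) \<le> (exp (Bd * ?t) - 1) * P j x" by (rule Q_dist[OF x])
        also have "\<dots> \<le> (Bd * ?t * exp (Bd * d)) * E"
          using e P_le[OF x(1)] P_pos[OF x(1)] t by (intro mult_mono) auto
        finally show ?thesis .
      qed
      have p: "\<bar>P j x - density_fun x\<bar> \<le> A * r ^ n" if "n \<le> j" for j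
      proof -
        have "r ^ j \<le> r ^ n" using that r by (intro power_decreasing) auto
        hence "A * r ^ j \<le> A * r ^ n" using A by simp
        thus ?thesis by (rule order_trans[OF density_fun_rate(1)[OF x(1), of j, folded A_def r_def]])
      qed
      have "norm (of_real (P k x) - of_real (P m x) :: complex) \<le> 2 * A * r ^ n"
        using p[OF km(1)] p[OF km(2)] by (simp flip: of_real_diff) 
      moreover have "Q k z - Q m z = (Q k z - of_real (P k x)) - (Q m z - of_real (P m x)) + (of_real (P k x) - of_real (P m x))"
        by simp
      ultimately have "norm (Q k z - Q m z) \<le> 2 * A * r ^ n + 2 * (Bd * ?t * exp (Bd * d) * E)"
        using q[of k] q[of m] norm_triangle_ineq norm_triangle_ineq4
        by (smt (verit))
      thus ?thesis by (simp add: \<beta>_def mult_ac)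
    qed
    have "norm ((ctransfer ^^ n) (\<lambda>z. Q k z - Q m z) z) \<le>
        (2 * A * r ^ n + \<beta> * l ^ n * ?t) * exp (Bd * ?t) * P n x"
      using A r \<beta> by (intro ctransfer_iter_bound[OF u] x) auto
    also have "\<dots> \<le> bnd n"
      unfolding bnd_def using x A r \<beta> l Bd(1) P_le[OF x(1)] P_pos[OF x(1)] less_imp_le[OF d]
      by (intro mult_mono add_left_mono mult_left_mono) (auto simp: dist_commute intro!: mult_left_mono add_nonneg_nonneg mult_nonneg_nonneg)
    finally show ?thesis by (simp add: ctransfer_iter_diff funpow_add)
  qed
  have "bnd \<longlonglongrightarrow> (2 * A * 0 + \<beta> * 0 * d) * exp (Bd * d) * E"
    unfolding bnd_def using r l by (intro tendsto_intros LIMSEQ_power_zero) auto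
  hence lim: "bnd \<longlonglongrightarrow> 0" by simp
  show ?thesis unfolding uniformly_Cauchy_on_def
  proof (intro allI impI)
    fix e :: real assume "e > 0"
    then obtain N where N: "bnd N < e"
      using order_tendstoD(2)[OF lim] by (auto simp: eventually_sequentially)
    show "\<exists>M. \<forall>x\<in>nbd. \<forall>m\<ge>M. \<forall>n\<ge>M. dist (Q m x) (Q n x) < e"
    \<comment> \<open>From \<open>2 * N\<close> on, \<open>N\<close> steps can be split off and at
      least \<open>N\<close> remain.\<close>
    proof (intro exI[of _ "2 * N"] ballI allI impI)
      fix z m n assume z: "z \<in> nbd" and mn: "2 * N \<le> m" "2 * N \<le> n"
      have "norm (Q (N + (m - N)) z - Q (N + (n - N)) z) \<le> bnd N"
        using mn by (intro est z) auto
      thus "dist (Q m z) (Q n z) < e" using N mn by (simp add: dist_norm)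
    qed
  qed
qed

lemma Q_cholo: "z \<in> nbd \<Longrightarrow> cholo (Q n) z"
proof (induction n arbitrary: z)
  case 0
  thus ?case by (simp add: cholo_const)
next
  case (Suc n)
  then obtain x where x: "x \<in> X" "z \<in> ball (cvec x) d" by (auto simp: nbd_def)
  have "cholo (\<lambda>z. \<Sum>s\<in>S. Jc s z * Q n (\<psi>c s z)) z"
  proof (intro cholo_sum cholo_mult)
    fix s assume s: "s \<in> S"
    show "cholo (Jc s) z" by (rule Jc_holo[OF s x])
    have "\<psi>c s z \<in> nbd" using \<psi>c_in[OF s x] \<psi>_in[OF s x(1)] by (auto simp: nbd_def)
    from cholo_vcompose[OF \<psi>c_holo[OF s x] Suc.IH[OF this]]
    show "cholo (\<lambda>z. Q n (\<psi>c s z)) z" .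
  qed
  moreover have "Q (Suc n) = (\<lambda>z. \<Sum>s\<in>S. Jc s z * Q n (\<psi>c s z))"
    by (simp add: fun_eq_iff ctransfer_def[of "Q n"])
  ultimately show ?case by simp
qed

lemma Q_bound: "z \<in> nbd \<Longrightarrow> norm (Q n z) \<le> exp (Bd * d) * E"
proof -
  assume "z \<in> nbd"
  then obtain x where x: "x \<in> X" "z \<in> ball (cvec x) d" by (auto simp: nbd_def)
  have "norm (Q n z) \<le> norm (of_real (P n x) :: complex) + norm (Q n z - of_real (P n x))"
    using norm_triangle_sub by blast
  also have "\<dots> \<le> exp (Bd * dist z (cvec x)) * P n x"
    using Q_dist[OF x, of n] P_pos[OF x(1), of n] by (simp add: algebra_simps)
  also have "\<dots> \<le> exp (Bd * d) * E"
    using x Bd(1) P_le[OF x(1)] P_pos[OF x(1)]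
    by (intro mult_mono) (auto simp: dist_commute intro: mult_left_mono)
  finally show ?thesis .
qed

text \<open>The uniform limit of the \<open>Q n\<close> is bounded and separately holomorphic, so
  its real part has a power series at each real point of \<open>nbd\<close>. On \<open>X\<close> it
  is the limit of the real iterates, because the distance in \<open>Q_dist\<close> is zero
  there.\<close>

theorem density_fun_analytic: "real_analytic_on density_fun X"
proof -
  obtain q where q: "uniform_limit nbd Q q sequentially"
    using Cauchy_uniformly_convergent[OF Q_uniformly_Cauchy] by (auto simp: uniformly_convergent_on_def)
  have open_nbd: "open nbd" by (auto simp: nbd_def)
  have pw: "(\<lambda>n. Q n z) \<longlonglongrightarrow> q z" if "z \<in> nbd" for z by (rule tendsto_uniform_limitI[OF q that])
  define U where "U = {a. cvec a \<in> nbd}"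
  show ?thesis unfolding real_analytic_on_def
  proof (intro exI conjI ballI)
    show "open U"
      using open_vimage[OF open_nbd linear_continuous_on[OF bounded_linear_cvec]] by (simp add: U_def vimage_def)
    have XU: "cvec x \<in> nbd" if "x \<in> X" for x using that d unfolding nbd_def by (intro UN_I[of x]) auto
    thus "X \<subseteq> U" by (auto simp: U_def)
    show "Re (q (cvec x)) = density_fun x" if x: "x \<in> X" for x
    proof -
      have "Q n (cvec x) = of_real (P n x)" for n using Q_dist[OF x, of "cvec x" n] d by simp
      hence "(\<lambda>n. of_real (P n x)) \<longlonglongrightarrow> q (cvec x)" using pw[OF XU[OF x]] by simp
      moreover have "(\<lambda>n. complex_of_real (P n x)) \<longlonglongrightarrow> of_real (density_fun x)"
        using density_fun_rate(2)[OF x] by (rule tendsto_of_real)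
      ultimately have "q (cvec x) = of_real (density_fun x)" by (rule LIMSEQ_unique)
      thus ?thesis by simp
    qed
    fix a assume "a \<in> U"
    then obtain R where R: "R > 0" "ball (cvec a) R \<subseteq> nbd" using openE[OF open_nbd] by (auto simp: U_def)
    let ?R = "R / real CARD('n)"
    have sub: "polydisc (cvec a) ?R \<subseteq> nbd" using polydisc_subset_ball[OF R(1)] R(2) by blast
    show "has_power_series_at (\<lambda>x. Re (q (cvec x))) a"
    proof (rule has_power_series_at_Re_sep_holo)
      show "?R > 0" using R by simp
      show "sep_holo (cvec a) ?R q"
      proof (rule sep_holo_uniform_limit)
        show "sep_holo (cvec a) ?R (Q n)" for n
          using Q_cholo sub by (intro cholo_imp_sep_holo) blast
        show "uniform_limit (polydisc (cvec a) ?R) Q q sequentially"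
          by (rule uniform_limit_on_subset[OF q sub])
      qed
      show "norm (q z) \<le> exp (Bd * d) * E" if "z \<in> polydisc (cvec a) ?R" for z
        by (rule LIMSEQ_le_const2[OF tendsto_norm[OF pw]]) (use Q_bound sub that in auto)
    qed
  qed
qed

end

text \<open>The Cauchy estimate gives an absolute Lipschitz bound, and the positive minimum of
  \<open>j\<close> on the compact set makes it relative. Points at distance at least
  \<open>e\<close> are covered by the quotient of maximum and minimum.\<close>

lemma cholo_relative_lipschitz:
  fixes X :: "(real ^ 'n) set" and f :: "complex ^ 'n \<Rightarrow> complex" and j :: "real ^ 'n \<Rightarrow> real"
  assumes X: "compact X" "X \<noteq> {}" and d: "0 < d"
    and f: "\<And>x z. x \<in> X \<Longrightarrow> z \<in> ball (cvec x) d \<Longrightarrow> cholo f z"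
    and j: "\<And>x. x \<in> X \<Longrightarrow> f (cvec x) = of_real (j x)" "\<And>x. x \<in> X \<Longrightarrow> 0 < j x"
  shows "continuous_on X j \<and> (\<exists>e>0. \<exists>B\<ge>0.
    (\<forall>x\<in>X. \<forall>z\<in>ball (cvec x) e. norm (f z - of_real (j x)) \<le> (exp (B * dist z (cvec x)) - 1) * j x) \<and>
    (\<forall>x\<in>X. \<forall>y\<in>X. j x \<le> exp (B * dist x y) * j y))"
proof -
  define U where "U = (\<Union>x\<in>X. ball (cvec x) d)"
  have U: "open U" "cvec ` X \<subseteq> U" using d by (auto simp: U_def)
  have fU: "continuous_on U f"
  proof (rule continuous_at_imp_continuous_on, rule ballI)
    fix z assume "z \<in> U"
    then obtain x where "x \<in> X" "z \<in> ball (cvec x) d" by (auto simp: U_def)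
    thus "isCont f z" by (intro cholo_imp_continuous f)
  qed
  have "continuous_on X (\<lambda>x. Re (f (cvec x)))"
    using U(2) by (intro continuous_intros continuous_on_compose2[OF fU linear_continuous_on[OF bounded_linear_cvec]])
  hence jc: "continuous_on X j" by (rule continuous_on_eq) (simp add: j(1))
  obtain xm where xm: "xm \<in> X" "\<And>x. x \<in> X \<Longrightarrow> j xm \<le> j x"
    using continuous_attains_inf[OF X jc] by blast
  obtain xM where xM: "xM \<in> X" "\<And>x. x \<in> X \<Longrightarrow> j x \<le> j xM"
    using continuous_attains_sup[OF X jc] by blast
  have comp: "compact (cvec ` X)"
    by (intro compact_continuous_image linear_continuous_on bounded_linear_cvec X)
  obtain d1 where d1: "d1 > 0" "\<And>x z. x \<in> X \<Longrightarrow> z \<in> ball (cvec x) d1 \<Longrightarrow> z \<in> U \<and> dist (f z) (f (cvec x)) < 1"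
    using compact_nbhd_uniform[OF comp U fU, of 1] by auto
  \<comment> \<open>Half, because the Cauchy estimate on a ball uses a bound on the ball of twice
    the radius.\<close>
  define e where "e = d1 / 2"
  have e: "e > 0" using d1 by (simp add: e_def)
  define M where "M = j xM + 1"
  have M: "M > 0" using j(2)[OF xM(1)] by (simp add: M_def)
  have pm: "j xm > 0" by (rule j(2)[OF xm(1)])
  define B where "B = max (M / e / j xm) (j xM / j xm / e)"
  have B0: "0 \<le> B" using M e pm by (simp add: B_def le_max_iff_disj)
  have loc: "norm (f z - of_real (j x)) \<le> (exp (B * dist z (cvec x)) - 1) * j x"
    if x: "x \<in> X" and z: "z \<in> ball (cvec x) e" for x z
  proof -
    have "norm (f z - f (cvec x)) \<le> M / e * dist z (cvec x)"
    proof (rule cholo_bounded_imp_lipschitz[OF _ _ z])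
      fix w assume "w \<in> ball (cvec x) (2 * e)"
      hence w: "w \<in> ball (cvec x) d1" by (simp add: e_def)
      show "cholo f w" using d1(2)[OF x w] f by (auto simp: U_def)
      have "norm (f w) \<le> norm (f (cvec x)) + dist (f w) (f (cvec x))"
        unfolding dist_norm by (rule norm_triangle_sub)
      also have "norm (f (cvec x)) = j x" using j(1)[OF x] j(2)[OF x] by simp
      finally show "norm (f w) \<le> M" using d1(2)[OF x w] xM(2)[OF x] by (simp add: M_def)
    qed
    also have "\<dots> = (M / e / j xm * dist z (cvec x)) * j xm" using pm by simp
    also have "\<dots> \<le> (B * dist z (cvec x)) * j x"
      using B0 pm xm(2)[OF x] by (intro mult_mono mult_right_mono) (auto simp: B_def)
    also have "\<dots> \<le> (exp (B * dist z (cvec x)) - 1) * j x"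
    proof (rule mult_right_mono)
      show "B * dist z (cvec x) \<le> exp (B * dist z (cvec x)) - 1"
        using exp_ge_add_one_self[of "B * dist z (cvec x)"] by linarith
    qed (use j(2)[OF x] in simp)
    finally show ?thesis using j(1)[OF x] by simp
  qed
  have glob: "j x \<le> exp (B * dist x y) * j y" if x: "x \<in> X" and y: "y \<in> X" for x y
  proof (cases "dist x y < e")
    case True
    hence "norm (f (cvec x) - of_real (j y)) \<le> (exp (B * dist x y) - 1) * j y"
      using loc[OF y, of "cvec x"] by (simp add: dist_commute)
    hence "\<bar>j x - j y\<bar> \<le> (exp (B * dist x y) - 1) * j y" using j(1)[OF x] by (simp flip: of_real_diff)
    thus ?thesis by (simp add: left_diff_distrib)
  next
    case False
    have "j x \<le> j xM / j xm * j y"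
      using xM(2)[OF x] xm(2)[OF y] pm j(2)[OF xM(1)] by (simp add: field_simps mult_mono)
    also have "j xM / j xm = j xM / j xm / e * e" using e by simp
    also have "\<dots> \<le> B * dist x y" using False e B0 by (intro mult_mono) (auto simp: B_def)
    also have "\<dots> \<le> exp (B * dist x y)" using exp_ge_add_one_self[of "B * dist x y"] by linarith
    finally show ?thesis using j(2)[OF y] by (simp add: mult_right_mono)
  qed
  show ?thesis using jc e B0 loc glob by blast
qed

lemma vholoI: "(f has_derivative f') (at z) \<Longrightarrow> (\<And>c v. f' (c *s v) = c *s f' v) \<Longrightarrow> vholo f z"
  unfolding vholo_def by blast

section \<open>Real and complex inverse branches\<close>

context gcm
begin

text \<open>The set \<open>s\<close> consists of the coordinates that lie to the right of the break point.\<close>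

definition branch :: "'n set \<Rightarrow> real ^ 'n \<Rightarrow> real ^ 'n" where
  "branch s x = the_inv_into cube F (x + shift_vec s)"

definition branch_jac :: "'n set \<Rightarrow> real ^ 'n \<Rightarrow> real" where
  "branch_jac s x = 1 / jac (DF (branch s x))"

lemma branch:
  assumes "x \<in> (cube :: (real ^ 'n) set)"
  shows "branch s x \<in> cube" "F (branch s x) = x + shift_vec s"
proof -
  have "x + shift_vec s \<in> F ` cube" using shift_image_box[OF assms] by (simp add: F_image)
  thus "branch s x \<in> cube" "F (branch s x) = x + shift_vec s"
    unfolding branch_def using F_inj by (auto intro: the_inv_into_into f_the_inv_into_f)
qed

lemma branch_F: "x \<in> cube \<Longrightarrow> F x = y + shift_vec s \<Longrightarrow> branch s y = x"
  unfolding branch_def by (metis F_inj the_inv_into_f_f)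

lemma branch_jac_pos: "x \<in> cube \<Longrightarrow> branch_jac s x > 0"
  unfolding branch_jac_def by (intro divide_pos_pos zero_less_one jacobian_cvec(3) branch(1))

definition complex_branches :: "real \<Rightarrow> ('n::finite set \<Rightarrow> complex ^ 'n \<Rightarrow> complex ^ 'n) \<Rightarrow> bool" where
  "complex_branches d \<psi>c \<longleftrightarrow> d > 0 \<and> (\<forall>s. \<forall>x\<in>cube. \<psi>c s (cvec x) = cvec (branch s x)) \<and>
     (\<forall>s. \<forall>x\<in>cube. \<forall>z\<in>ball (cvec x) d. \<psi>c s z \<in> reg \<and> (\<exists>g'. (\<psi>c s has_derivative g') (at z) \<and>
        onorm g' \<le> 20 / 21 \<and> (\<forall>c v. g' (c *s v) = c *s g' v)))"

lemma complex_branchesD: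
  assumes "complex_branches d \<psi>c"
  shows "d > 0" "x \<in> cube \<Longrightarrow> \<psi>c s (cvec x) = cvec (branch s x)"
    "x \<in> cube \<Longrightarrow> z \<in> ball (cvec x) d \<Longrightarrow> \<psi>c s z \<in> reg"
    "x \<in> cube \<Longrightarrow> z \<in> ball (cvec x) d \<Longrightarrow> \<exists>g'. (\<psi>c s has_derivative g') (at z) \<and>
        onorm g' \<le> 20 / 21 \<and> (\<forall>c v. g' (c *s v) = c *s g' v)"
  using assms unfolding complex_branches_def by blast+

lemma ex_complex_branches: "\<exists>d \<psi>c. complex_branches d (\<psi>c :: 'n::finite set \<Rightarrow> complex ^ 'n \<Rightarrow> complex ^ 'n)"
proof -
  obtain d and Psi :: "complex ^ 'n \<Rightarrow> complex ^ 'n" where d: "d > 0"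
    and P1: "\<And>x. x \<in> cube \<Longrightarrow> Psi (cvec (F x)) = cvec x"
    and P2: "\<And>y z. y \<in> image_box \<Longrightarrow> z \<in> ball (cvec y) d \<Longrightarrow> Psi z \<in> reg \<and> (\<exists>g'. (Psi has_derivative g') (at z) \<and>
        onorm g' \<le> 20 / 21 \<and> (\<forall>c v. g' (c *s v) = c *s g' v))"
    using ex_complex_inverse by blast
  define \<psi>c where "\<psi>c s z = Psi (z + cvec (shift_vec s))" for s z
  have "\<psi>c s (cvec x) = cvec (branch s x)" if x: "x \<in> cube" for s x
    using P1[OF branch(1)[OF x], of s] by (simp add: \<psi>c_def branch(2)[OF x] cvec_add)
  moreover have "\<psi>c s z \<in> reg \<and> (\<exists>g'. (\<psi>c s has_derivative g') (at z) \<and>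
        onorm g' \<le> 20 / 21 \<and> (\<forall>c v. g' (c *s v) = c *s g' v))"
    if x: "x \<in> cube" and z: "z \<in> ball (cvec x) d" for s x z
  proof -
    have "z + cvec (shift_vec s) \<in> ball (cvec (x + shift_vec s)) d"
      using z by (simp add: cvec_add)
    from P2[OF shift_image_box[OF x] this] obtain g' where g': "Psi (z + cvec (shift_vec s)) \<in> reg"
      "(Psi has_derivative g') (at (z + cvec (shift_vec s)))" "onorm g' \<le> 20 / 21" "\<forall>c v. g' (c *s v) = c *s g' v"
      by blast
    have "((\<lambda>z. z + cvec (shift_vec s)) has_derivative (\<lambda>v. v)) (at z)" by (auto intro!: derivative_eq_intros)
    from has_derivative_compose[OF this g'(2)]
    have "(\<psi>c s has_derivative g') (at z)" by (simp add: \<psi>c_def[abs_def])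
    with g' show ?thesis unfolding \<psi>c_def[of s z] by blast
  qed
  ultimately have "complex_branches d \<psi>c" using d unfolding complex_branches_def by blast
  thus ?thesis by blast
qed

text \<open>The complex branch has derivative norm at most \<open>20 / 21\<close> on the convex set
  of real points, where it coincides with the real branch; the mean value inequality does the
  rest.\<close>

lemma branch_contr:
  assumes "x \<in> cube" "y \<in> (cube :: (real ^ 'n) set)"
  shows "dist (branch s x) (branch s y) \<le> 20 / 21 * dist x y"
proof -
  obtain d and \<psi>c :: "'n set \<Rightarrow> complex ^ 'n \<Rightarrow> complex ^ 'n" where cb: "complex_branches d \<psi>c"
    using ex_complex_branches by blast
  note d = complex_branchesD(1)[OF cb] and 1 = complex_branchesD(2)[OF cb] and 2 = complex_branchesD(4)[OF cb]
  have "\<exists>g'. (\<psi>c s has_derivative g') (at z within cvec ` cube) \<and> onorm g' \<le> 20 / 21" if z: "z \<in> cvec ` cube" for z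
  proof -
    obtain x where "x \<in> cube" "z = cvec x" using z by blast
    hence "x \<in> cube" "z \<in> ball (cvec x) d" using d by simp_all
    from 2[OF this] show ?thesis by (blast intro: has_derivative_at_withinI)
  qed
  hence "\<forall>z. \<exists>g'. z \<in> cvec ` cube \<longrightarrow> (\<psi>c s has_derivative g') (at z within cvec ` cube) \<and> onorm g' \<le> 20 / 21"
    by blast
  from choice[OF this] obtain g' where g': "\<And>z. z \<in> cvec ` cube \<Longrightarrow> (\<psi>c s has_derivative g' z) (at z within cvec ` cube)"
    "\<And>z. z \<in> cvec ` cube \<Longrightarrow> onorm (g' z) \<le> 20 / 21" by blast
  have "convex (cvec ` (cube :: (real ^ 'n) set))"
    by (intro convex_linear_image convex_cube bounded_linear.linear bounded_linear_cvec)
  from differentiable_bound[OF this g', of "cvec x" "cvec y"]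
  have "norm (\<psi>c s (cvec x) - \<psi>c s (cvec y)) \<le> 20 / 21 * norm (cvec x - cvec y)"
    using assms by simp
  thus ?thesis using assms by (simp add: 1 dist_norm flip: cvec_diff)
qed

text \<open>There are finitely many branches, so the smallest radius and the largest distortion
  constant serve all of them.\<close>

lemma ex_holo_branches:
  "\<exists>\<psi>c Jc d B. d > 0 \<and> B \<ge> 0 \<and> (\<forall>s :: 'n::finite set. continuous_on cube (branch_jac s) \<and>
     (\<forall>x\<in>cube. \<forall>y\<in>cube. branch_jac s x \<le> exp (B * dist x y) * branch_jac s y) \<and>
     (\<forall>x\<in>cube. \<forall>z\<in>ball (cvec x) d. dist (\<psi>c s z) (cvec (branch s x)) \<le> 20 / 21 * dist z (cvec x) \<and>
        norm (Jc s z - of_real (branch_jac s x)) \<le> (exp (B * dist z (cvec x)) - 1) * branch_jac s x \<and>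
        vholo (\<psi>c s) z \<and> cholo (Jc s) z))"
proof -
  obtain d and \<psi>c :: "'n set \<Rightarrow> complex ^ 'n \<Rightarrow> complex ^ 'n" where cb: "complex_branches d \<psi>c"
    using ex_complex_branches by blast
  note d = complex_branchesD(1)[OF cb] and 1 = complex_branchesD(2)[OF cb] and
    2 = complex_branchesD(3)[OF cb] and 3 = complex_branchesD(4)[OF cb]
  obtain \<sigma> where \<sigma>: "\<sigma> \<in> {1, -1 :: real}"
    "\<And>x. x \<in> (cube :: (real ^ 'n) set) \<Longrightarrow> Re (det (jacobian (cvec x))) = \<sigma> * jac (DF x)"
    using det_sign by blast
  \<comment> \<open>The sign turns the determinant into \<open>jac\<close> at real points, so
    \<open>Jc\<close> extends \<open>branch_jac\<close> holomorphically.\<close>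
  define Jc where "Jc s z = of_real \<sigma> / det (jacobian (\<psi>c s z))" for s z
  have vh: "vholo (\<psi>c s) z" if "x \<in> cube" "z \<in> ball (cvec x) d" for s x z
    using 3[OF that] vholoI by blast
  have ch: "cholo (Jc s) z" if "x \<in> cube" "z \<in> ball (cvec x) d" for s x z
    unfolding Jc_def using 2[OF that] vh[OF that]
    by (intro cholo_divide cholo_const cholo_vcompose[of "\<psi>c s"] dom_cholo) (auto simp: reg_def)
  have Jr: "Jc s (cvec x) = of_real (branch_jac s x)" if x: "x \<in> cube" for s x
  proof -
    have b: "branch s x \<in> cube" by (rule branch(1)[OF x])
    have "det (jacobian (cvec (branch s x))) = of_real (\<sigma> * jac (DF (branch s x)))"
      using \<sigma>(2)[OF b] jacobian_cvec(2)[OF b] by (simp add: complex_eq_iff)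
    thus ?thesis using \<sigma>(1) by (auto simp: Jc_def 1[OF x] branch_jac_def)
  qed
  have ne: "(cube :: (real ^ 'n) set) \<noteq> {}"
    using emeasure_cube by (metis emeasure_empty zero_neq_one)
  have "\<forall>s. continuous_on cube (branch_jac s) \<and> (\<exists>e>0. \<exists>B\<ge>0.
    (\<forall>x\<in>cube. \<forall>z\<in>ball (cvec x) e. norm (Jc s z - of_real (branch_jac s x)) \<le> (exp (B * dist z (cvec x)) - 1) * branch_jac s x) \<and>
    (\<forall>x\<in>cube. \<forall>y\<in>cube. branch_jac s x \<le> exp (B * dist x y) * branch_jac s y))"
  proof
    fix s :: "'n set"
    show "continuous_on cube (branch_jac s) \<and> (\<exists>e>0. \<exists>B\<ge>0.
      (\<forall>x\<in>cube. \<forall>z\<in>ball (cvec x) e. norm (Jc s z - of_real (branch_jac s x)) \<le> (exp (B * dist z (cvec x)) - 1) * branch_jac s x) \<and>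
      (\<forall>x\<in>cube. \<forall>y\<in>cube. branch_jac s x \<le> exp (B * dist x y) * branch_jac s y))"
      by (rule cholo_relative_lipschitz[OF compact_cube ne d ch Jr branch_jac_pos])
  qed
  note loc = this
  have cont: "continuous_on cube (branch_jac s)" for s :: "'n set" using loc[rule_format, of s] by (rule conjunct1)
  define R where "R s p \<longleftrightarrow> fst p > 0 \<and> snd p \<ge> 0 \<and>
    (\<forall>x\<in>cube. \<forall>z\<in>ball (cvec x) (fst p). norm (Jc s z - of_real (branch_jac s x)) \<le>
        (exp (snd p * dist z (cvec x)) - 1) * branch_jac s x) \<and>
    (\<forall>x\<in>cube. \<forall>y\<in>cube. branch_jac s x \<le> exp (snd p * dist x y) * branch_jac s y)" for s p
  have "\<forall>s. \<exists>p. R s p"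
  proof
    fix s :: "'n set"
    from conjunct2[OF loc[rule_format, of s]] obtain e B where "R s (e, B)" unfolding R_def fst_conv snd_conv by blast
    thus "\<exists>p. R s p" by blast
  qed
  from choice[OF this] obtain p where p: "\<And>s. R s (p s)" by blast
  define e Bs where "e s = fst (p s)" and "Bs s = snd (p s)" for s
  have eB: "\<And>s. e s > 0" "\<And>s. Bs s \<ge> 0"
    "\<And>s x z. x \<in> cube \<Longrightarrow> z \<in> ball (cvec x) (e s) \<Longrightarrow>
       norm (Jc s z - of_real (branch_jac s x)) \<le> (exp (Bs s * dist z (cvec x)) - 1) * branch_jac s x"
    "\<And>s x y. x \<in> cube \<Longrightarrow> y \<in> cube \<Longrightarrow> branch_jac s x \<le> exp (Bs s * dist x y) * branch_jac s y"
    using p unfolding R_def e_def Bs_def by blast+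
  define d' where "d' = min d (Min (range e))"
  define B where "B = Max (range Bs)"
  have d': "d' > 0" "d' \<le> d" "\<And>s. d' \<le> e s"
    using d eB(1) by (auto simp: d'_def min_le_iff_disj intro: Min_le)
  have B: "Bs s \<le> B" for s by (auto simp: B_def)
  have B0: "B \<ge> 0" using B eB(2) order_trans by blast
  have expB: "exp (Bs s * t) \<le> exp (B * t)" if "t \<ge> 0" for s t using B[of s] that by (simp add: mult_right_mono)
  have contr: "dist (\<psi>c s z) (cvec (branch s x)) \<le> 20 / 21 * dist z (cvec x)"
    if x: "x \<in> cube" and z: "z \<in> ball (cvec x) d" for s x z
  proof -
    have "\<forall>z. \<exists>g'. z \<in> ball (cvec x) d \<longrightarrow> (\<psi>c s has_derivative g') (at z within ball (cvec x) d) \<and> onorm g' \<le> 20 / 21"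
      using 3[OF x] by (blast intro: has_derivative_at_withinI)
    from choice[OF this] obtain g' where g': "\<And>z. z \<in> ball (cvec x) d \<Longrightarrow> (\<psi>c s has_derivative g' z) (at z within ball (cvec x) d)"
      "\<And>z. z \<in> ball (cvec x) d \<Longrightarrow> onorm (g' z) \<le> 20 / 21" by blast
    from differentiable_bound[OF convex_ball g' z, of "cvec x"] d
    show ?thesis by (simp add: 1[OF x] dist_norm)
  qed
  show ?thesis
  proof (rule exI[of _ \<psi>c], rule exI[of _ Jc], rule exI[of _ d'], rule exI[of _ B], intro conjI allI ballI d' B0 cont)
    fix s :: "'n set" and x z :: "real ^ 'n" assume "x \<in> cube" "z \<in> cube"
    thus "branch_jac s x \<le> exp (B * dist x z) * branch_jac s z"
      using order_trans[OF eB(4) mult_right_mono[OF expB]] branch_jac_pos less_imp_le zero_le_dist by metis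
  next
    fix s :: "'n set" and x :: "real ^ 'n" and z assume x: "x \<in> cube" and z: "z \<in> ball (cvec x) d'"
    have zd: "z \<in> ball (cvec x) d" "z \<in> ball (cvec x) (e s)" using z d'(2) d'(3)[of s] by auto
    show "dist (\<psi>c s z) (cvec (branch s x)) \<le> 20 / 21 * dist z (cvec x)" by (rule contr[OF x zd(1)])
    show "vholo (\<psi>c s) z" "cholo (Jc s) z" using vh[OF x zd(1)] ch[OF x zd(1)] .
    have "(exp (Bs s * dist z (cvec x)) - 1) * branch_jac s x \<le> (exp (B * dist z (cvec x)) - 1) * branch_jac s x"
      using expB[of "dist z (cvec x)" s] branch_jac_pos[OF x, of s] by (intro mult_right_mono) auto
    with eB(3)[OF x zd(2)]
    show "norm (Jc s z - of_real (branch_jac s x)) \<le> (exp (B * dist z (cvec x)) - 1) * branch_jac s x" by linarith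
  qed
qed

end

section \<open>The transfer operator of the coupled map\<close>

lemma integrable_lebesgue_on_iff:
  fixes f :: "'a::euclidean_space \<Rightarrow> real"
  assumes "X \<in> sets lebesgue"
  shows "integrable (lebesgue_on X) f \<longleftrightarrow> f absolutely_integrable_on X"
  unfolding set_integrable_def using assms by (intro integrable_restrict_space) simp

lemma integral_lebesgue_on_eq:
  fixes f :: "'a::euclidean_space \<Rightarrow> real"
  assumes "X \<in> sets lebesgue" "f absolutely_integrable_on X"
  shows "(LINT x|lebesgue_on X. f x) = integral X f"
  using set_lebesgue_integral_eq_integral(2)[OF assms(2)] assms(1)
  by (simp add: set_lebesgue_integral_def integral_restrict_space)

lemma absolutely_integrable_extend:
  fixes f :: "'a::euclidean_space \<Rightarrow> real"
  assumes "Z \<subseteq> X" "f absolutely_integrable_on Z"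
  shows "(\<lambda>x. if x \<in> Z then f x else 0) absolutely_integrable_on X"
    and "integral X (\<lambda>x. if x \<in> Z then f x else 0) = integral Z f"
proof -
  have f: "(f has_integral integral Z f) Z" "((\<lambda>x. norm (f x)) has_integral integral Z (\<lambda>x. norm (f x))) Z"
    using assms(2) unfolding absolutely_integrable_on_def by auto
  have 1: "((\<lambda>x. if x \<in> Z then f x else 0) has_integral integral Z f) X"
    using f(1) by (simp only: has_integral_restrict[OF assms(1)])
  have "((\<lambda>x. if x \<in> Z then norm (f x) else 0) has_integral integral Z (\<lambda>x. norm (f x))) X"
    using f(2) by (simp only: has_integral_restrict[OF assms(1)])
  moreover have "(\<lambda>x. if x \<in> Z then norm (f x) else 0) = (\<lambda>x. norm (if x \<in> Z then f x else 0))" by auto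
  ultimately show "(\<lambda>x. if x \<in> Z then f x else 0) absolutely_integrable_on X"
    using 1 unfolding absolutely_integrable_on_def by (auto simp: integrable_on_def)
  show "integral X (\<lambda>x. if x \<in> Z then f x else 0) = integral Z f" using 1 by (rule integral_unique)
qed

lemma integrable_continuous_mult:
  fixes u g :: "'a::euclidean_space \<Rightarrow> real"
  assumes X: "compact X" and u: "continuous_on X u" and g: "integrable (lebesgue_on X) g"
  shows "integrable (lebesgue_on X) (\<lambda>x. u x * g x)"
proof -
  obtain K where K: "\<And>x. x \<in> X \<Longrightarrow> norm (u x) \<le> K"
    using compact_imp_bounded[OF compact_continuous_image[OF u X]] by (auto simp: bounded_iff)
  have um: "u \<in> borel_measurable (lebesgue_on X)"
    by (rule continuous_imp_measurable_on_sets_lebesgue[OF u fmeasurableD[OF lmeasurable_compact[OF X]]])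
  show ?thesis
  proof (rule Bochner_Integration.integrable_bound[of _ "\<lambda>x. K * g x"])
    show "integrable (lebesgue_on X) (\<lambda>x. K * g x)" using g by simp
    show "(\<lambda>x. u x * g x) \<in> borel_measurable (lebesgue_on X)"
      using um borel_measurable_integrable[OF g] by (rule borel_measurable_times)
    show "AE x in lebesgue_on X. norm (u x * g x) \<le> norm (K * g x)"
    proof (rule AE_I2)
      fix x assume "x \<in> space (lebesgue_on X)"
      hence "norm (u x) \<le> \<bar>K\<bar>" using K[of x] by (simp add: space_restrict_space)
      thus "norm (u x * g x) \<le> norm (K * g x)" by (simp add: abs_mult mult_right_mono)
    qed
  qed
qed

text \<open>The boundary of the cube. A coordinate at the break point has lifted value 1/2, which
  corresponds to 1/2 or -1/2 after the shift; off the edge, neither the unspecified value nor the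
  choice between adjacent branches matters.\<close>

definition edge :: "(real ^ 'n) set" where
  "edge = {y \<in> cube. \<exists>i. \<bar>y $ i\<bar> = 1 / 2}"

lemma negligible_edge: "negligible (edge :: (real ^ 'n) set)"
proof -
  have h: "negligible {y :: real ^ 'n. y $ i = a}" for i a
    using negligible_standard_hyperplane[of "axis i (1 :: real)" a] by (simp add: inner_axis_1)
  have "negligible ({y :: real ^ 'n. y $ i = 1 / 2} \<union> {y. y $ i = - 1 / 2})" for i
    by (intro negligible_Un h)
  hence "negligible (\<Union>i. {y :: real ^ 'n. y $ i = 1 / 2} \<union> {y. y $ i = - 1 / 2})"
  proof (intro negligible_Union)
    show "finite (range (\<lambda>i. {y :: real ^ 'n. y $ i = 1 / 2} \<union> {y. y $ i = - 1 / 2}))" by simp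
  qed blast
  thus ?thesis
  proof (rule negligible_subset, intro subsetI)
    fix y :: "real ^ 'n" assume "y \<in> edge"
    then obtain i where "\<bar>y $ i\<bar> = 1 / 2" by (auto simp: edge_def)
    hence "y $ i = 1 / 2 \<or> y $ i = - 1 / 2" by linarith
    thus "y \<in> (\<Union>i. {y :: real ^ 'n. y $ i = 1 / 2} \<union> {y. y $ i = - 1 / 2})" by blast
  qed
qed

lemma not_edgeD:
  assumes "y \<in> cube" "y \<notin> edge"
  shows "- 1 / 2 < y $ i" "y $ i < 1 / 2"
proof -
  have "\<bar>y $ i\<bar> \<noteq> 1 / 2" using assms by (simp add: edge_def)
  hence "\<bar>y $ i\<bar> < 1 / 2" using cubeD[OF assms(1), of i] by linarith
  thus "- 1 / 2 < y $ i" "y $ i < 1 / 2" by linarith+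
qed

context gcm
begin

lemma cube_sets: "(cube :: (real ^ 'n) set) \<in> sets lebesgue"
  by (rule fmeasurableD[OF lmeasurable_compact[OF compact_cube]])

lemma coupled_map_in_cube:
  assumes c: "\<forall>r. \<bar>r\<bar> < 2 / 3 \<longrightarrow> c r \<in> unit_int" and x: "x \<in> cube"
  shows "coupled_map c G x \<in> cube"
  unfolding cube_def
proof (intro CollectI allI)
  fix i
  let ?r = "G (mean x)"
  note r = G_cube[OF x] and xi = cubeD[OF x, of i]
  have *: "mob ?r (x $ i) < mob ?r y \<longleftrightarrow> x $ i < y" "mob ?r y < mob ?r (x $ i) \<longleftrightarrow> y < x $ i"
    if "\<bar>y\<bar> \<le> 1 / 2" for y using mob_less_iff[OF r] xi that by auto
  have lo: "- 1 / 2 \<le> mob ?r (x $ i)" using *(1)[of "- 1 / 2"] mob_ends(1)[OF r] xi by (simp add: abs_le_iff) linarith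
  have hi: "mob ?r (x $ i) \<le> 3 / 2" using *(2)[of "1 / 2"] mob_ends(2)[OF r] xi by (simp add: abs_le_iff) linarith
  have bp: "x $ i < break_pt ?r \<longleftrightarrow> mob ?r (x $ i) < 1 / 2" "break_pt ?r < x $ i \<longleftrightarrow> 1 / 2 < mob ?r (x $ i)"
    using *[OF mob_ends(4)[OF r]] by (simp_all add: mob_ends(3)[OF r])
  have "site_map c ?r (x $ i) \<in> unit_int"
  proof (cases "x $ i = break_pt ?r")
    case True
    have "\<bar>?r\<bar> < 2 / 3" using r by linarith
    thus ?thesis using c True by (simp add: site_map_def)
  next
    case False
    thus ?thesis using lo hi bp unfolding site_map_def unit_int_def by auto
  qed
  thus "coupled_map c G x $ i \<in> unit_int" by (simp add: coupled_map_def mean_field_eq)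
qed

lemma coupled_map_branch:
  assumes y: "y \<in> cube" "y \<notin> edge"
  shows "coupled_map c G (branch s y) = y"
proof (subst vec_eq_iff, rule allI)
  fix i
  let ?x = "branch s y" and ?r = "G (mean (branch s y))"
  note b = branch[OF y(1), of s]
  note r = G_cube[OF b(1)] and xi = cubeD[OF b(1), of i]
  have m: "mob ?r (?x $ i) = y $ i + (if i \<in> s then 1 else 0)"
    using arg_cong[OF b(2), of "\<lambda>v. v $ i"] by (simp add: F_def shift_vec_def)
  note yi = not_edgeD[OF y, of i]
  have bp: "?x $ i < break_pt ?r \<longleftrightarrow> mob ?r (?x $ i) < 1 / 2" "break_pt ?r < ?x $ i \<longleftrightarrow> 1 / 2 < mob ?r (?x $ i)"
    using mob_less_iff[OF r xi mob_ends(4)[OF r]] mob_less_iff[OF r mob_ends(4)[OF r] xi]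
    by (simp_all add: mob_ends(3)[OF r])
  have "site_map c ?r (?x $ i) = y $ i"
    using bp m yi by (cases "i \<in> s") (simp_all add: site_map_def)
  thus "coupled_map c G ?x $ i = y $ i" by (simp add: coupled_map_def mean_field_eq)
qed

definition crit :: "(real ^ 'n) set" where
  "crit = (\<Union>s. branch s ` edge)"

text \<open>Branches are Lipschitz, and Lipschitz images of null sets are null. Outside this set the
  branches have disjoint images and the coupled map inverts them.\<close>

lemma negligible_crit: "negligible (crit :: (real ^ 'n) set)"
proof -
  have "negligible (branch s ` (edge :: (real ^ 'n) set))" for s
  proof (rule negligible_locally_Lipschitz_image[OF order_refl negligible_edge])
    fix x :: "real ^ 'n" assume x: "x \<in> edge"
    show "\<exists>T B. open T \<and> x \<in> T \<and> (\<forall>y\<in>edge \<inter> T. norm (branch s y - branch s x) \<le> B * norm (y - x))"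
    proof (intro exI conjI ballI)
      show "open (UNIV :: (real ^ 'n) set)" "x \<in> UNIV" by auto
      fix y assume "y \<in> edge \<inter> (UNIV :: (real ^ 'n) set)"
      thus "norm (branch s y - branch s x) \<le> 20 / 21 * norm (y - x)"
        using branch_contr[of y x s] x by (simp add: edge_def dist_norm)
    qed
  qed
  thus ?thesis unfolding crit_def by (intro negligible_Union) auto
qed

lemma branch_cases:
  assumes x: "x \<in> cube"
  defines "s \<equiv> {i. F x $ i > 1 / 2}"
  shows "F x - shift_vec s \<in> cube" "branch s (F x - shift_vec s) = x"
proof -
  have "F x \<in> image_box" using x F_image by blast
  hence "- 1 / 2 \<le> F x $ i" "F x $ i \<le> 3 / 2" for i by (auto simp: image_box_def)
  thus "F x - shift_vec s \<in> cube"
    by (auto simp: cube_def unit_int_def s_def shift_vec_def not_less)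
  show "branch s (F x - shift_vec s) = x" by (rule branch_F[OF x]) simp
qed

text \<open>Interior coordinates of \<open>y\<close> stay below 1/2 when unshifted and exceed it
  when shifted, so the lift remembers which coordinates were shifted.\<close>

lemma branch_unique:
  assumes y: "y \<in> cube" and x: "branch t y \<notin> crit"
  shows "t = {i. F (branch t y) $ i > 1 / 2}"
proof -
  have "y \<notin> edge" using x by (auto simp: crit_def)
  note yi = not_edgeD[OF y this]
  have "1 / 2 < y $ i + 1" "\<not> 1 / 2 < y $ i" for i using yi[of i] by linarith+
  thus ?thesis unfolding branch(2)[OF y] by (auto simp: shift_vec_def)
qed

context
  fixes \<phi> g :: "real ^ 'n \<Rightarrow> real"
  assumes \<phi>: "continuous_on cube \<phi>" and g: "integrable (lebesgue_on cube) g"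
begin

lemma continuous_on_branch_weight: "continuous_on cube (\<lambda>y. branch_jac s y * \<phi> (branch s y))"
proof (intro continuous_intros continuous_on_compose2[OF \<phi>])
  show "continuous_on cube (branch_jac s)" using ex_holo_branches[where 'n = 'n] by blast
  show "continuous_on cube (branch s)"
    by (rule lipschitz_on_continuous_on[of "20 / 21"]) (auto intro!: lipschitz_onI branch_contr)
  show "branch s ` cube \<subseteq> cube" using branch(1) by blast
qed

text \<open>The substitution is performed with the lift minus the shift, whose derivative
  \<open>DF\<close> is known explicitly; its Jacobian cancels \<open>branch_jac\<close>.\<close>

lemma branch_change_of_variables:
  fixes s
  defines "w \<equiv> \<lambda>x. if x \<in> branch s ` cube then \<phi> x * g (F x - shift_vec s) else 0"
  shows "w absolutely_integrable_on cube"
    and "integral cube w = integral cube (\<lambda>y. branch_jac s y * \<phi> (branch s y) * g y)"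
proof -
  let ?f = "\<lambda>y. branch_jac s y * \<phi> (branch s y) * g y" and ?H = "\<lambda>x. F x - shift_vec s"
  let ?Z = "branch s ` cube"
  have ZX: "?Z \<subseteq> cube" using branch(1) by blast
  have "continuous_on cube (branch s)"
    by (rule lipschitz_on_continuous_on[of "20 / 21"]) (auto intro!: lipschitz_onI branch_contr)
  hence Z: "compact ?Z" using compact_cube by (rule compact_continuous_image)
  have Hb: "?H (branch s y) = y" if "y \<in> cube" for y using branch(2)[OF that, of s] by simp
  have der: "(?H has_derivative DF x) (at x within ?Z)" if "x \<in> ?Z" for x
  proof -
    have "(F has_derivative DF x) (at x within ?Z)"
      using F_has_derivative ZX that by (blast intro: has_derivative_subset)
    thus ?thesis by (auto intro!: derivative_eq_intros)
  qed
  have inj: "inj_on ?H ?Z"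
  proof (rule inj_onI)
    fix x x' assume "x \<in> ?Z" "x' \<in> ?Z" "?H x = ?H x'"
    thus "x = x'" using Hb by (metis imageE)
  qed
  have im: "?H ` ?Z = cube" using Hb by (force simp: image_iff)
  have "integrable (lebesgue_on cube) ?f"
    by (rule integrable_continuous_mult[OF compact_cube continuous_on_branch_weight g])
  hence f: "?f absolutely_integrable_on (?H ` ?Z)"
    unfolding im by (simp only: integrable_lebesgue_on_iff[OF cube_sets])
  note cov = absolutely_integrable_change_of_variables[OF Z der inj f]
  have eq: "jac (DF x) * ?f (?H x) = \<phi> x * g (?H x)" if x: "x \<in> ?Z" for x
  proof -
    obtain y where y: "y \<in> cube" "x = branch s y" using x by blast
    have "jac (DF x) > 0" using jacobian_cvec(3) ZX x by blast
    moreover have "?f (?H x) = \<phi> x * g (?H x) / jac (DF x)"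
      using Hb[OF y(1)] by (simp add: y(2) branch_jac_def)
    ultimately show ?thesis by simp
  qed
  have 1: "(\<lambda>x. \<phi> x * g (?H x)) absolutely_integrable_on ?Z"
  proof (rule absolutely_integrable_spike[OF cov(1) negligible_empty])
    fix x assume "x \<in> ?Z - {}"
    hence "x \<in> ?Z" by blast
    from eq[OF this] show "\<phi> x * g (?H x) = jac (DF x) * ?f (?H x)" by (rule sym)
  qed
  show "w absolutely_integrable_on cube"
    unfolding w_def by (rule absolutely_integrable_extend(1)[OF ZX 1])
  have "integral cube w = integral ?Z (\<lambda>x. \<phi> x * g (?H x))"
    unfolding w_def by (rule absolutely_integrable_extend(2)[OF ZX 1])
  also have "\<dots> = integral ?Z (\<lambda>x. jac (DF x) * ?f (?H x))"
    by (rule Henstock_Kurzweil_Integration.integral_cong) (simp only: eq)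
  also have "\<dots> = integral cube ?f" using cov(2) unfolding im .
  finally show "integral cube w = integral cube ?f" .
qed

text \<open>Up to the null set \<open>crit\<close>, the cube is the disjoint union of the branch
  images, and on each of them the coupled map is the lift minus a shift. Summing the substitution
  over the branches gives the duality, for any choice of the values \<open>c\<close>.\<close>

theorem transfer_duality:
  shows "integrable (lebesgue_on cube) (\<lambda>x. \<phi> x * g (coupled_map c G x))"
    and "(LINT x|lebesgue_on cube. \<phi> x * g (coupled_map c G x)) =
      (LINT x|lebesgue_on cube. (\<Sum>s\<in>UNIV. branch_jac s x * \<phi> (branch s x)) * g x)"
proof -
  define w where "w s x = (if x \<in> branch s ` cube then \<phi> x * g (F x - shift_vec s) else 0)" for s x
  let ?u = "\<lambda>x. \<phi> x * g (coupled_map c G x)"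
  have w: "w s absolutely_integrable_on cube"
    "integral cube (w s) = integral cube (\<lambda>y. branch_jac s y * \<phi> (branch s y) * g y)" for s
    using branch_change_of_variables[of s] unfolding w_def[abs_def] by blast+
  have sum: "?u x = (\<Sum>s\<in>UNIV. w s x)" if x: "x \<in> cube - crit" for x
  proof -
    let ?s = "{i. F x $ i > 1 / 2}"
    let ?y = "F x - shift_vec ?s"
    have xc: "x \<in> cube" using x by blast
    note b = branch_cases[OF xc]
    have "?y \<notin> edge"
    proof
      assume "?y \<in> edge"
      hence "branch ?s ?y \<in> crit" unfolding crit_def by blast
      thus False using x b(2) by simp
    qed
    hence T: "coupled_map c G x = ?y" using coupled_map_branch[where s = ?s, OF b(1)] b(2) by simp
    have "w t x = 0" if "t \<noteq> ?s" for t
    proof -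
      have "x \<notin> branch t ` cube"
      proof
        assume "x \<in> branch t ` cube"
        then obtain y where "y \<in> cube" "x = branch t y" by blast
        with branch_unique[of y t] x that show False by simp
      qed
      thus ?thesis by (simp add: w_def)
    qed
    hence "(\<Sum>s\<in>UNIV. w s x) = (\<Sum>s\<in>{?s}. w s x)" by (intro sum.mono_neutral_right) auto
    also have "\<dots> = ?u x"
      using b by (simp add: w_def T) (metis image_eqI)
    finally show ?thesis by simp
  qed
  have "(\<lambda>x. \<Sum>s\<in>UNIV. w s x) absolutely_integrable_on cube"
    by (rule absolutely_integrable_sum) (auto intro: w)
  hence u: "?u absolutely_integrable_on cube"
    by (rule absolutely_integrable_spike[OF _ negligible_crit]) (rule sum)
  thus "integrable (lebesgue_on cube) ?u" by (simp only: integrable_lebesgue_on_iff[OF cube_sets])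
  have fi: "integrable (lebesgue_on cube) (\<lambda>y. branch_jac s y * \<phi> (branch s y) * g y)" for s
    by (rule integrable_continuous_mult[OF compact_cube continuous_on_branch_weight g])
  have "(LINT x|lebesgue_on cube. ?u x) = integral cube ?u" by (rule integral_lebesgue_on_eq[OF cube_sets u])
  also have "\<dots> = integral cube (\<lambda>x. \<Sum>s\<in>UNIV. w s x)"
    by (rule integral_spike[OF negligible_crit]) (simp only: sum)
  also have "\<dots> = (\<Sum>s\<in>UNIV. integral cube (w s))"
    using w(1) by (intro integral_sum) (auto simp: absolutely_integrable_on_def)
  also have "\<dots> = (\<Sum>s\<in>UNIV. LINT y|lebesgue_on cube. branch_jac s y * \<phi> (branch s y) * g y)"
    using fi by (simp only: w(2) integral_lebesgue_on_eq[OF cube_sets] integrable_lebesgue_on_iff[OF cube_sets])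
  also have "\<dots> = (LINT y|lebesgue_on cube. (\<Sum>s\<in>UNIV. branch_jac s y * \<phi> (branch s y) * g y))"
    using fi by (intro Bochner_Integration.integral_sum[symmetric])
  finally show "(LINT x|lebesgue_on cube. ?u x) =
      (LINT x|lebesgue_on cube. (\<Sum>s\<in>UNIV. branch_jac s x * \<phi> (branch s x)) * g x)"
    by (simp only: sum_distrib_right)
qed

end

theorem ex_holo_branch_system:
  "\<exists>C \<psi>c Jc d B. holo_branch_system (cube :: (real ^ 'n) set) UNIV branch branch_jac (20 / 21) C \<psi>c Jc d B"
proof -
  obtain \<psi>c Jc d B where d: "d > 0" "B \<ge> 0" and H: "\<forall>s :: 'n set. continuous_on cube (branch_jac s) \<and>
     (\<forall>x\<in>cube. \<forall>y\<in>cube. branch_jac s x \<le> exp (B * dist x y) * branch_jac s y) \<and>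
     (\<forall>x\<in>cube. \<forall>z\<in>ball (cvec x) d. dist (\<psi>c s z) (cvec (branch s x)) \<le> 20 / 21 * dist z (cvec x) \<and>
        norm (Jc s z - of_real (branch_jac s x)) \<le> (exp (B * dist z (cvec x)) - 1) * branch_jac s x \<and>
        vholo (\<psi>c s) z \<and> cholo (Jc s) z)"
    using ex_holo_branches by blast
  have "holo_branch_system (cube :: (real ^ 'n) set) UNIV branch branch_jac (20 / 21) B \<psi>c Jc d B"
  proof
    show "compact (cube :: (real ^ 'n) set)" "emeasure lebesgue (cube :: (real ^ 'n) set) = 1"
      by (rule compact_cube, rule emeasure_cube)
    fix \<phi> :: "real ^ 'n \<Rightarrow> real" assume \<phi>: "continuous_on cube \<phi>"
    have "integrable (lebesgue_on cube) (\<lambda>_ :: real ^ 'n. 1 :: real)"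
      using lmeasurable_compact[OF compact_cube] unfolding lmeasurable_iff_integrable
      by (subst integrable_lebesgue_on_iff[OF cube_sets]) (simp add: set_integrable_def)
    \<comment> \<open>Conservation of mass is duality against \<open>g = 1\<close>; composition with
      the map disappears, so any \<open>c\<close> serves.\<close>
    from transfer_duality(2)[where c = "\<lambda>_. 0", OF \<phi> this]
    show "(LINT x|lebesgue_on cube. (\<Sum>s\<in>UNIV. branch_jac s x * \<phi> (branch s x))) = (LINT x|lebesgue_on cube. \<phi> x)"
      by simp
  qed (use d H branch(1) branch_contr branch_jac_pos in \<open>simp_all\<close>)
  thus ?thesis by blast
qed

end

section \<open>The invariant measure\<close>

lemma emeasure_density_integral:
  fixes q :: "'a \<Rightarrow> real"
  assumes q: "integrable M q" "AE x in M. 0 \<le> q x" and A: "A \<in> sets M"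
  shows "emeasure (density M (\<lambda>x. ennreal (q x))) A = ennreal (LINT x|M. q x * indicator A x)"
proof -
  have "emeasure (density M (\<lambda>x. ennreal (q x))) A = (\<integral>\<^sup>+x. ennreal (q x) * indicator A x \<partial>M)"
    using q(1) A by (intro emeasure_density) auto
  also have "\<dots> = (\<integral>\<^sup>+x. ennreal (q x * indicator A x) \<partial>M)"
    by (intro nn_integral_cong) (simp split: split_indicator)
  also have "\<dots> = ennreal (LINT x|M. q x * indicator A x)"
  proof (rule nn_integral_eq_integral)
    show "integrable M (\<lambda>x. q x * indicator A x)"
      using q(1) A by (rule integrable_real_mult_indicator[rotated])
    show "AE x in M. 0 \<le> q x * indicator A x" using q(2) by eventually_elim (simp split: split_indicator)
  qed
  finally show ?thesis .
qed

lemma (in finite_measure) Radon_Nikodym_real: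
  assumes N: "finite_measure N" "sets N = sets M" "absolutely_continuous M N"
  obtains q :: "'a \<Rightarrow> real" where "integrable M q" "\<And>x. 0 \<le> q x" "N = density M (\<lambda>x. ennreal (q x))"
proof -
  obtain f where f: "f \<in> borel_measurable M" "density M f = N"
    using Radon_Nikodym_finite_measure[OF N] by blast
  have "integral\<^sup>N M f = emeasure N (space M)"
    using emeasure_density[OF f(1) sets.top] by (simp add: f(2) nn_integral_set_ennreal[symmetric])
  hence fin: "integral\<^sup>N M f \<noteq> \<infinity>" using finite_measure.emeasure_finite[OF N(1)] by simp
  have ae: "AE x in M. f x \<noteq> \<infinity>" by (rule nn_integral_PInf_AE[OF f(1) fin])
  have eq: "AE x in M. f x = ennreal (enn2real (f x))" using ae by eventually_elim (simp add: less_top)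
  show ?thesis
  proof
    show "N = density M (\<lambda>x. ennreal (enn2real (f x)))"
      unfolding f(2)[symmetric] by (rule density_cong[OF _ _ eq]) (use f in measurable)
    show "integrable M (\<lambda>x. enn2real (f x))"
    proof (rule integrableI_nonneg)
      have "integral\<^sup>N M f = (\<integral>\<^sup>+x. ennreal (enn2real (f x)) \<partial>M)" by (rule nn_integral_cong_AE[OF eq])
      thus "(\<integral>\<^sup>+x. ennreal (enn2real (f x)) \<partial>M) < \<infinity>" using fin by (simp add: less_top)
    qed (use f in auto)
  qed simp
qed

text \<open>Besides \<open>T_in\<close>, the forward map is known only through its duality with the
  transfer operator; its measurability and invariant measure are derived from that.\<close>

locale branch_dynamics = branch_system X S \<psi> J l C
  for X :: "'a::euclidean_space set" and S :: "'s set" and \<psi> J l C +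
  fixes T :: "'a \<Rightarrow> 'a"
  assumes T_in: "\<And>x. x \<in> X \<Longrightarrow> T x \<in> X"
    and dual_integrable: "\<And>\<phi> g :: 'a \<Rightarrow> real. continuous_on X \<phi> \<Longrightarrow> integrable (lebesgue_on X) g \<Longrightarrow>
      integrable (lebesgue_on X) (\<lambda>x. \<phi> x * g (T x))"
    and dual: "\<And>\<phi> g :: 'a \<Rightarrow> real. continuous_on X \<phi> \<Longrightarrow> integrable (lebesgue_on X) g \<Longrightarrow>
      (LINT x|lebesgue_on X. \<phi> x * g (T x)) = (LINT x|lebesgue_on X. transfer \<phi> x * g x)"
begin

abbreviation M :: "'a measure" where "M \<equiv> lebesgue_on X"
abbreviation h :: "'a \<Rightarrow> real" where "h \<equiv> density_fun"

definition inv_measure :: "'a measure" where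
  "inv_measure = density M (\<lambda>x. ennreal (h x))"

lemma space_M: "space M = X"
  by (simp add: space_restrict_space)

lemma integrable_ind: "A \<in> sets M \<Longrightarrow> integrable M (indicator A :: 'a \<Rightarrow> real)"
  using finite_measure.emeasure_finite[OF fin_measure] by (intro integrable_real_indicator) (auto simp: less_top)

text \<open>Integrability of indicators composed with \<open>T\<close> contains their measurability,
  and preimages under \<open>T\<close> are level sets of these functions.\<close>

lemma T_measurable: "T \<in> measurable M M"
proof (rule measurableI)
  fix A assume A: "A \<in> sets M"
  have "integrable M (\<lambda>x. 1 * indicator A (T x) :: real)"
    by (rule dual_integrable[OF continuous_on_const integrable_ind[OF A]])
  hence "(\<lambda>x. indicator A (T x) :: real) \<in> borel_measurable M" by auto
  hence "(\<lambda>x. indicator A (T x) :: real) -` {1} \<inter> space M \<in> sets M" by (rule measurable_sets) simp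
  moreover have "(\<lambda>x. indicator A (T x) :: real) -` {1} \<inter> space M = T -` A \<inter> space M"
    by (auto simp: indicator_def split: if_splits)
  ultimately show "T -` A \<inter> space M \<in> sets M" by simp
qed (simp add: space_M T_in)

lemma integrable_iter:
  fixes g :: "'a \<Rightarrow> real"
  assumes "integrable M g"
  shows "integrable M (\<lambda>x. g ((T ^^ n) x))"
proof (induction n)
  case (Suc n)
  show ?case using dual_integrable[OF continuous_on_const Suc, of 1] by (simp add: funpow_swap1)
qed (simp add: assms)

lemma dual_iter:
  fixes \<phi> g :: "'a \<Rightarrow> real"
  assumes g: "integrable M g" and \<phi>: "continuous_on X \<phi>"
  shows "(LINT x|M. \<phi> x * g ((T ^^ n) x)) = (LINT x|M. (transfer ^^ n) \<phi> x * g x)"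
  using \<phi>
proof (induction n arbitrary: \<phi>)
  case (Suc n)
  have "(LINT x|M. \<phi> x * g ((T ^^ Suc n) x)) = (LINT x|M. \<phi> x * g ((T ^^ n) (T x)))"
    by (simp add: funpow_swap1)
  also have "\<dots> = (LINT x|M. transfer \<phi> x * g ((T ^^ n) x))"
    by (rule dual[OF Suc.prems integrable_iter[OF g]])
  also have "\<dots> = (LINT x|M. (transfer ^^ Suc n) \<phi> x * g x)"
    using Suc.IH[OF transfer_cont[OF Suc.prems]] by (simp add: funpow_swap1)
  finally show ?case .
qed simp

lemma h_cont: "continuous_on X h"
  by (rule coneD(1)[OF density_fun(1)])

lemma h_integrable: "integrable M h"
  by (rule integrable_cont[OF h_cont])

lemma h_nonneg: "AE x in M. 0 \<le> h x"
  using density_fun(4) by (intro AE_I2) (auto simp: space_M less_imp_le)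

lemma h_bounds: obtains m H where "0 < m" "\<And>x. x \<in> X \<Longrightarrow> m \<le> h x" "\<And>x. x \<in> X \<Longrightarrow> h x \<le> H"
proof -
  obtain a b where "a \<in> X" "\<And>x. x \<in> X \<Longrightarrow> h a \<le> h x" "\<And>x. x \<in> X \<Longrightarrow> h x \<le> h b"
    using continuous_attains_inf[OF X(1) X_ne h_cont] continuous_attains_sup[OF X(1) X_ne h_cont] by metis
  thus thesis using density_fun(4) that by blast
qed

lemma sets_inv_measure [simp]: "sets inv_measure = sets M"
  and space_inv_measure [simp]: "space inv_measure = X"
  by (simp_all add: inv_measure_def space_M)

lemma emeasure_inv_measure: "A \<in> sets M \<Longrightarrow> emeasure inv_measure A = ennreal (LINT x|M. h x * indicator A x)"
  unfolding inv_measure_def by (rule emeasure_density_integral[OF h_integrable h_nonneg])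

lemma emeasure_inv_measure_X: "emeasure inv_measure X = 1"
proof -
  have "(LINT x|M. h x * indicator X x) = Leb h" by (rule Int_cong) simp
  moreover have "X \<in> sets M" using sets.top[of M] by (simp only: space_M)
  ultimately show ?thesis by (simp add: emeasure_inv_measure density_fun(2))
qed

lemma distr_inv_measure: "distr inv_measure inv_measure T = inv_measure"
proof (rule measure_eqI)
  fix A assume "A \<in> sets (distr inv_measure inv_measure T)"
  hence A: "A \<in> sets M" by simp
  have T: "T \<in> measurable inv_measure inv_measure"
    using T_measurable by (simp add: measurable_cong_sets[OF sets_inv_measure sets_inv_measure])
  have pre: "T -` A \<inter> X \<in> sets M" using measurable_sets[OF T_measurable A] by (simp add: space_M)
  have "emeasure (distr inv_measure inv_measure T) A = emeasure inv_measure (T -` A \<inter> X)"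
    using A by (subst emeasure_distr[OF T]) simp_all
  also have "\<dots> = ennreal (LINT x|M. h x * indicator (T -` A \<inter> X) x)" by (rule emeasure_inv_measure[OF pre])
  also have "(LINT x|M. h x * indicator (T -` A \<inter> X) x) = (LINT x|M. h x * indicator A (T x))"
    by (rule Int_cong) (simp add: indicator_def)
  also have "\<dots> = (LINT x|M. transfer h x * indicator A x)" by (rule dual[OF h_cont integrable_ind[OF A]])
  also have "\<dots> = (LINT x|M. h x * indicator A x)" by (rule Int_cong) (simp add: density_fun(3))
  also have "ennreal \<dots> = emeasure inv_measure A" by (rule emeasure_inv_measure[OF A, symmetric])
  finally show "emeasure (distr inv_measure inv_measure T) A = emeasure inv_measure A" .
qed simp

text \<open>Duality moves the iterates from \<open>g\<close> to \<open>f * h\<close>, where the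
  iterates of the transfer operator converge uniformly; the remaining pairing costs only the
  integral of the modulus of \<open>g\<close>.\<close>

lemma decay:
  assumes \<gamma>: "0 < \<gamma>" "\<gamma> \<le> 1"
  obtains B \<rho> where "0 < \<rho>" "\<rho> < 1" "0 \<le> B"
    "\<And>f g K n. hoelder_on X \<gamma> K f \<Longrightarrow> integrable M g \<Longrightarrow>
      \<bar>(LINT x|M. (f x * h x) * g ((T ^^ n) x)) - Leb (\<lambda>x. f x * h x) * (LINT x|M. h x * g x)\<bar>
        \<le> B * K * \<rho> ^ n * (LINT x|M. \<bar>g x\<bar>)"
proof -
  obtain B \<rho> where \<rho>: "0 < \<rho>" "\<rho> < 1" and B: "\<And>f K n x. hoelder_on X \<gamma> K f \<Longrightarrow> x \<in> X \<Longrightarrow>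
     \<bar>(transfer ^^ n) (\<lambda>x. f x * h x) x - Leb (\<lambda>x. f x * h x) * h x\<bar> \<le> B * K * \<rho> ^ n"
    using transfer_hoelder_decay[OF \<gamma>] by blast
  show thesis
  proof (rule that[OF \<rho> abs_ge_zero[of B]])
    fix f g :: "'a \<Rightarrow> real" and K :: real and n :: nat
    assume f: "hoelder_on X \<gamma> K f" and g: "integrable M g"
    obtain x0 where "x0 \<in> X" using X_ne by blast
    hence "\<bar>f x0\<bar> \<le> K" using f by (auto simp: hoelder_on_def)
    hence K: "0 \<le> K" by linarith
    let ?u = "(transfer ^^ n) (\<lambda>x. f x * h x)" and ?c = "Leb (\<lambda>x. f x * h x)"
    have fh: "continuous_on X (\<lambda>x. f x * h x)"
      by (rule continuous_on_mult[OF hoelder_on_imp_continuous_on[OF f \<gamma>(1)] h_cont])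
    have i: "integrable M (\<lambda>x. ?u x * g x)" "integrable M (\<lambda>x. (?c * h x) * g x)"
      by (intro integrable_continuous_mult X(1) g iter_cont fh continuous_intros h_cont)+
    have "(LINT x|M. (f x * h x) * g ((T ^^ n) x)) - ?c * (LINT x|M. h x * g x) =
        (LINT x|M. ?u x * g x) - (LINT x|M. (?c * h x) * g x)"
      unfolding dual_iter[OF g fh] by (simp add: mult.assoc)
    also have "\<dots> = (LINT x|M. (?u x - ?c * h x) * g x)"
      using i by (simp add: left_diff_distrib)
    finally have eq: "(LINT x|M. (f x * h x) * g ((T ^^ n) x)) - ?c * (LINT x|M. h x * g x) =
        (LINT x|M. (?u x - ?c * h x) * g x)" .
    have "norm (LINT x|M. (?u x - ?c * h x) * g x) \<le> (LINT x|M. (\<bar>B\<bar> * K * \<rho> ^ n) * \<bar>g x\<bar>)"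
    proof (rule Bochner_Integration.integral_norm_bound_integral)
      show "integrable M (\<lambda>x. (?u x - ?c * h x) * g x)"
        by (intro integrable_continuous_mult X(1) g iter_cont fh continuous_intros h_cont)
      show "integrable M (\<lambda>x. (\<bar>B\<bar> * K * \<rho> ^ n) * \<bar>g x\<bar>)" using g by simp
      fix x assume "x \<in> space M"
      hence x: "x \<in> X" by (simp add: space_M)
      have "\<bar>?u x - ?c * h x\<bar> \<le> B * K * \<rho> ^ n" by (rule B[OF f x])
      also have "\<dots> \<le> \<bar>B\<bar> * K * \<rho> ^ n" using K \<rho> by (intro mult_right_mono) auto
      finally show "norm ((?u x - ?c * h x) * g x) \<le> (\<bar>B\<bar> * K * \<rho> ^ n) * \<bar>g x\<bar>"
        unfolding real_norm_def abs_mult by (intro mult_right_mono) auto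
    qed
    thus "\<bar>(LINT x|M. (f x * h x) * g ((T ^^ n) x)) - ?c * (LINT x|M. h x * g x)\<bar>
        \<le> \<bar>B\<bar> * K * \<rho> ^ n * (LINT x|M. \<bar>g x\<bar>)" using eq by simp
  qed
qed

lemma integrable_inv_measure:
  assumes "integrable inv_measure g"
  shows "integrable M (\<lambda>x. h x * g x)" "integrable M g"
proof -
  have m: "g \<in> borel_measurable M"
    using borel_measurable_integrable[OF assms] by (simp add: measurable_cong_sets[OF sets_inv_measure refl])
  show hg: "integrable M (\<lambda>x. h x * g x)"
    using assms integrable_real_density[OF _ h_nonneg m] h_integrable by (simp add: inv_measure_def)
  have "continuous_on X (\<lambda>x. inverse (h x))"
    using density_fun(4) by (intro continuous_intros h_cont) force
  hence "integrable M (\<lambda>x. inverse (h x) * (h x * g x))" by (rule integrable_continuous_mult[OF X(1) _ hg])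
  moreover have "inverse (h x) * (h x * g x) = g x" if "x \<in> space M" for x
    using density_fun(4)[of x] that by (simp add: space_M)
  ultimately show "integrable M g"
    using Bochner_Integration.integrable_cong[OF refl, of M "\<lambda>x. inverse (h x) * (h x * g x)" g] by blast
qed

lemma integral_inv_measure:
  "g \<in> borel_measurable M \<Longrightarrow> (LINT x|inv_measure. g x) = (LINT x|M. h x * g x)" for g :: "'a \<Rightarrow> real"
  unfolding inv_measure_def using h_integrable h_nonneg by (intro integral_real_density) auto

theorem inv_measure_mixing: "strongly_exp_mixing inv_measure T"
  unfolding strongly_exp_mixing_def
proof (intro allI impI, elim conjE)
  fix \<gamma> :: real assume \<gamma>: "0 < \<gamma>" "\<gamma> \<le> 1"
  obtain B \<rho> where \<rho>: "0 < \<rho>" "\<rho> < 1" and B0: "0 \<le> B" and B: "\<And>f g K n. hoelder_on X \<gamma> K f \<Longrightarrow> integrable M g \<Longrightarrow>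
      \<bar>(LINT x|M. (f x * h x) * g ((T ^^ n) x)) - Leb (\<lambda>x. f x * h x) * (LINT x|M. h x * g x)\<bar>
        \<le> B * K * \<rho> ^ n * (LINT x|M. \<bar>g x\<bar>)" by (rule decay[OF \<gamma>]) (rule that, assumption+)
  obtain m where m: "0 < m" "\<And>x. x \<in> X \<Longrightarrow> m \<le> h x" using h_bounds by blast
  have main: "\<bar>correlation inv_measure T f g n\<bar> \<le> (B / m) * K * (LINT x|inv_measure. \<bar>g x\<bar>) * \<rho> ^ n"
    if f: "hoelder_on X \<gamma> K f" and g: "integrable inv_measure g" for f g K n
  proof -
    obtain x0 where "x0 \<in> X" using X_ne by blast
    hence "\<bar>f x0\<bar> \<le> K" using f by (auto simp: hoelder_on_def)
    hence K: "0 \<le> K" by linarith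
    note gi = integrable_inv_measure[OF g]
    have fm: "f \<in> borel_measurable M"
      by (rule continuous_imp_measurable_on_sets_lebesgue[OF hoelder_on_imp_continuous_on[OF f \<gamma>(1)] X_sets])
    have gm: "g \<in> borel_measurable M" "(\<lambda>x. g ((T ^^ n) x)) \<in> borel_measurable M"
      using gi(2) integrable_iter[OF gi(2)] by auto
    have "correlation inv_measure T f g n =
        (LINT x|M. h x * (f x * g ((T ^^ n) x))) - (LINT x|M. h x * f x) * (LINT x|M. h x * g x)"
      unfolding correlation_def using fm gm by (subst (1 2 3) integral_inv_measure) auto
    also have "\<dots> = (LINT x|M. (f x * h x) * g ((T ^^ n) x)) - Leb (\<lambda>x. f x * h x) * (LINT x|M. h x * g x)"
      by (simp add: mult_ac)
    finally have bound: "\<bar>correlation inv_measure T f g n\<bar> \<le> B * K * \<rho> ^ n * (LINT x|M. \<bar>g x\<bar>)"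
      using B[OF f gi(2), of n] by simp
    \<comment> \<open>The positive lower bound \<open>m\<close> of the density converts the Lebesgue
      integral of the modulus into one with respect to the invariant measure.\<close>
    have "(LINT x|M. \<bar>g x\<bar>) \<le> (LINT x|M. (h x * \<bar>g x\<bar>) / m)"
    proof (rule Bochner_Integration.integral_mono)
      show "integrable M (\<lambda>x. \<bar>g x\<bar>)" using gi(2) by simp
      show "integrable M (\<lambda>x. (h x * \<bar>g x\<bar>) / m)"
        using integrable_continuous_mult[OF X(1) h_cont, of "\<lambda>x. \<bar>g x\<bar>"] gi(2) by simp
      fix x assume "x \<in> space M"
      hence "m * \<bar>g x\<bar> \<le> h x * \<bar>g x\<bar>" using m(2)[of x] by (intro mult_right_mono) (auto simp: space_M)
      thus "\<bar>g x\<bar> \<le> (h x * \<bar>g x\<bar>) / m" using m(1) by (simp add: pos_le_divide_eq mult.commute)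
    qed
    also have "\<dots> = (LINT x|inv_measure. \<bar>g x\<bar>) / m" using gm(1) by (simp add: integral_inv_measure)
    finally have "(LINT x|M. \<bar>g x\<bar>) \<le> (LINT x|inv_measure. \<bar>g x\<bar>) / m" .
    hence "B * K * \<rho> ^ n * (LINT x|M. \<bar>g x\<bar>) \<le> B * K * \<rho> ^ n * ((LINT x|inv_measure. \<bar>g x\<bar>) / m)"
      using B0 K \<rho> by (intro mult_left_mono) auto
    with bound show ?thesis by (simp add: mult_ac)
  qed
  show "\<exists>C \<rho>. 0 < \<rho> \<and> \<rho> < 1 \<and> (\<forall>f g K n. hoelder_on (space inv_measure) \<gamma> K f \<longrightarrow> integrable inv_measure g \<longrightarrow>
      \<bar>correlation inv_measure T f g n\<bar> \<le> C * K * (LINT x|inv_measure. \<bar>g x\<bar>) * \<rho> ^ n)"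
  proof (rule exI, rule exI, intro conjI allI impI)
    show "0 < \<rho>" "\<rho> < 1" by (rule \<rho>)+
    fix f g :: "'a \<Rightarrow> real" and K n
    assume "hoelder_on (space inv_measure) \<gamma> K f" "integrable inv_measure g"
    thus "\<bar>correlation inv_measure T f g n\<bar> \<le> (B / m) * K * (LINT x|inv_measure. \<bar>g x\<bar>) * \<rho> ^ n"
      using main[of K f g n] by simp
  qed
qed

text \<open>The density of \<nu> is merely integrable, so its quotient by \<open>h\<close> is
  replaced by a Lipschitz \<open>u\<close> with a small \<open>L1\<close> error. Invariance equates
  the measure of \<open>A\<close> with that of its \<open>n\<close>-th preimage, and mixing sends
  the approximation to a multiple of the invariant measure with factor close to 1.\<close>

theorem inv_measure_unique:
  assumes \<nu>: "sets \<nu> = sets M" "emeasure \<nu> (space \<nu>) = 1" "absolutely_continuous M \<nu>"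
    and T: "T \<in> measurable \<nu> \<nu>" and inv: "distr \<nu> \<nu> T = \<nu>"
  shows "\<nu> = inv_measure"
proof -
  have sp: "space \<nu> = X" using sets_eq_imp_space_eq[OF \<nu>(1)] by (simp add: space_M)
  interpret N: finite_measure \<nu> using \<nu>(2) by (intro finite_measureI) simp
  interpret finite_measure M by (rule fin_measure)
  obtain q where q: "integrable M q" "\<And>x. 0 \<le> q x" "\<nu> = density M (\<lambda>x. ennreal (q x))"
    using Radon_Nikodym_real[OF N.finite_measure_axioms \<nu>(1,3)] by blast
  have em: "emeasure \<nu> A = ennreal (LINT x|M. q x * indicator A x)" if "A \<in> sets M" for A
    unfolding q(3) using q(1,2) that by (intro emeasure_density_integral) auto
  have nonneg: "0 \<le> (LINT x|M. q x * indicator A x)" for A using q(2) by (intro Bochner_Integration.integral_nonneg) simp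
  have XM: "X \<in> sets M" using sets.top[of M] by (simp only: space_M)
  have iter: "(T ^^ n) \<in> measurable M M" for n by (rule measurable_compose_n[OF T_measurable])
  have pre: "(T ^^ n) -` A \<inter> X \<in> sets M" if "A \<in> sets M" for A n
    using measurable_sets[OF iter that] by (simp add: space_M)
  have inv1: "emeasure \<nu> (T -` A \<inter> X) = emeasure \<nu> A" if "A \<in> sets M" for A
    using emeasure_distr[OF T, of A] that by (simp add: inv \<nu>(1) sp)
  have invn: "emeasure \<nu> ((T ^^ n) -` A \<inter> X) = emeasure \<nu> A" if A: "A \<in> sets M" for A n
  proof (induction n)
    case 0
    have "A \<subseteq> X" using sets.sets_into_space[OF A] by (simp add: space_M)
    thus ?case by (simp add: Int_absorb2)
  next
    case (Suc n)
    have "(T ^^ Suc n) -` A \<inter> X = T -` ((T ^^ n) -` A \<inter> X) \<inter> X" using T_in by (auto simp: funpow_swap1)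
    thus ?case using inv1[OF pre[OF A, of n]] Suc by (simp only:)
  qed
  obtain H where H: "\<And>x. x \<in> X \<Longrightarrow> h x \<le> H" by (rule h_bounds) (rule that, assumption)
  obtain B \<rho> where \<rho>: "0 < \<rho>" "\<rho> < 1" and B: "\<And>f g K n. hoelder_on X 1 K f \<Longrightarrow> integrable M g \<Longrightarrow>
      \<bar>(LINT x|M. (f x * h x) * g ((T ^^ n) x)) - Leb (\<lambda>x. f x * h x) * (LINT x|M. h x * g x)\<bar>
        \<le> B * K * \<rho> ^ n * (LINT x|M. \<bar>g x\<bar>)" by (rule decay[OF zero_less_one order_refl]) (rule that, assumption+)
  define f where "f x = inverse (h x) * q x" for x
  have "continuous_on X (\<lambda>x. inverse (h x))" using density_fun(4) by (intro continuous_intros h_cont) force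
  hence f: "integrable M f" unfolding f_def[abs_def] by (rule integrable_continuous_mult[OF X(1) _ q(1)])
  have fh: "f x * h x = q x" if "x \<in> X" for x using density_fun(4)[OF that] by (simp add: f_def)
  show ?thesis
  proof (rule measure_eqI)
    fix A assume "A \<in> sets \<nu>"
    hence A: "A \<in> sets M" by (simp add: \<nu>(1))
    let ?a = "LINT x|M. q x * indicator A x" and ?b = "LINT x|M. h x * indicator A x"
    have b: "0 \<le> ?b" "?b \<le> 1"
    proof -
      have "?b \<le> Leb h"
        by (rule Bochner_Integration.integral_mono[OF integrable_real_mult_indicator[OF A h_integrable] h_integrable])
          (use density_fun(4) in \<open>auto simp: space_M less_imp_le split: split_indicator\<close>)
      thus "?b \<le> 1" by (simp add: density_fun(2))
      show "0 \<le> ?b" by (rule Bochner_Integration.integral_nonneg_AE) (use h_nonneg in \<open>auto split: split_indicator\<close>)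
    qed
    have close: "\<bar>?a - ?b\<bar> \<le> 2 * (H * e)" if e: "e > 0" for e
    proof -
      obtain u K where u: "hoelder_on X 1 K u" and fu: "(LINT x|M. \<bar>f x - u x\<bar>) < e"
        using lipschitz_dense_L1[OF X(1) f e] by blast
      have uc: "continuous_on X u" by (rule hoelder_on_imp_continuous_on[OF u]) simp
      have ui: "integrable M u" by (rule integrable_cont[OF uc])
      \<comment> \<open>The error \<open>H * e\<close> does not depend on the set \<open>E\<close>,
        so it is the same for all preimages of \<open>A\<close>.\<close>
      have comp: "\<bar>(LINT x|M. q x * indicator E x) - (LINT x|M. (u x * h x) * indicator E x)\<bar> \<le> H * e"
        if E: "E \<in> sets M" for E
      proof -
        have i: "integrable M (\<lambda>x. q x * indicator E x)" "integrable M (\<lambda>x. (u x * h x) * indicator E x)"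
          by (intro integrable_real_mult_indicator E q(1) integrable_cont continuous_intros uc h_cont)+
        have "norm (LINT x|M. q x * indicator E x - (u x * h x) * indicator E x) \<le> (LINT x|M. H * \<bar>f x - u x\<bar>)"
        proof (rule Bochner_Integration.integral_norm_bound_integral)
          show "integrable M (\<lambda>x. q x * indicator E x - (u x * h x) * indicator E x)" using i by simp
          show "integrable M (\<lambda>x. H * \<bar>f x - u x\<bar>)" using f ui by simp
          fix x assume "x \<in> space M"
          hence x: "x \<in> X" by (simp add: space_M)
          have "norm (q x * indicator E x - (u x * h x) * indicator E x) \<le> \<bar>q x - u x * h x\<bar>"
            by (simp split: split_indicator)
          also have "\<dots> = h x * \<bar>f x - u x\<bar>"
            using density_fun(4)[OF x] fh[OF x] by (simp add: abs_mult flip: fh[OF x] left_diff_distrib)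
          also have "\<dots> \<le> H * \<bar>f x - u x\<bar>" using H[OF x] by (intro mult_right_mono) auto
          finally show "norm (q x * indicator E x - (u x * h x) * indicator E x) \<le> H * \<bar>f x - u x\<bar>" .
        qed
        also have "\<dots> = H * (LINT x|M. \<bar>f x - u x\<bar>)" by simp
        also have "\<dots> \<le> H * e"
        proof (rule mult_left_mono[OF less_imp_le[OF fu]])
          obtain x0 where "x0 \<in> X" using X_ne by blast
          thus "0 \<le> H" using H[of x0] density_fun(4)[of x0] by linarith
        qed
        finally show ?thesis using i by simp
      qed
      \<comment> \<open>By invariance the left side is free of \<open>n\<close>, so the last term
        can be made to vanish.\<close>
      have step: "\<bar>?a - Leb (\<lambda>x. u x * h x) * ?b\<bar> \<le> H * e + (B * K * (LINT x|M. \<bar>indicator A x\<bar>)) * \<rho> ^ n" for n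
      proof -
        let ?E = "(T ^^ n) -` A \<inter> X"
        have "ennreal (LINT x|M. q x * indicator ?E x) = ennreal ?a"
          using invn[OF A, of n] by (simp only: em[OF A] em[OF pre[OF A]])
        hence 1: "(LINT x|M. q x * indicator ?E x) = ?a" using nonneg by (simp only: ennreal_inj)
        have 2: "(LINT x|M. (u x * h x) * indicator ?E x) = (LINT x|M. (u x * h x) * indicator A ((T ^^ n) x))"
          by (rule Int_cong) (simp add: indicator_def)
        show ?thesis using comp[OF pre[OF A, of n]] B[OF u integrable_ind[OF A], of n]
          unfolding 1 2 by (simp add: mult_ac)
      qed
      have "(\<lambda>n. H * e + (B * K * (LINT x|M. \<bar>indicator A x\<bar>)) * \<rho> ^ n) \<longlonglongrightarrow>
          H * e + (B * K * (LINT x|M. \<bar>indicator A x\<bar>)) * 0"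
        using \<rho> by (intro tendsto_intros LIMSEQ_power_zero) auto
      hence lim: "\<bar>?a - Leb (\<lambda>x. u x * h x) * ?b\<bar> \<le> H * e"
        using step by (intro LIMSEQ_le_const[where X = "\<lambda>n. H * e + (B * K * (LINT x|M. \<bar>indicator A x\<bar>)) * \<rho> ^ n"]) auto
      have "(LINT x|M. q x * indicator X x) = 1"
      proof -
        have "ennreal (LINT x|M. q x * indicator X x) = ennreal 1" using \<nu>(2) em[OF XM] by (simp add: sp)
        thus ?thesis using nonneg by (simp only: ennreal_inj zero_le_one)
      qed
      moreover have "(LINT x|M. (u x * h x) * indicator X x) = Leb (\<lambda>x. u x * h x)" by (rule Int_cong) simp
      ultimately have one: "\<bar>1 - Leb (\<lambda>x. u x * h x)\<bar> \<le> H * e" using comp[OF XM] by simp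
      have "\<bar>?b - Leb (\<lambda>x. u x * h x) * ?b\<bar> = \<bar>1 - Leb (\<lambda>x. u x * h x)\<bar> * ?b"
        using b(1) by (simp add: abs_mult flip: left_diff_distrib[of 1 _ ?b, simplified])
      also have "\<dots> \<le> \<bar>1 - Leb (\<lambda>x. u x * h x)\<bar> * 1" using b(2) by (intro mult_left_mono) auto
      also have "\<dots> \<le> H * e" using one by simp
      finally have "\<bar>?b - Leb (\<lambda>x. u x * h x) * ?b\<bar> \<le> H * e" .
      with lim have "\<bar>?a - Leb (\<lambda>x. u x * h x) * ?b\<bar> + \<bar>?b - Leb (\<lambda>x. u x * h x) * ?b\<bar> \<le> H * e + H * e"
        by (rule add_mono)
      moreover have "\<bar>?a - ?b\<bar> \<le> \<bar>?a - Leb (\<lambda>x. u x * h x) * ?b\<bar> + \<bar>?b - Leb (\<lambda>x. u x * h x) * ?b\<bar>"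
        using abs_triangle_ineq4[of "?a - Leb (\<lambda>x. u x * h x) * ?b" "?b - Leb (\<lambda>x. u x * h x) * ?b"] by simp
      ultimately show ?thesis by simp
    qed
    have lims: "\<bar>?a - ?b\<bar> \<le> 0 + e" if "e > 0" for e
    proof -
      define d where "d = e / (2 * \<bar>H\<bar> + 1)"
      have "d > 0" using that by (simp add: d_def)
      hence "\<bar>?a - ?b\<bar> \<le> (2 * H) * d" using close[of d] by simp
      also have "\<dots> \<le> (2 * \<bar>H\<bar> + 1) * d" using \<open>d > 0\<close> by (intro mult_right_mono) auto
      also have "\<dots> = e" by (simp add: d_def)
      finally show ?thesis by simp
    qed
    have "\<bar>?a - ?b\<bar> \<le> 0" by (rule field_le_epsilon) (rule lims)
    hence "?a = ?b" by simp
    thus "emeasure \<nu> A = emeasure inv_measure A" by (simp only: em[OF A] emeasure_inv_measure[OF A])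
  qed (simp add: \<nu>(1))
qed

end

text \<open>On a probability space the integral of the modulus of \<open>g\<close> is at most its
  supremum, hence at most \<open>L\<close>.\<close>

lemma strongly_exp_mixing_imp_exp_decay_hoelder:
  assumes mix: "strongly_exp_mixing \<mu> T" and \<mu>: "emeasure \<mu> (space \<mu>) = 1"
    and meas: "\<And>\<gamma> L g. 0 < \<gamma> \<Longrightarrow> hoelder_on (space \<mu>) \<gamma> L g \<Longrightarrow> g \<in> borel_measurable \<mu>"
  shows "exp_decay_hoelder \<mu> T"
  unfolding exp_decay_hoelder_def
proof (intro allI impI, elim conjE)
  fix \<gamma> :: real assume \<gamma>: "0 < \<gamma>" "\<gamma> \<le> 1"
  interpret finite_measure \<mu> using \<mu> by (intro finite_measureI) simp
  obtain C \<rho> where \<rho>: "0 < \<rho>" "\<rho> < 1" and C: "\<And>f g K n. hoelder_on (space \<mu>) \<gamma> K f \<Longrightarrow> integrable \<mu> g \<Longrightarrow>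
     \<bar>correlation \<mu> T f g n\<bar> \<le> C * K * (LINT x|\<mu>. \<bar>g x\<bar>) * \<rho> ^ n"
    using mix \<gamma> unfolding strongly_exp_mixing_def by blast
  show "\<exists>C \<rho>. 0 < \<rho> \<and> \<rho> < 1 \<and> (\<forall>f g K L n. hoelder_on (space \<mu>) \<gamma> K f \<longrightarrow> hoelder_on (space \<mu>) \<gamma> L g \<longrightarrow>
      \<bar>correlation \<mu> T f g n\<bar> \<le> C * K * L * \<rho> ^ n)"
  proof (rule exI, rule exI, intro conjI allI impI)
    show "0 < \<rho>" "\<rho> < 1" by (rule \<rho>)+
    fix f g :: "'a \<Rightarrow> real" and K L :: real and n :: nat
    assume f: "hoelder_on (space \<mu>) \<gamma> K f" and g: "hoelder_on (space \<mu>) \<gamma> L g"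
    have gL: "\<bar>g x\<bar> \<le> L" if "x \<in> space \<mu>" for x using g that by (auto simp: hoelder_on_def)
    have gi: "integrable \<mu> g"
      using gL by (intro integrable_const_bound[of _ L] meas[OF \<gamma>(1) g]) auto
    have "(LINT x|\<mu>. \<bar>g x\<bar>) \<le> (LINT x|\<mu>. L)" using gi gL by (intro Bochner_Integration.integral_mono) auto
    also have "\<dots> = L" using \<mu> by (simp add: measure_def)
    finally have I: "(LINT x|\<mu>. \<bar>g x\<bar>) \<le> L" .
    obtain x0 where "x0 \<in> space \<mu>" using \<mu> by (cases "space \<mu> = {}") auto
    hence "\<bar>f x0\<bar> \<le> K" using f by (auto simp: hoelder_on_def)
    hence K: "0 \<le> K" by linarith
    have I0: "0 \<le> (LINT x|\<mu>. \<bar>g x\<bar>)" by simp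
    have "\<bar>correlation \<mu> T f g n\<bar> \<le> C * K * (LINT x|\<mu>. \<bar>g x\<bar>) * \<rho> ^ n" by (rule C[OF f gi])
    also have "\<dots> \<le> \<bar>C\<bar> * K * (LINT x|\<mu>. \<bar>g x\<bar>) * \<rho> ^ n" using K I0 \<rho> by (intro mult_right_mono) auto
    also have "\<dots> \<le> \<bar>C\<bar> * K * L * \<rho> ^ n" using K I \<rho> by (intro mult_right_mono mult_left_mono) auto
    finally show "\<bar>correlation \<mu> T f g n\<bar> \<le> \<bar>C\<bar> * K * L * \<rho> ^ n" .
  qed
qed

text \<open>Vector derivatives within a nondegenerate closed interval are unique even at its ends,
  so \<open>int_deriv G\<close> agrees with the complex derivative of the extension. Monotonicity
  comes from the mean value theorem.\<close>

lemma ex_gcm: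
  assumes "real_analytic_on G unit_int" and S: "S_shaped G"
    and dG: "\<forall>x\<in>unit_int. int_deriv G x \<le> 25 - 50 * \<bar>G x\<bar>"
  shows "\<exists>Gc Om. gcm G (int_deriv G) Gc Om"
proof -
  obtain Om Gc where Om: "open Om" "complex_of_real ` unit_int \<subseteq> Om" and Gc: "Gc holomorphic_on Om"
    "\<And>x. x \<in> unit_int \<Longrightarrow> Gc (of_real x) = of_real (G x)"
    using real_analytic_on_holomorphic_extension[OF assms(1)] by blast
  have bound: "\<bar>G x\<bar> \<le> 2 / 5" if "x \<in> unit_int" for x
  proof -
    have "G x \<in> {-2/5..2/5}" using S that unfolding S_shaped_def by blast
    thus ?thesis by auto
  qed
  have der: "(G has_vector_derivative int_deriv G x) (at x within unit_int)" if "x \<in> unit_int" for x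
    using S that unfolding S_shaped_def int_deriv_def differentiable_on_def by (blast intro: vector_derivative_works[THEN iffD1])
  have pos: "0 < int_deriv G x" if "x \<in> unit_int" for x using S that by (simp add: S_shaped_def)
  have "gcm G (int_deriv G) Gc Om"
  proof
    show "open Om" "Gc holomorphic_on Om" by fact+
    fix x :: real assume x: "x \<in> unit_int"
    show xOm: "complex_of_real x \<in> Om" using Om(2) x by blast
    show "Gc (of_real x) = of_real (G x)" by (rule Gc(2)[OF x])
    have "((\<lambda>t. Gc (of_real t)) has_vector_derivative deriv Gc (of_real x)) (at x within unit_int)"
      by (intro has_vector_derivative_real_field holomorphic_derivI[OF Gc(1) Om(1) xOm])
    moreover have "((\<lambda>t. Gc (of_real t)) has_vector_derivative of_real (int_deriv G x)) (at x within unit_int)"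
    proof (rule has_vector_derivative_transform[OF x])
      show "((\<lambda>t. complex_of_real (G t)) has_vector_derivative of_real (int_deriv G x)) (at x within unit_int)"
        using der[OF x] by (intro has_vector_derivative_of_real) (simp add: has_real_derivative_iff_has_vector_derivative)
    qed (rule Gc(2))
    ultimately show "deriv Gc (of_real x) = of_real (int_deriv G x)"
      using vector_derivative_unique_within_closed_interval[of "-1/2" "1/2" x] x by (simp add: unit_int_def)
    show "\<bar>G x\<bar> \<le> 2 / 5" by (rule bound[OF x])
    show "0 \<le> int_deriv G x" using pos[OF x] by simp
    show "int_deriv G x \<le> 25 - 50 * \<bar>G x\<bar>" using dG x by blast
  next
    fix x y :: real assume xy: "x \<in> unit_int" "y \<in> unit_int" "x \<le> y"
    have sub: "{x..y} \<subseteq> unit_int" using xy by (auto simp: unit_int_def)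
    have "\<exists>z\<in>{x..y}. G y - G x = (y - x) *\<^sub>R int_deriv G z"
    proof (rule mvt_very_simple[OF xy(3)])
      fix z assume "x \<le> z" "z \<le> y"
      hence "z \<in> unit_int" using sub by auto
      from has_vector_derivative_within_subset[OF der[OF this] sub]
      show "(G has_derivative (\<lambda>v. v *\<^sub>R int_deriv G z)) (at z within {x..y})"
        by (simp only: has_vector_derivative_def)
    qed
    then obtain z where "z \<in> {x..y}" "G y - G x = (y - x) * int_deriv G z" by auto
    moreover have "0 \<le> (y - x) * int_deriv G z" using pos[of z] sub xy(3) \<open>z \<in> {x..y}\<close> by (intro mult_nonneg_nonneg) (auto intro: less_imp_le)
    ultimately show "G x \<le> G y" by linarith
  qed
  thus ?thesis by blast
qed

context gcm
begin

lemma invariant_measure: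
  assumes c: "\<forall>r. \<bar>r\<bar> < 2/3 \<longrightarrow> c r \<in> unit_int"
  shows "\<exists>\<mu> :: (real ^ 'n) measure.
           acip (coupled_map c G) \<mu> \<and>
           (\<forall>\<nu>. acip (coupled_map c G) \<nu> \<longrightarrow> \<nu> = \<mu>) \<and>
           (\<exists>h. real_analytic_on h cube \<and> (\<forall>x\<in>cube. h x > 0) \<and>
                \<mu> = density (lebesgue_on cube) (\<lambda>x. ennreal (h x))) \<and>
           strongly_exp_mixing \<mu> (coupled_map c G) \<and>
           exp_decay_hoelder \<mu> (coupled_map c G)"
proof -
  let ?T = "coupled_map c G :: real ^ 'n \<Rightarrow> real ^ 'n"
  obtain C \<psi>c Jc d B where
    holo: "holo_branch_system (cube :: (real ^ 'n) set) UNIV branch branch_jac (20 / 21) C \<psi>c Jc d B"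
    using ex_holo_branch_system[where 'n = 'n] by (elim exE)
  interpret H: holo_branch_system "cube :: (real ^ 'n) set" UNIV branch branch_jac "20 / 21" C \<psi>c Jc d B
    by (rule holo)
  interpret D: branch_dynamics "cube :: (real ^ 'n) set" UNIV branch branch_jac "20 / 21" C ?T
  proof
    show "?T x \<in> cube" if "x \<in> cube" for x by (rule coupled_map_in_cube[OF c that])
    fix \<phi> g :: "real ^ 'n \<Rightarrow> real"
    assume *: "continuous_on cube \<phi>" "integrable (lebesgue_on cube) g"
    show "integrable (lebesgue_on cube) (\<lambda>x. \<phi> x * g (?T x))"
      by (rule transfer_duality(1)[OF *])
    show "(LINT x|lebesgue_on cube. \<phi> x * g (?T x)) = (LINT x|lebesgue_on cube. H.transfer \<phi> x * g x)"
      unfolding H.transfer_def by (rule transfer_duality(2)[OF *])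
  qed
  let ?\<mu> = D.inv_measure
  have prob: "emeasure ?\<mu> (space ?\<mu>) = 1" by (simp only: D.space_inv_measure D.emeasure_inv_measure_X)
  have acip: "acip ?T ?\<mu>"
    unfolding acip_def
  proof (intro conjI)
    show "sets ?\<mu> = sets (lebesgue_on cube)" by (rule D.sets_inv_measure)
    show "emeasure ?\<mu> (space ?\<mu>) = 1" by (rule prob)
    show "absolutely_continuous (lebesgue_on cube) ?\<mu>"
      unfolding D.inv_measure_def using D.h_integrable by (intro absolutely_continuousI_density) auto
    show "?T \<in> measurable ?\<mu> ?\<mu>"
      using D.T_measurable by (simp add: measurable_cong_sets[OF D.sets_inv_measure D.sets_inv_measure])
    show "distr ?\<mu> ?\<mu> ?T = ?\<mu>" by (rule D.distr_inv_measure)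
  qed
  have decay: "exp_decay_hoelder ?\<mu> ?T"
  proof (rule strongly_exp_mixing_imp_exp_decay_hoelder[OF D.inv_measure_mixing prob])
    fix \<gamma> L and g :: "real ^ 'n \<Rightarrow> real"
    assume "0 < \<gamma>" "hoelder_on (space ?\<mu>) \<gamma> L g"
    hence "continuous_on cube g" by (auto intro: hoelder_on_imp_continuous_on)
    hence "g \<in> borel_measurable (lebesgue_on cube)"
      by (rule continuous_imp_measurable_on_sets_lebesgue[OF _ cube_sets])
    thus "g \<in> borel_measurable ?\<mu>" by (simp add: measurable_cong_sets[OF D.sets_inv_measure refl])
  qed
  show ?thesis
  proof (rule exI[of _ ?\<mu>], intro conjI allI impI)
    show "\<nu> = ?\<mu>" if "acip ?T \<nu>" for \<nu>
      using that unfolding acip_def by (elim conjE) (rule D.inv_measure_unique)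
    show "\<exists>h. real_analytic_on h cube \<and> (\<forall>x\<in>cube. h x > 0) \<and> ?\<mu> = density (lebesgue_on cube) (\<lambda>x. ennreal (h x))"
      by (rule exI[of _ H.density_fun]) (use H.density_fun_analytic H.density_fun(4) D.inv_measure_def in blast)
  qed (rule acip D.inv_measure_mixing decay)+
qed

end

theorem theorem1:
  fixes G c :: "real \<Rightarrow> real"
  assumes "real_analytic_on G unit_int"
    and "S_shaped G"
    and "\<forall>x\<in>unit_int. int_deriv G x \<le> 25 - 50 * \<bar>G x\<bar>"
    and "\<forall>r. \<bar>r\<bar> < 2/3 \<longrightarrow> c r \<in> unit_int"
  shows "\<exists>\<mu> :: (real ^ 'n) measure.
           acip (coupled_map c G) \<mu> \<and>
           (\<forall>\<nu>. acip (coupled_map c G) \<nu> \<longrightarrow> \<nu> = \<mu>) \<and>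
           (\<exists>h. real_analytic_on h cube \<and> (\<forall>x\<in>cube. h x > 0) \<and>
                \<mu> = density (lebesgue_on cube) (\<lambda>x. ennreal (h x))) \<and>
           strongly_exp_mixing \<mu> (coupled_map c G) \<and>
           exp_decay_hoelder \<mu> (coupled_map c G)"
proof -
  obtain Gc Om where "gcm G (int_deriv G) Gc Om" using ex_gcm[OF assms(1-3)] by (elim exE)
  thus ?thesis using assms(4) by (rule gcm.invariant_measure)
qed

end
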